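(* For every real $\beta>1$, the transformation $T_{-\beta}$ has a unique maximal entropy measure, i.e. $T_{-\beta}$ is intrinsic.
   Context: For real $\beta>1$, $T_{-\beta}:(0,1]\to(0,1]$, $x\mapsto -\beta x+\lfloor \beta x\rfloor+1$. A maximal entropy measure of a dynamical system is an invariant (Borel probability) measure that maximises the (measure-theoretic) entropy among all invariant probability measures. A dynamical system with a unique maximal entropy measure is called intrinsic. *)

theory Defs
  imports "HOL-Probability.Probability"
begin

text \<open>A dynamical system is a map \<open>T\<close> on a measurable space \<open>X\<close>. The latter is given as a value of
  type \<open>'a measure\<close> of which only \<open>space X\<close> and \<open>sets X\<close> matter.\<close>

definition invariant_prob :: "'a measure \<Rightarrow> ('a \<Rightarrow> 'a) \<Rightarrow> 'a measure \<Rightarrow> bool" where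
  "invariant_prob X T \<mu> \<longleftrightarrow>
     sets \<mu> = sets X \<and> prob_space \<mu> \<and> T \<in> measurable \<mu> \<mu> \<and>
     (\<forall>A\<in>sets \<mu>. emeasure \<mu> (T -` A \<inter> space \<mu>) = emeasure \<mu> A)"

definition measurable_partition :: "'a measure \<Rightarrow> 'a set set \<Rightarrow> bool" where
  "measurable_partition \<mu> P \<longleftrightarrow> finite P \<and> P \<subseteq> sets \<mu> \<and> partition_on (space \<mu>) P"

text \<open>The convention \<open>0 * ln 0 = 0\<close> holds automatically.\<close>

definition partition_entropy :: "'a measure \<Rightarrow> 'a set set \<Rightarrow> real" where
  "partition_entropy \<mu> P = - (\<Sum>A\<in>P. measure \<mu> A * ln (measure \<mu> A))"

definition pullback_partition :: "'a measure \<Rightarrow> ('a \<Rightarrow> 'a) \<Rightarrow> 'a set set \<Rightarrow> 'a set set" where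
  "pullback_partition \<mu> S P = (\<lambda>A. S -` A \<inter> space \<mu>) ` P - {{}}"

text \<open>The join of the pullbacks of \<open>P\<close> under \<open>T ^^ i\<close> for \<open>i < n\<close>; only \<open>n \<ge> 1\<close> is meaningful.\<close>

definition iterated_join :: "'a measure \<Rightarrow> ('a \<Rightarrow> 'a) \<Rightarrow> 'a set set \<Rightarrow> nat \<Rightarrow> 'a set set" where
  "iterated_join \<mu> T P n = common_refinement ((\<lambda>i. pullback_partition \<mu> (T ^^ i) P) ` {..<n})"

text \<open>For an invariant probability measure and a finite measurable partition the limit exists, by
  subadditivity.\<close>

definition entropy_wrt_partition :: "'a measure \<Rightarrow> ('a \<Rightarrow> 'a) \<Rightarrow> 'a set set \<Rightarrow> real" where
  "entropy_wrt_partition \<mu> T P = lim (\<lambda>n. partition_entropy \<mu> (iterated_join \<mu> T P n) / real n)"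

text \<open>Kolmogorov--Sinai entropy, possibly infinite.\<close>

definition ks_entropy :: "'a measure \<Rightarrow> ('a \<Rightarrow> 'a) \<Rightarrow> ereal" where
  "ks_entropy \<mu> T = (SUP P \<in> {P. measurable_partition \<mu> P}. ereal (entropy_wrt_partition \<mu> T P))"

definition maximal_entropy_measure :: "'a measure \<Rightarrow> ('a \<Rightarrow> 'a) \<Rightarrow> 'a measure \<Rightarrow> bool" where
  "maximal_entropy_measure X T \<mu> \<longleftrightarrow>
     invariant_prob X T \<mu> \<and> (\<forall>\<nu>. invariant_prob X T \<nu> \<longrightarrow> ks_entropy \<nu> T \<le> ks_entropy \<mu> T)"

definition intrinsic :: "'a measure \<Rightarrow> ('a \<Rightarrow> 'a) \<Rightarrow> bool" where
  "intrinsic X T \<longleftrightarrow> (\<exists>!\<mu>. maximal_entropy_measure X T \<mu>)"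

text \<open>The transformation is a self-map of the half-open interval; its values elsewhere play no role.\<close>

definition T_neg_beta :: "real \<Rightarrow> real \<Rightarrow> real" where
  "T_neg_beta \<beta> x = - \<beta> * x + of_int \<lfloor>\<beta> * x\<rfloor> + 1"

definition unit_borel :: "real measure" where
  "unit_borel = restrict_space borel {0<..1}"

lemma space_unit_borel: "space unit_borel = {0<..1}"
  by (simp add: unit_borel_def space_restrict_space)

lemma T_neg_beta_in_unit: "T_neg_beta \<beta> x \<in> {0<..1}"
proof -
  have "T_neg_beta \<beta> x = 1 - frac (\<beta> * x)"
    by (simp add: T_neg_beta_def frac_def)
  then show ?thesis
    using frac_ge_0[of "\<beta> * x"] frac_lt_1[of "\<beta> * x"] by simp
qed

lemma measurable_T_neg_beta: "T_neg_beta \<beta> \<in> measurable unit_borel unit_borel"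
proof -
  have "T_neg_beta \<beta> \<in> borel_measurable borel"
    unfolding T_neg_beta_def by measurable
  then have "T_neg_beta \<beta> \<in> borel_measurable (restrict_space borel {0<..1})"
    by (rule measurable_restrict_space1)
  moreover have "T_neg_beta \<beta> \<in> space (restrict_space borel {0<..1}) \<rightarrow> {0<..1}"
    using T_neg_beta_in_unit by (rule Pi_I)
  ultimately show ?thesis
    unfolding unit_borel_def by (intro measurable_restrict_space2)
qed

lemma partition_on_pullback:
  assumes "partition_on (space \<mu>) P" "S \<in> space \<mu> \<rightarrow> space \<mu>"
  shows "partition_on (space \<mu>) (pullback_partition \<mu> S P)"
proof (rule partition_onI)
  have "x \<in> \<Union> (pullback_partition \<mu> S P)" if x: "x \<in> space \<mu>" for x
  proof -
    have "S x \<in> \<Union>P" using assms x by (auto simp: partition_on_def)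
    then obtain A where "A \<in> P" "S x \<in> A" by blast
    with x have "x \<in> S -` A \<inter> space \<mu>" "S -` A \<inter> space \<mu> \<in> pullback_partition \<mu> S P"
      by (auto simp: pullback_partition_def)
    then show ?thesis by blast
  qed
  then show "\<Union> (pullback_partition \<mu> S P) = space \<mu>"
    by (auto simp: pullback_partition_def)
next
  fix p q
  assume "p \<in> pullback_partition \<mu> S P" "q \<in> pullback_partition \<mu> S P" and "p \<noteq> q"
  then obtain A B where AB: "A \<in> P" "B \<in> P" "p = S -` A \<inter> space \<mu>" "q = S -` B \<inter> space \<mu>"
    by (auto simp: pullback_partition_def)
  with \<open>p \<noteq> q\<close> have "A \<noteq> B" by blast
  then have "A \<inter> B = {}"
    using assms(1) AB by (meson disjointD partition_on_def)
  with AB show "disjnt p q" by (auto simp: disjnt_def)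
qed (simp add: pullback_partition_def)

lemma partition_on_iterated_join:
  assumes "partition_on (space \<mu>) P" "T \<in> space \<mu> \<rightarrow> space \<mu>" "n \<ge> 1"
  shows "partition_on (space \<mu>) (iterated_join \<mu> T P n)"
proof -
  have "T ^^ i \<in> space \<mu> \<rightarrow> space \<mu>" for i
    using assms(2) by (induction i) auto
  then have "partition_on (space \<mu>) (pullback_partition \<mu> (T ^^ i) P)" for i
    using assms(1) by (intro partition_on_pullback)
  moreover have "{..<n} \<noteq> {}"
    using assms(3) by (simp add: lessThan_empty_iff)
  ultimately show ?thesis
    unfolding iterated_join_def
    by (intro partition_on_common_refinement) (blast, simp)
qed

end

theory Submission
  imports Defs
begin

text \<open>Let \<open>\<lambda>\<close> be Lebesgue measure on the unit interval. The image of an \<open>n\<close>-cylinder under \<open>T ^^ n\<close> is an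
  interval, and all but few \<open>n\<close>-cylinders have a long image; since \<open>T ^^ n\<close> expands lengths by
  \<open>\<beta> ^ n\<close>, there are at most \<open>C * \<beta> ^ n\<close> of them, so that every entropy is at most \<open>ln \<beta>\<close>. In the same
  way, for large \<open>n\<close> only a small proportion of \<open>\<beta> ^ n\<close> cylinders meets a given compact \<open>\<lambda>\<close>-null set.
  A measure charging such a set therefore has entropy less than \<open>ln \<beta>\<close>, that is, every measure of
  entropy \<open>ln \<beta>\<close> is absolutely continuous.

  There is at most one absolutely continuous invariant probability measure. Otherwise the positive
  and negative part of the difference of two densities are again invariant, and their supports
  contain disjoint forward invariant sets of positive measure. By a density argument and
  expansion each of them contains a left neighbourhood of 1 up to a null set, a contradiction.

  The alternating series \<open>dens\<close> is a bounded signed invariant density that does not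
  vanish near 1. Its positive or its negative part yields an invariant measure bounded by a
  multiple of \<open>\<lambda>\<close>, and such a measure has entropy \<open>ln \<beta>\<close>.\<close>

section \<open>Entropy of finite-valued functions\<close>

text \<open>Kolmogorov--Sinai entropy is a supremum over all finite partitions. It reduces to the
  partition by digits: \<open>n\<close>-cylinders have diameter at most
  \<open>1 / \<beta> ^ n\<close>, so unions of them approximate every Borel set with respect to
  every invariant measure. The obstacle is that a cylinder may be a single point. Counting by
  Lebesgue measure does not see such cylinders, yet a measure with atoms may charge them. Atoms are
  periodic, and the orbit of a one-point cylinder hits a discontinuity or 1, so the number of
  charged ones is bounded independently of \<open>n\<close>. For this reason the counts that enter
  an entropy bound concern charged cylinders only. The strict drop of entropy comes from
  subadditivity: the entropy rate is at most the entropy at time \<open>N\<close> divided by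
  \<open>N\<close>, for every single \<open>N\<close>. Estimates with additive constants therefore
  suffice, provided that at one \<open>N\<close> the saving on the charged null set exceeds these
  constants.\<close>

definition fibre_prob :: "'a measure \<Rightarrow> ('a \<Rightarrow> 'b) \<Rightarrow> 'b \<Rightarrow> real" where
  "fibre_prob M X v = measure M (X -` {v} \<inter> space M)"

text \<open>Shannon entropy. Functions take the place of partitions, so that joins become pairs or
  lists of functions.\<close>

definition ent :: "'a measure \<Rightarrow> ('a \<Rightarrow> 'b) \<Rightarrow> real" where
  "ent M X = - (\<Sum>v\<in>X ` space M. fibre_prob M X v * ln (fibre_prob M X v))"

context prob_space
begin

lemma fibre_prob_nonneg [simp]: "fibre_prob M X v \<ge> 0"
  by (simp add: fibre_prob_def)

text \<open>Expectation as a sum over values. It turns sums over the ranges of different functions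
  into integrals over one space, where they can be compared.\<close>

lemma sum_fibre_prob:
  assumes "simple_function M X"
  shows "(\<Sum>v\<in>X ` space M. fibre_prob M X v * g v) = (\<integral>\<omega>. g (X \<omega>) \<partial>M)"
proof -
  have fin: "finite (X ` space M)" and meas: "\<And>v. X -` {v} \<inter> space M \<in> events"
    using assms by (auto dest: simple_functionD)
  have "(\<integral>\<omega>. g (X \<omega>) \<partial>M) =
      (\<integral>\<omega>. (\<Sum>v\<in>X ` space M. indicator (X -` {v} \<inter> space M) \<omega> * g v) \<partial>M)"
  proof (rule Bochner_Integration.integral_cong)
    fix \<omega> assume "\<omega> \<in> space M"
    then have "(\<Sum>v\<in>X ` space M. indicator (X -` {v} \<inter> space M) \<omega> * g v) =
        (\<Sum>v\<in>X ` space M. if v = X \<omega> then g v else 0)"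
      by (intro sum.cong) auto
    with \<open>\<omega> \<in> space M\<close> fin show
      "g (X \<omega>) = (\<Sum>v\<in>X ` space M. indicator (X -` {v} \<inter> space M) \<omega> * g v)"
      by simp
  qed simp
  also have "\<dots> = (\<Sum>v\<in>X ` space M. (\<integral>\<omega>. indicator (X -` {v} \<inter> space M) \<omega> * g v \<partial>M))"
    by (intro Bochner_Integration.integral_sum integrable_mult_left)
      (auto intro!: integrable_real_indicator meas simp: less_top[symmetric])
  also have "\<dots> = (\<Sum>v\<in>X ` space M. fibre_prob M X v * g v)"
    by (intro sum.cong) (simp_all add: fibre_prob_def)
  finally show ?thesis ..
qed

lemma sum_fibre_prob_eq_1:
  "simple_function M X \<Longrightarrow> (\<Sum>v\<in>X ` space M. fibre_prob M X v) = 1"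
  using sum_fibre_prob[of X "\<lambda>_. 1"] by (simp add: prob_space)

lemma ent_eq_integral:
  "simple_function M X \<Longrightarrow> ent M X = - (\<integral>\<omega>. ln (fibre_prob M X (X \<omega>)) \<partial>M)"
  by (simp add: ent_def sum_fibre_prob[of X "\<lambda>v. ln (fibre_prob M X v)"])

lemma fibre_prob_le:
  assumes "simple_function M X"
    and "\<And>\<omega>. \<omega> \<in> space M \<Longrightarrow> Y \<omega> = y \<Longrightarrow> X \<omega> = x"
  shows "fibre_prob M Y y \<le> fibre_prob M X x"
  unfolding fibre_prob_def using assms by (intro finite_measure_mono) (auto dest: simple_functionD)

text \<open>Nonnegativity of relative entropy, from \<open>ln t \<le> t - 1\<close>. The weights are
  summed over charged values only, because the uncharged degenerate cylinders will not be
  counted.\<close>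

lemma gibbs_inequality:
  assumes X: "simple_function M X"
    and q: "\<And>v. v \<in> X ` space M \<Longrightarrow> fibre_prob M X v > 0 \<Longrightarrow> q v > 0"
    and sum: "(\<Sum>v | v \<in> X ` space M \<and> fibre_prob M X v > 0. q v) \<le> 1"
  shows "ent M X \<le> - (\<Sum>v\<in>X ` space M. fibre_prob M X v * ln (q v))"
proof -
  let ?p = "fibre_prob M X" and ?V = "{v. v \<in> X ` space M \<and> fibre_prob M X v > 0}"
  have fin: "finite (X ` space M)"
    using X by (rule simple_functionD)
  have restrict: "(\<Sum>v\<in>X ` space M. ?p v * f v) = (\<Sum>v\<in>?V. ?p v * f v)" for f :: "_ \<Rightarrow> real"
    using fin by (intro sum.mono_neutral_right) (auto simp: less_le)
  have "(\<Sum>v\<in>?V. ?p v * ln (q v)) - (\<Sum>v\<in>?V. ?p v * ln (?p v)) \<le> (\<Sum>v\<in>?V. q v - ?p v)"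
    unfolding sum_subtractf[symmetric]
  proof (rule sum_mono)
    fix v assume v: "v \<in> ?V"
    with q have "q v > 0" by auto
    with v have "ln (q v) - ln (?p v) \<le> q v / ?p v - 1"
      using ln_le_minus_one[of "q v / ?p v"] by (simp add: ln_div)
    with v have "?p v * (ln (q v) - ln (?p v)) \<le> ?p v * (q v / ?p v - 1)"
      by (intro mult_left_mono) auto
    with v show "?p v * ln (q v) - ?p v * ln (?p v) \<le> q v - ?p v"
      by (simp add: algebra_simps)
  qed
  also have "\<dots> \<le> 0"
    using sum restrict[of "\<lambda>_. 1"] sum_fibre_prob_eq_1[OF X] by (simp add: sum_subtractf)
  finally show ?thesis
    unfolding ent_def restrict by simp
qed

text \<open>\<open>Y\<close> is a function of \<open>X\<close> on the space, so every fibre of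
  \<open>X\<close> lies in a fibre of \<open>Y\<close>, which has at least its probability.\<close>

lemma ent_mono:
  assumes X: "simple_function M X" and Y: "simple_function M Y"
    and det: "\<And>x y. x \<in> space M \<Longrightarrow> y \<in> space M \<Longrightarrow> X x = X y \<Longrightarrow> Y x = Y y"
  shows "ent M Y \<le> ent M X"
proof -
  obtain f where f: "\<And>x. x \<in> space M \<Longrightarrow> f (X x) = Y x"
  proof
    fix x assume x: "x \<in> space M"
    show "Y (inv_into (space M) X (X x)) = Y x"
      using x by (intro det) (auto intro: inv_into_into f_inv_into_f)
  qed
  have "(\<Sum>v\<in>X ` space M. fibre_prob M X v * ln (fibre_prob M X v)) \<le>
      (\<Sum>v\<in>X ` space M. fibre_prob M X v * ln (fibre_prob M Y (f v)))"
  proof (intro sum_mono)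
    fix v assume "v \<in> X ` space M"
    have "fibre_prob M X v \<le> fibre_prob M Y (f v)"
      using f by (intro fibre_prob_le[OF Y]) auto
    then show "fibre_prob M X v * ln (fibre_prob M X v) \<le> fibre_prob M X v * ln (fibre_prob M Y (f v))"
      using less_le_trans[of 0 "fibre_prob M X v" "fibre_prob M Y (f v)"]
      by (cases "fibre_prob M X v = 0") (auto intro!: mult_left_mono simp: less_le)
  qed
  also have "\<dots> = (\<integral>\<omega>. ln (fibre_prob M Y (f (X \<omega>))) \<partial>M)"
    by (rule sum_fibre_prob[OF X])
  also have "\<dots> = (\<integral>\<omega>. ln (fibre_prob M Y (Y \<omega>)) \<partial>M)"
    using f by (intro Bochner_Integration.integral_cong) auto
  also have "\<dots> = - ent M Y"
    by (simp add: ent_eq_integral[OF Y])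
  finally show ?thesis
    by (simp add: ent_def)
qed

lemma sum_fibre_prob_Pair:
  assumes X: "simple_function M X" and Y: "simple_function M Y"
  shows "(\<Sum>x\<in>X ` space M. fibre_prob M (\<lambda>\<omega>. (X \<omega>, Y \<omega>)) (x, y)) = fibre_prob M Y y"
proof -
  have "(\<Sum>x\<in>X ` space M. fibre_prob M (\<lambda>\<omega>. (X \<omega>, Y \<omega>)) (x, y)) =
      measure M (\<Union>x\<in>X ` space M. (\<lambda>\<omega>. (X \<omega>, Y \<omega>)) -` {(x, y)} \<inter> space M)"
    unfolding fibre_prob_def using simple_functionD[OF X] simple_functionD[OF simple_function_Pair[OF X Y]]
    by (intro finite_measure_finite_Union[symmetric]) (auto simp: disjoint_family_on_def)
  also have "(\<Union>x\<in>X ` space M. (\<lambda>\<omega>. (X \<omega>, Y \<omega>)) -` {(x, y)} \<inter> space M) = Y -` {y} \<inter> space M"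
    by auto
  finally show ?thesis by (simp add: fibre_prob_def)
qed

lemma fibre_prob_swap:
  "fibre_prob M (\<lambda>\<omega>. (X \<omega>, Y \<omega>)) (x, y) = fibre_prob M (\<lambda>\<omega>. (Y \<omega>, X \<omega>)) (y, x)"
  unfolding fibre_prob_def by (rule arg_cong[where f="measure M"]) auto

text \<open>Nonnegativity of conditional mutual information: Gibbs' inequality against the law
  \<open>?q\<close> that makes \<open>X\<close> and \<open>Z\<close> conditionally independent given
  \<open>Y\<close>.\<close>

lemma ent_submodular:
  assumes X: "simple_function M X" and Y: "simple_function M Y" and Z: "simple_function M Z"
  shows "ent M (\<lambda>\<omega>. (X \<omega>, Y \<omega>, Z \<omega>)) + ent M Y \<le>
    ent M (\<lambda>\<omega>. (X \<omega>, Y \<omega>)) + ent M (\<lambda>\<omega>. (Y \<omega>, Z \<omega>))"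
proof -
  let ?W = "\<lambda>\<omega>. (X \<omega>, Y \<omega>, Z \<omega>)" and ?XY = "\<lambda>\<omega>. (X \<omega>, Y \<omega>)" and ?YZ = "\<lambda>\<omega>. (Y \<omega>, Z \<omega>)"
  let ?q = "\<lambda>(x, y, z). fibre_prob M ?XY (x, y) * fibre_prob M ?YZ (y, z) / fibre_prob M Y y"
  have XY: "simple_function M ?XY" and YZ: "simple_function M ?YZ" and W: "simple_function M ?W"
    using X Y Z by (auto intro: simple_function_Pair)
  note fin = simple_functionD(1)[OF X] simple_functionD(1)[OF Y] simple_functionD(1)[OF Z]
  have le: "fibre_prob M ?W (x, y, z) \<le> fibre_prob M ?XY (x, y)"
     "fibre_prob M ?W (x, y, z) \<le> fibre_prob M ?YZ (y, z)"
     "fibre_prob M ?W (x, y, z) \<le> fibre_prob M Y y" for x y z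
    by (auto intro: fibre_prob_le XY YZ Y)
  have pos: "fibre_prob M ?XY (x, y) > 0 \<and> fibre_prob M ?YZ (y, z) > 0 \<and> fibre_prob M Y y > 0"
    if "fibre_prob M ?W (x, y, z) > 0" for x y z
    using le[of x y z] that by linarith
  have "ent M ?W \<le> - (\<Sum>v\<in>?W ` space M. fibre_prob M ?W v * ln (?q v))"
  proof (rule gibbs_inequality[OF W])
    show "?q v > 0" if "fibre_prob M ?W v > 0" for v
      using pos that by (cases v) auto
    have "(\<Sum>v | v \<in> ?W ` space M \<and> fibre_prob M ?W v > 0. ?q v) \<le>
        (\<Sum>v\<in>X ` space M \<times> Y ` space M \<times> Z ` space M. ?q v)"
      using fin by (intro sum_mono2) auto
    also have "\<dots> = (\<Sum>y\<in>Y ` space M. (\<Sum>x\<in>X ` space M. fibre_prob M ?XY (x, y)) *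
        (\<Sum>z\<in>Z ` space M. fibre_prob M ?YZ (y, z)) / fibre_prob M Y y)"
      unfolding sum_product sum_divide_distrib sum.cartesian_product[symmetric]
      by (subst sum.swap) (simp add: sum.cartesian_product split_beta)
    \<comment> \<open>Both inner sums are marginals, leaving \<open>p * p / p\<close> for a
      probability \<open>p\<close> of \<open>Y\<close>. This is \<open>p\<close> also for
      \<open>p = 0\<close>, as division by zero yields 0.\<close>
    also have "\<dots> = (\<Sum>y\<in>Y ` space M. fibre_prob M Y y)"
      by (subst (2) fibre_prob_swap) (simp add: sum_fibre_prob_Pair X Y Z)
    finally show "(\<Sum>v | v \<in> ?W ` space M \<and> fibre_prob M ?W v > 0. ?q v) \<le> 1"
      by (simp add: sum_fibre_prob_eq_1[OF Y])
  qed
  also have "(\<Sum>v\<in>?W ` space M. fibre_prob M ?W v * ln (?q v)) =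
      (\<Sum>v\<in>?W ` space M. fibre_prob M ?W v * ln (fibre_prob M ?XY (fst v, fst (snd v)))) +
      (\<Sum>v\<in>?W ` space M. fibre_prob M ?W v * ln (fibre_prob M ?YZ (snd v))) -
      (\<Sum>v\<in>?W ` space M. fibre_prob M ?W v * ln (fibre_prob M Y (fst (snd v))))"
    unfolding sum.distrib[symmetric] sum_subtractf[symmetric]
  proof (intro sum.cong refl)
    fix v
    show "fibre_prob M ?W v * ln (?q v) =
      fibre_prob M ?W v * ln (fibre_prob M ?XY (fst v, fst (snd v))) +
      fibre_prob M ?W v * ln (fibre_prob M ?YZ (snd v)) -
      fibre_prob M ?W v * ln (fibre_prob M Y (fst (snd v)))"
    proof (cases "fibre_prob M ?W v = 0")
      case False
      obtain x y z where "v = (x, y, z)" by (cases v)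
      with False pos[of x y z] show ?thesis
        by (simp add: less_le ln_mult ln_div algebra_simps)
    qed simp
  qed
  also have "\<dots> = - ent M ?XY - ent M ?YZ + ent M Y"
    by (simp add: sum_fibre_prob[OF W] ent_eq_integral XY YZ Y)
  finally show ?thesis by simp
qed

text \<open>Submodularity over a constant function, whose entropy is 0.\<close>

lemma ent_Pair_le:
  assumes X: "simple_function M X" and Z: "simple_function M Z"
  shows "ent M (\<lambda>\<omega>. (X \<omega>, Z \<omega>)) \<le> ent M X + ent M Z"
proof -
  let ?u = "\<lambda>_. ()"
  have u: "simple_function M ?u" by simp
  have "ent M ?u = 0"
    using not_empty by (simp add: ent_def fibre_prob_def image_constant_conv prob_space)
  moreover have "ent M (\<lambda>\<omega>. (X \<omega>, Z \<omega>)) \<le> ent M (\<lambda>\<omega>. (X \<omega>, (), Z \<omega>))"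
    using X Z u by (intro ent_mono simple_function_Pair) auto
  moreover have "ent M (\<lambda>\<omega>. (X \<omega>, ())) \<le> ent M X"
    using X u by (intro ent_mono simple_function_Pair) auto
  moreover have "ent M (\<lambda>\<omega>. ((), Z \<omega>)) \<le> ent M Z"
    using Z u by (intro ent_mono simple_function_Pair) auto
  ultimately show ?thesis
    using ent_submodular[OF X u Z] by linarith
qed

text \<open>The conditional entropy of \<open>Y\<close> given \<open>X\<close> is small if every fibre of \<open>Y\<close> is close to a union
  of fibres of \<open>X\<close>: terms \<open>- t * ln t\<close> are bounded by \<open>1 - t\<close> on that union and by the tangent line
  \<open>a - t * ln a\<close> off it.\<close>

lemma cond_ent_le:
  assumes X: "simple_function M X" and Y: "simple_function M Y"
    and a: "0 < a" "a \<le> 1"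
    and approx: "\<And>v. v \<in> Y ` space M \<Longrightarrow>
      \<exists>S. measure M {\<omega> \<in> space M. (Y \<omega> = v) \<noteq> (X \<omega> \<in> S)} \<le> e"
  shows "ent M (\<lambda>\<omega>. (X \<omega>, Y \<omega>)) - ent M X \<le> card (Y ` space M) * (e + a - e * ln a)"
proof -
  let ?XY = "\<lambda>\<omega>. (X \<omega>, Y \<omega>)" and ?A = "X ` space M" and ?B = "Y ` space M"
  let ?p = "fibre_prob M X" and ?r = "fibre_prob M ?XY"
  have XY: "simple_function M ?XY" using X Y by (rule simple_function_Pair)
  note fin = simple_functionD(1)[OF X] simple_functionD(1)[OF Y]
  have le: "?r (x, y) \<le> ?p x" for x y
    by (rule fibre_prob_le[OF X]) auto
  have empty: "?r v = 0" if "v \<notin> ?XY ` space M" for v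
  proof -
    have "?XY -` {v} \<inter> space M = {}" using that by auto
    then show ?thesis by (simp add: fibre_prob_def)
  qed
  have ev: "{\<omega> \<in> space M. Q (X \<omega>) (Y \<omega>)} \<in> events" for Q
  proof -
    have "{\<omega> \<in> space M. Q (X \<omega>) (Y \<omega>)} =
        (\<Union>v\<in>{v \<in> ?XY ` space M. Q (fst v) (snd v)}. ?XY -` {v} \<inter> space M)" by auto
    also have "\<dots> \<in> events"
      using simple_functionD[OF XY] by (intro sets.finite_UN) auto
    finally show ?thesis .
  qed
  have "ent M ?XY - ent M X = - (\<Sum>v\<in>?XY ` space M. ?r v * ln (?r v)) + (\<Sum>v\<in>?XY ` space M. ?r v * ln (?p (fst v)))"
    by (simp add: sum_fibre_prob[OF XY] ent_eq_integral XY X)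
  also have "\<dots> = (\<Sum>v\<in>?XY ` space M. ?r v * (ln (?p (fst v)) - ln (?r v)))"
    by (simp add: sum_subtractf right_diff_distrib)
  also have "\<dots> = (\<Sum>v\<in>?A \<times> ?B. ?r v * (ln (?p (fst v)) - ln (?r v)))"
    using fin empty by (intro sum.mono_neutral_left) auto
  also have "\<dots> = (\<Sum>y\<in>?B. \<Sum>x\<in>?A. ?r (x, y) * (ln (?p x) - ln (?r (x, y))))"
    by (subst sum.swap) (simp add: sum.cartesian_product split_beta)
  also have "\<dots> \<le> (\<Sum>y\<in>?B. e + a - e * ln a)"
  proof (rule sum_mono)
    fix y assume "y \<in> ?B"
    then obtain S where S: "measure M {\<omega> \<in> space M. (Y \<omega> = y) \<noteq> (X \<omega> \<in> S)} \<le> e"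
      using approx by blast
    \<comment> \<open>The mass on which the event \<open>Y \<omega> = y\<close> differs from the
      union of the \<open>X\<close>-fibres selected by \<open>Q\<close>, split along the fibres of
      \<open>X\<close>. For \<open>Q\<close> given by \<open>S\<close> it is at most
      \<open>e\<close>.\<close>
    have sum_eq: "(\<Sum>x\<in>?A. if Q x then ?p x - ?r (x, y) else ?r (x, y)) =
        measure M {\<omega> \<in> space M. (Y \<omega> = y) \<noteq> Q (X \<omega>)}" for Q
    proof -
      have "(\<Sum>x\<in>?A. if Q x then ?p x - ?r (x, y) else ?r (x, y)) =
          (\<Sum>x\<in>?A. measure M {\<omega> \<in> space M. X \<omega> = x \<and> (Y \<omega> = y) \<noteq> Q x})"
      proof (intro sum.cong refl)
        fix x
        have "?p x - ?r (x, y) = measure M ((X -` {x} \<inter> space M) - (?XY -` {(x, y)} \<inter> space M))"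
          unfolding fibre_prob_def using simple_functionD[OF X] simple_functionD[OF XY]
          by (intro finite_measure_Diff[symmetric]) auto
        also have "(X -` {x} \<inter> space M) - (?XY -` {(x, y)} \<inter> space M) = {\<omega> \<in> space M. X \<omega> = x \<and> Y \<omega> \<noteq> y}"
          by auto
        finally have 1: "?p x - ?r (x, y) = measure M {\<omega> \<in> space M. X \<omega> = x \<and> Y \<omega> \<noteq> y}" .
        have 2: "?r (x, y) = measure M {\<omega> \<in> space M. X \<omega> = x \<and> Y \<omega> = y}"
          unfolding fibre_prob_def by (rule arg_cong[where f="measure M"]) auto
        show "(if Q x then ?p x - ?r (x, y) else ?r (x, y)) =
            measure M {\<omega> \<in> space M. X \<omega> = x \<and> (Y \<omega> = y) \<noteq> Q x}"
          using 1 2 by (cases "Q x") auto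
      qed
      also have "\<dots> = measure M (\<Union>x\<in>?A. {\<omega> \<in> space M. X \<omega> = x \<and> (Y \<omega> = y) \<noteq> Q x})"
        using fin ev[of "\<lambda>u v. u = _ \<and> (v = y) \<noteq> Q _"]
        by (intro finite_measure_finite_Union[symmetric]) (auto simp: disjoint_family_on_def)
      also have "(\<Union>x\<in>?A. {\<omega> \<in> space M. X \<omega> = x \<and> (Y \<omega> = y) \<noteq> Q x}) =
          {\<omega> \<in> space M. (Y \<omega> = y) \<noteq> Q (X \<omega>)}" by auto
      finally show ?thesis .
    qed
    have "(\<Sum>x\<in>?A. ?r (x, y) * (ln (?p x) - ln (?r (x, y)))) \<le>
        (\<Sum>x\<in>?A. (1 - ln a) * (if x \<in> S then ?p x - ?r (x, y) else ?r (x, y)) + a * ?p x - (if x \<in> S then 0 else ?r (x, y)))"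
    proof (rule sum_mono)
      fix x
      define p r where "p = ?p x" and "r = ?r (x, y)"
      have pr: "0 \<le> r" "r \<le> p" using le by (auto simp: p_def r_def)
      have la: "ln a \<le> 0" using a by simp
      have "r * (ln p - ln r) \<le> (if x \<in> S then (1 - ln a) * (p - r) + a * p else a * p - r * ln a)"
      proof (cases "r = 0")
        case False
        then have "r > 0" "p > 0" using pr by auto
        show ?thesis
        proof (cases "x \<in> S")
          case True
          have "ln p - ln r \<le> p / r - 1"
            using ln_le_minus_one[of "p / r"] \<open>r > 0\<close> \<open>p > 0\<close> by (simp add: ln_div)
          then have "r * (ln p - ln r) \<le> p - r"
            using mult_left_mono[of "ln p - ln r" "p / r - 1" r] \<open>r > 0\<close> by (simp add: right_diff_distrib)
          moreover have "0 \<le> (- ln a) * (p - r)" "0 \<le> a * p"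
            using la pr a by (auto intro: mult_nonpos_nonneg)
          ultimately show ?thesis using True by (simp add: algebra_simps)
        next
          case F: False
          have "ln (a * p / r) \<le> a * p / r - 1"
            using \<open>r > 0\<close> \<open>p > 0\<close> a by (intro ln_le_minus_one) auto
          then have "ln a + ln p - ln r \<le> a * p / r - 1"
            using \<open>r > 0\<close> \<open>p > 0\<close> a by (simp add: ln_div ln_mult)
          then have "r * (ln a + ln p - ln r) \<le> a * p - r"
            using mult_left_mono[of "ln a + ln p - ln r" "a * p / r - 1" r] \<open>r > 0\<close> by (simp add: right_diff_distrib)
          then show ?thesis using F \<open>r > 0\<close> by (simp add: algebra_simps)
        qed
      qed (use pr a la in \<open>auto intro!: mult_nonneg_nonneg add_nonneg_nonneg order_trans[OF la]\<close>)
      then show "?r (x, y) * (ln (?p x) - ln (?r (x, y))) \<le>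
          (1 - ln a) * (if x \<in> S then ?p x - ?r (x, y) else ?r (x, y)) + a * ?p x - (if x \<in> S then 0 else ?r (x, y))"
        by (auto simp: p_def r_def algebra_simps)
    qed
    also have "\<dots> \<le> (\<Sum>x\<in>?A. (1 - ln a) * (if x \<in> S then ?p x - ?r (x, y) else ?r (x, y)) + a * ?p x)"
      by (intro sum_mono) auto
    also have "\<dots> = (1 - ln a) * measure M {\<omega> \<in> space M. (Y \<omega> = y) \<noteq> (X \<omega> \<in> S)} + a"
      unfolding sum.distrib sum_distrib_left[symmetric] sum_eq sum_fibre_prob_eq_1[OF X] by simp
    also have "\<dots> \<le> (1 - ln a) * e + a"
      using S a by (intro add_right_mono mult_left_mono) (auto intro: order_trans[of _ 0])
    finally show "(\<Sum>x\<in>?A. ?r (x, y) * (ln (?p x) - ln (?r (x, y)))) \<le> e + a - e * ln a"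
      by (simp add: algebra_simps)
  qed
  finally show ?thesis by simp
qed

end

section \<open>Entropy of measure-preserving systems\<close>

definition itinerary :: "('a \<Rightarrow> 'a) \<Rightarrow> ('a \<Rightarrow> 'b) \<Rightarrow> nat \<Rightarrow> 'a \<Rightarrow> 'b list" where
  "itinerary T c n x = map (\<lambda>i. c ((T ^^ i) x)) [0..<n]"

lemma length_itinerary [simp]: "length (itinerary T c n x) = n"
  by (simp add: itinerary_def)

lemma itinerary_0 [simp]: "itinerary T c 0 x = []"
  by (simp add: itinerary_def)

lemma itinerary_Suc: "itinerary T c (Suc n) x = itinerary T c n x @ [c ((T ^^ n) x)]"
  by (simp add: itinerary_def)

lemma itinerary_add: "itinerary T c (n + m) x = itinerary T c n x @ itinerary T c m ((T ^^ n) x)"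
proof (induction m)
  case (Suc m)
  have "(T ^^ (n + m)) x = (T ^^ m) ((T ^^ n) x)"
    by (simp add: add.commute[of n] funpow_add)
  with Suc show ?case by (simp add: itinerary_Suc)
qed simp

lemma itinerary_eq_iff:
  "itinerary T c n x = itinerary T c n y \<longleftrightarrow> (\<forall>i<n. c ((T ^^ i) x) = c ((T ^^ i) y))"
  by (auto simp: itinerary_def)

text \<open>Fekete's lemma, by division with remainder \<open>n = q * k + r\<close>. The limit is
  the infimum, so a bound at a single \<open>n\<close> already bounds the limit.\<close>

lemma fekete_subadditive:
  fixes a :: "nat \<Rightarrow> real"
  assumes sub: "\<And>n m. a (n + m) \<le> a n + a m" and nonneg: "\<And>n. a n \<ge> 0"
  shows "\<exists>L. (\<lambda>n. a n / n) \<longlonglongrightarrow> L \<and> (\<forall>n\<ge>1. L \<le> a n / n)"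
proof -
  define L where "L = (INF n\<in>{1..}. a n / n)"
  have bdd: "bdd_below ((\<lambda>n. a n / n) ` {1..})"
    using nonneg by (intro bdd_belowI[of _ 0]) auto
  have le: "L \<le> a n / n" if "n \<ge> 1" for n
    unfolding L_def using that bdd by (intro cINF_lower) auto
  have mult: "a (q * k + r) \<le> q * a k + a r" for q k r
  proof (induction q)
    case (Suc q)
    have "a (Suc q * k + r) \<le> a k + a (q * k + r)"
      using sub[of k "q * k + r"] by (simp add: algebra_simps)
    with Suc show ?case by (simp add: algebra_simps)
  qed simp
  have "(\<lambda>n. a n / n) \<longlonglongrightarrow> L"
  proof (rule LIMSEQ_I)
    fix e :: real assume "e > 0"
    have "\<exists>k\<in>{1..}. a k / k < L + e / 2"
      using \<open>e > 0\<close> bdd by (subst cINF_less_iff[symmetric]) (auto simp: L_def)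
    then obtain k where k: "k \<ge> 1" "a k / k < L + e / 2" by auto
    define B where "B = (\<Sum>r<k. a r)"
    have B: "a r \<le> B" if "r < k" for r
      unfolding B_def using that nonneg by (intro member_le_sum) auto
    obtain N :: nat where N: "N > 0" "B / N < e / 2"
    proof -
      obtain N :: nat where N: "2 * (B + 1) / e < N" using reals_Archimedean2 by blast
      have "B \<ge> 0" unfolding B_def using nonneg by (intro sum_nonneg) auto
      then have "0 < 2 * (B + 1) / e" using \<open>e > 0\<close> by simp
      with N have "real N > 0" by linarith
      moreover from N \<open>e > 0\<close> have "2 * (B + 1) < N * e" by (simp add: field_simps)
      ultimately show ?thesis using that[of N] by (simp add: field_simps)
    qed
    show "\<exists>no. \<forall>n\<ge>no. norm (a n / n - L) < e"
    proof (intro exI allI impI)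
      fix n :: nat assume n: "n \<ge> N"
      define q r where "q = n div k" and "r = n mod k"
      have n_eq: "n = q * k + r" and "r < k" using k by (auto simp: q_def r_def)
      have "a n \<le> q * a k + B"
        using mult[of q k r] B[OF \<open>r < k\<close>] n_eq by simp
      also have "q * a k = (q * k) * (a k / k)" using k by simp
      also have "\<dots> \<le> n * (a k / k)"
        using n_eq nonneg[of k] by (intro mult_right_mono) auto
      finally have "a n / n \<le> a k / k + B / n"
        using n N by (simp add: field_simps)
      moreover have "B / n \<le> B / N"
        using n N nonneg unfolding B_def by (intro divide_left_mono sum_nonneg) auto
      ultimately have "a n / n < L + e" using k N by linarith
      moreover have "L \<le> a n / n" using n N by (intro le) auto
      ultimately show "norm (a n / n - L) < e" by simp
    qed
  qed
  with le show ?thesis by blast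
qed

lemma (in prob_space) ent_nonneg: "ent M X \<ge> 0"
proof -
  have "fibre_prob M X v * ln (fibre_prob M X v) \<le> 0" for v
    by (cases "fibre_prob M X v = 0") (auto intro!: mult_nonneg_nonpos simp: fibre_prob_def less_le)
  then show ?thesis unfolding ent_def by (simp add: sum_nonpos)
qed

text \<open>The cells of \<open>Q\<close> are exactly the nonempty fibres of the labelling
  \<open>X\<close>, so the two sums have the same terms.\<close>

lemma (in prob_space) partition_entropy_eq_ent:
  assumes Q: "partition_on (space M) Q"
    and X: "\<And>x y. x \<in> space M \<Longrightarrow> y \<in> space M \<Longrightarrow> X x = X y \<longleftrightarrow> (\<exists>A\<in>Q. x \<in> A \<and> y \<in> A)"
  shows "partition_entropy M Q = ent M X"
proof -
  have eq: "X -` {X x} \<inter> space M = A" if "A \<in> Q" "x \<in> A" for x A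
  proof -
    have sub: "A \<subseteq> space M" using Q that by (auto simp: partition_on_def)
    have "A' = A" if "A' \<in> Q" "x \<in> A'" for A'
      using Q \<open>A \<in> Q\<close> \<open>x \<in> A\<close> that unfolding partition_on_def disjoint_def by blast
    then have "X y = X x \<longleftrightarrow> y \<in> A" if "y \<in> space M" for y
      using sub \<open>A \<in> Q\<close> \<open>x \<in> A\<close> that X[of y x] by blast
    with sub show ?thesis by blast
  qed
  have "bij_betw (\<lambda>v. X -` {v} \<inter> space M) (X ` space M) Q"
  proof (rule bij_betw_imageI)
    show "inj_on (\<lambda>v. X -` {v} \<inter> space M) (X ` space M)"
      by (auto simp: inj_on_def)
    show "(\<lambda>v. X -` {v} \<inter> space M) ` X ` space M = Q"
    proof (intro equalityI subsetI)
      fix B assume "B \<in> (\<lambda>v. X -` {v} \<inter> space M) ` X ` space M"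
      then obtain x where "x \<in> space M" "B = X -` {X x} \<inter> space M" by auto
      moreover obtain A where "A \<in> Q" "x \<in> A"
        using Q \<open>x \<in> space M\<close> by (auto simp: partition_on_def)
      ultimately show "B \<in> Q" using eq by auto
    next
      fix A assume A: "A \<in> Q"
      then have "A \<noteq> {}" using partition_onD3[OF Q] by auto
      then obtain x where "x \<in> A" by blast
      then have "x \<in> space M" "A = X -` {X x} \<inter> space M"
        using A Q eq by (auto simp: partition_on_def)
      then show "A \<in> (\<lambda>v. X -` {v} \<inter> space M) ` X ` space M" by blast
    qed
  qed
  from sum.reindex_bij_betw[OF this, of "\<lambda>A. measure M A * ln (measure M A)"]
  show ?thesis by (simp add: partition_entropy_def ent_def fibre_prob_def)
qed

locale measure_preserving_system = prob_space M for M :: "'a measure" and T :: "'a \<Rightarrow> 'a" +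
  assumes T_measurable [measurable]: "T \<in> measurable M M"
    and T_preserving: "\<And>A. A \<in> sets M \<Longrightarrow> emeasure M (T -` A \<inter> space M) = emeasure M A"
begin

lemma funpow_measurable [measurable]: "T ^^ n \<in> measurable M M"
  by (induction n) auto

lemma funpow_in_space: "x \<in> space M \<Longrightarrow> (T ^^ n) x \<in> space M"
  using measurable_space[OF funpow_measurable] by auto

lemma measure_funpow_vimage:
  "A \<in> sets M \<Longrightarrow> measure M ((T ^^ n) -` A \<inter> space M) = measure M A"
proof (induction n arbitrary: A)
  case 0
  then show ?case using sets.sets_into_space[of A M] by (simp add: Int_absorb2)
next
  case (Suc n)
  have "measure M ((T ^^ Suc n) -` A \<inter> space M) = measure M ((T ^^ n) -` (T -` A \<inter> space M) \<inter> space M)"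
    using funpow_in_space by (intro arg_cong[where f="measure M"]) auto
  moreover have "measure M (T -` A \<inter> space M) = measure M A"
    using T_preserving[OF Suc.prems] by (simp add: measure_def)
  ultimately show ?case
    using Suc.IH[of "T -` A \<inter> space M"] measurable_sets[OF T_measurable Suc.prems] by (simp only: o_def)
qed

lemma simple_function_funpow:
  "simple_function M X \<Longrightarrow> simple_function M (\<lambda>\<omega>. X ((T ^^ n) \<omega>))"
  by (rule simple_function_comp[OF funpow_measurable])

lemma simple_function_itinerary:
  assumes "simple_function M c"
  shows "simple_function M (itinerary T c n)"
proof (induction n)
  case (Suc n)
  have eq: "itinerary T c (Suc n) = (\<lambda>(u, v). u @ [v]) \<circ> (\<lambda>\<omega>. (itinerary T c n \<omega>, c ((T ^^ n) \<omega>)))"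
    by (auto simp: itinerary_Suc)
  show ?case
    unfolding eq using Suc assms
    by (intro simple_function_compose simple_function_Pair simple_function_funpow)
qed (simp add: itinerary_def)

lemma ent_funpow:
  assumes X: "simple_function M X"
  shows "ent M (\<lambda>\<omega>. X ((T ^^ n) \<omega>)) = ent M X"
proof -
  let ?Y = "\<lambda>\<omega>. X ((T ^^ n) \<omega>)"
  have p: "fibre_prob M ?Y v = fibre_prob M X v" for v
  proof -
    have "?Y -` {v} \<inter> space M = (T ^^ n) -` (X -` {v} \<inter> space M) \<inter> space M"
      using funpow_in_space by auto
    then show ?thesis
      using measure_funpow_vimage[OF simple_functionD(2)[OF X], of n "{v}"]
      by (simp only: fibre_prob_def)
  qed
  \<comment> \<open>\<open>T ^^ n\<close> may fail to be onto, so the range can shrink; the lost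
    values have empty fibres and contribute 0.\<close>
  have "(\<Sum>v\<in>?Y ` space M. fibre_prob M ?Y v * ln (fibre_prob M ?Y v)) =
      (\<Sum>v\<in>X ` space M. fibre_prob M ?Y v * ln (fibre_prob M ?Y v))"
  proof (rule sum.mono_neutral_left)
    show "?Y ` space M \<subseteq> X ` space M" using funpow_in_space by auto
    show "\<forall>v\<in>X ` space M - ?Y ` space M. fibre_prob M ?Y v * ln (fibre_prob M ?Y v) = 0"
    proof
      fix v assume "v \<in> X ` space M - ?Y ` space M"
      then have "?Y -` {v} \<inter> space M = {}" by blast
      then show "fibre_prob M ?Y v * ln (fibre_prob M ?Y v) = 0"
        by (simp add: fibre_prob_def)
    qed
  qed (use X in \<open>auto dest: simple_functionD\<close>)
  then show ?thesis by (simp add: ent_def p)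
qed

section \<open>Entropy rates and the generator theorem\<close>

definition ent_rate :: "('a \<Rightarrow> 'b) \<Rightarrow> real" where
  "ent_rate c = lim (\<lambda>n. ent M (itinerary T c n) / n)"

lemma ent_itinerary_add:
  assumes "simple_function M c"
  shows "ent M (itinerary T c (n + m)) \<le> ent M (itinerary T c n) + ent M (itinerary T c m)"
proof -
  let ?Y = "\<lambda>\<omega>. itinerary T c m ((T ^^ n) \<omega>)"
  note sf = simple_function_itinerary[OF assms]
  note sf' = simple_function_funpow[OF sf, of m n]
  have "ent M (itinerary T c (n + m)) \<le> ent M (\<lambda>\<omega>. (itinerary T c n \<omega>, ?Y \<omega>))"
    by (intro ent_mono simple_function_Pair sf sf') (auto simp: itinerary_add)
  also have "\<dots> \<le> ent M (itinerary T c n) + ent M ?Y"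
    by (rule ent_Pair_le[OF sf sf'])
  finally show ?thesis by (simp add: ent_funpow[OF sf])
qed

lemma
  assumes "simple_function M c"
  shows ent_rate_LIMSEQ: "(\<lambda>n. ent M (itinerary T c n) / n) \<longlonglongrightarrow> ent_rate c"
    and ent_rate_le: "n \<ge> 1 \<Longrightarrow> ent_rate c \<le> ent M (itinerary T c n) / n"
proof -
  obtain L where "(\<lambda>n. ent M (itinerary T c n) / n) \<longlonglongrightarrow> L" "\<forall>n\<ge>1. L \<le> ent M (itinerary T c n) / n"
    using fekete_subadditive[of "\<lambda>n. ent M (itinerary T c n)"] ent_itinerary_add[OF assms] ent_nonneg
    by blast
  moreover from this have "ent_rate c = L" unfolding ent_rate_def by (intro limI)
  ultimately show "(\<lambda>n. ent M (itinerary T c n) / n) \<longlonglongrightarrow> ent_rate c"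
    "n \<ge> 1 \<Longrightarrow> ent_rate c \<le> ent M (itinerary T c n) / n" by auto
qed

text \<open>A chain rule. For \<open>i < n\<close> the \<open>c\<close>-word of length
  \<open>n + m\<close> shows the \<open>m\<close> symbols from time \<open>i\<close> on; given
  these, the \<open>r\<close>-symbol at time \<open>i\<close> costs at most the conditional entropy
  of \<open>r\<close> given \<open>m\<close> symbols of \<open>c\<close>, by invariance the same at
  all times.\<close>

lemma ent_itinerary_le_cond:
  assumes r: "simple_function M r" and c: "simple_function M c"
  shows "ent M (itinerary T r n) \<le> ent M (itinerary T c (n + m)) +
    n * (ent M (\<lambda>\<omega>. (itinerary T c m \<omega>, r \<omega>)) - ent M (itinerary T c m))"
proof -
  let ?w = "itinerary T c (n + m)"
  define \<delta> where "\<delta> = ent M (\<lambda>\<omega>. (itinerary T c m \<omega>, r \<omega>)) - ent M (itinerary T c m)"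
  note sf = simple_function_itinerary[OF c] simple_function_itinerary[OF r]
    simple_function_funpow[OF r] simple_function_funpow[OF simple_function_itinerary[OF c]]
    simple_function_Pair
  \<comment> \<open>The \<open>r\<close>-symbols are added one by one next to the complete
    \<open>c\<close>-word. Submodularity over the window \<open>?Y\<close> at time \<open>j\<close>,
    a function of \<open>?w\<close>, bounds each increment.\<close>
  have "ent M (\<lambda>\<omega>. (itinerary T r j \<omega>, ?w \<omega>)) \<le> ent M ?w + j * \<delta>" if "j \<le> n" for j
    using that
  proof (induction j)
    case 0
    show ?case using ent_mono[of ?w "\<lambda>\<omega>. ([], ?w \<omega>)"] by (simp add: itinerary_def[of _ r] sf)
  next
    case (Suc j)
    let ?X = "\<lambda>\<omega>. (itinerary T r j \<omega>, ?w \<omega>)"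
      and ?Y = "\<lambda>\<omega>. itinerary T c m ((T ^^ j) \<omega>)" and ?Z = "\<lambda>\<omega>. r ((T ^^ j) \<omega>)"
    have split: "?w \<omega> = itinerary T c j \<omega> @ ?Y \<omega> @ itinerary T c (n - j) ((T ^^ (j + m)) \<omega>)" for \<omega>
    proof -
      have "?w \<omega> = itinerary T c ((j + m) + (n - j)) \<omega>"
        using Suc.prems by (intro arg_cong[where f="\<lambda>k. itinerary T c k \<omega>"]) simp
      then show ?thesis by (simp only: itinerary_add append.assoc)
    qed
    have Y_det: "?Y x = ?Y y" if "?w x = ?w y" for x y
      using that unfolding split[of x] split[of y]
      by (simp only: append_eq_append_conv length_itinerary simp_thms)
    have "ent M (\<lambda>\<omega>. (itinerary T r (Suc j) \<omega>, ?w \<omega>)) \<le> ent M (\<lambda>\<omega>. (?X \<omega>, ?Y \<omega>, ?Z \<omega>))"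
      by (intro ent_mono sf) (auto simp: itinerary_Suc)
    also have "\<dots> \<le> ent M (\<lambda>\<omega>. (?X \<omega>, ?Y \<omega>)) + ent M (\<lambda>\<omega>. (?Y \<omega>, ?Z \<omega>)) - ent M ?Y"
      using ent_submodular[of ?X ?Y ?Z] by (simp add: sf)
    also have "ent M (\<lambda>\<omega>. (?X \<omega>, ?Y \<omega>)) \<le> ent M ?X"
    proof (intro ent_mono sf)
      fix x y assume "?X x = ?X y"
      with Y_det[of x y] show "(?X x, ?Y x) = (?X y, ?Y y)" by (simp only: prod.inject)
    qed
    also have "ent M ?Y = ent M (itinerary T c m)"
      by (intro ent_funpow sf)
    also have "ent M (\<lambda>\<omega>. (?Y \<omega>, ?Z \<omega>)) = ent M (\<lambda>\<omega>. (itinerary T c m \<omega>, r \<omega>))"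
      using ent_funpow[of "\<lambda>\<omega>. (itinerary T c m \<omega>, r \<omega>)" j] r by (simp add: sf)
    finally show ?case
      using Suc by (simp add: \<delta>_def algebra_simps)
  qed
  from this[of n] have "ent M (\<lambda>\<omega>. (itinerary T r n \<omega>, ?w \<omega>)) \<le> ent M ?w + n * \<delta>" by simp
  moreover have "ent M (itinerary T r n) \<le> ent M (\<lambda>\<omega>. (itinerary T r n \<omega>, ?w \<omega>))"
    by (intro ent_mono sf) auto
  ultimately show ?thesis by (simp add: \<delta>_def)
qed

text \<open>Two points share a cell of the iterated join iff their labels agree along the first
  \<open>n\<close> iterates, that is, iff their itineraries coincide.\<close>

lemma entropy_wrt_partition_eq_ent_rate:
  assumes P: "partition_on (space M) P"
    and r: "\<And>x y. x \<in> space M \<Longrightarrow> y \<in> space M \<Longrightarrow> r x = r y \<longleftrightarrow> (\<exists>A\<in>P. x \<in> A \<and> y \<in> A)"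
  shows "entropy_wrt_partition M T P = ent_rate r"
proof -
  have "partition_entropy M (iterated_join M T P n) = ent M (itinerary T r n)" if n: "n \<ge> 1" for n
  proof (rule partition_entropy_eq_ent)
    show "partition_on (space M) (iterated_join M T P n)"
      using measurable_space[OF T_measurable] n by (intro partition_on_iterated_join P) auto
    fix x y assume xy: "x \<in> space M" "y \<in> space M"
    have pull: "(\<exists>A\<in>pullback_partition M (T ^^ i) P. x \<in> A \<and> y \<in> A) \<longleftrightarrow> r ((T ^^ i) x) = r ((T ^^ i) y)" for i
    proof
      assume "\<exists>A\<in>pullback_partition M (T ^^ i) P. x \<in> A \<and> y \<in> A"
      then obtain A where "A \<in> P" "(T ^^ i) x \<in> A" "(T ^^ i) y \<in> A"
        unfolding pullback_partition_def by blast
      then show "r ((T ^^ i) x) = r ((T ^^ i) y)"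
        using r[OF funpow_in_space[OF xy(1)] funpow_in_space[OF xy(2)], of i i] by blast
    next
      assume "r ((T ^^ i) x) = r ((T ^^ i) y)"
      then obtain A where A: "A \<in> P" "(T ^^ i) x \<in> A" "(T ^^ i) y \<in> A"
        using r[OF funpow_in_space[OF xy(1)] funpow_in_space[OF xy(2)], of i i] by blast
      let ?B = "(T ^^ i) -` A \<inter> space M"
      have B: "x \<in> ?B" "y \<in> ?B" using A xy by auto
      then have "?B \<in> pullback_partition M (T ^^ i) P"
        unfolding pullback_partition_def using A(1) by blast
      with B show "\<exists>A\<in>pullback_partition M (T ^^ i) P. x \<in> A \<and> y \<in> A" by (intro bexI conjI)
    qed
    show "(itinerary T r n x = itinerary T r n y) = (\<exists>A\<in>iterated_join M T P n. x \<in> A \<and> y \<in> A)"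
      (is "?L = ?R")
    proof
      assume ?L
      let ?PP = "(\<lambda>i. pullback_partition M (T ^^ i) P) ` {..<n}"
      have "\<forall>Q\<in>?PP. \<exists>A. A \<in> Q \<and> x \<in> A \<and> y \<in> A"
        using \<open>?L\<close> pull by (auto simp: itinerary_eq_iff Bex_def)
      then obtain f where f: "\<forall>Q\<in>?PP. f Q \<in> Q \<and> x \<in> f Q \<and> y \<in> f Q" by metis
      then have "\<Inter> (f ` ?PP) \<in> iterated_join M T P n"
        unfolding iterated_join_def common_refinement by blast
      moreover have "x \<in> \<Inter> (f ` ?PP)" "y \<in> \<Inter> (f ` ?PP)" using f by auto
      ultimately show ?R by blast
    next
      assume ?R
      then obtain A where A: "A \<in> iterated_join M T P n" "x \<in> A" "y \<in> A" by auto
      have "r ((T ^^ i) x) = r ((T ^^ i) y)" if "i < n" for i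
        using common_refinement_exists[OF A(1)[unfolded iterated_join_def], of "pullback_partition M (T ^^ i) P"]
          that A unfolding pull[symmetric] by blast
      then show ?L by (simp add: itinerary_eq_iff)
    qed
  qed
  then have "\<forall>\<^sub>F n in sequentially. partition_entropy M (iterated_join M T P n) / n = ent M (itinerary T r n) / n"
    by (intro eventually_sequentiallyI[of 1]) simp
  then show ?thesis
    unfolding entropy_wrt_partition_def ent_rate_def lim_def by (simp only: tendsto_cong)
qed

text \<open>By \<open>gen\<close>, long \<open>c\<close>-words determine the value of
  \<open>r\<close> up to small errors, so the conditional entropy of \<open>r\<close> given such a
  word is small; by the chain rule this is all that \<open>r\<close> can add to the rate.\<close>

lemma ent_rate_le_generator:
  assumes c: "simple_function M c" and r: "simple_function M r"
    and gen: "\<And>A e. A \<in> sets M \<Longrightarrow> e > 0 \<Longrightarrow>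
      \<forall>\<^sub>F m in sequentially. \<exists>S. measure M {\<omega> \<in> space M. (\<omega> \<in> A) \<noteq> (itinerary T c m \<omega> \<in> S)} \<le> e"
  shows "ent_rate r \<le> ent_rate c"
proof (rule field_le_epsilon)
  fix \<epsilon> :: real assume "\<epsilon> > 0"
  define K where "K = real (card (r ` space M))"
  have fin: "finite (r ` space M)" using r by (rule simple_functionD)
  have K: "K \<ge> 0" by (simp add: K_def)
  obtain a where a: "0 < a" "a \<le> 1" "K * a \<le> \<epsilon> / 2"
  proof
    show "0 < min 1 (\<epsilon> / (2 * (K + 1)))" "min 1 (\<epsilon> / (2 * (K + 1))) \<le> 1" using \<open>\<epsilon> > 0\<close> K by auto
    have "K * min 1 (\<epsilon> / (2 * (K + 1))) \<le> (K + 1) * (\<epsilon> / (2 * (K + 1)))"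
      using \<open>\<epsilon> > 0\<close> K by (intro mult_mono) auto
    also have "\<dots> = \<epsilon> / 2" using K by (simp add: field_simps)
    finally show "K * min 1 (\<epsilon> / (2 * (K + 1))) \<le> \<epsilon> / 2" .
  qed
  \<comment> \<open>\<open>C - 1\<close> is the coefficient of \<open>e\<close> in the bound
    \<open>K * (e + a - e * ln a)\<close>, and the added 1 keeps \<open>C\<close> positive. The
    choice of \<open>a\<close> uses half of \<open>\<epsilon>\<close>, that of \<open>e\<close> the
    other half.\<close>
  define C where "C = K * (1 - ln a) + 1"
  have "ln a \<le> 0" using a by simp
  then have C: "C > 0" unfolding C_def using K by (intro add_nonneg_pos mult_nonneg_nonneg) auto
  define e where "e = \<epsilon> / (2 * C)"
  have e: "e > 0" using C \<open>\<epsilon> > 0\<close> by (simp add: e_def)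
  have "\<forall>\<^sub>F m in sequentially. \<forall>v\<in>r ` space M.
      \<exists>S. measure M {\<omega> \<in> space M. (\<omega> \<in> r -` {v} \<inter> space M) \<noteq> (itinerary T c m \<omega> \<in> S)} \<le> e"
    using fin e simple_functionD(2)[OF r] by (intro eventually_ball_finite ballI gen) auto
  then obtain m where m: "\<forall>v\<in>r ` space M.
      \<exists>S. measure M {\<omega> \<in> space M. (\<omega> \<in> r -` {v} \<inter> space M) \<noteq> (itinerary T c m \<omega> \<in> S)} \<le> e"
    by (auto simp: eventually_sequentially)
  have m': "\<exists>S. measure M {\<omega> \<in> space M. (r \<omega> = v) \<noteq> (itinerary T c m \<omega> \<in> S)} \<le> e" if v: "v \<in> r ` space M" for v
  proof -
    obtain S where S: "measure M {\<omega> \<in> space M. (\<omega> \<in> r -` {v} \<inter> space M) \<noteq> (itinerary T c m \<omega> \<in> S)} \<le> e"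
      by (rule exE[OF bspec[OF m v]])
    have "{\<omega> \<in> space M. (\<omega> \<in> r -` {v} \<inter> space M) \<noteq> (itinerary T c m \<omega> \<in> S)} =
        {\<omega> \<in> space M. (r \<omega> = v) \<noteq> (itinerary T c m \<omega> \<in> S)}" by auto
    with S show ?thesis by auto
  qed
  define \<delta> where "\<delta> = ent M (\<lambda>\<omega>. (itinerary T c m \<omega>, r \<omega>)) - ent M (itinerary T c m)"
  have "\<delta> \<le> K * (e + a - e * ln a)"
    unfolding \<delta>_def K_def by (rule cond_ent_le[OF simple_function_itinerary[OF c] r a(1,2) m'])
  also have "\<dots> = (C - 1) * e + K * a"
    by (simp add: C_def algebra_simps)
  also have "\<dots> \<le> \<epsilon>"
  proof -
    have "C * e = \<epsilon> / 2" using C by (simp add: e_def)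
    with a e show ?thesis by (simp add: left_diff_distrib)
  qed
  finally have \<delta>: "\<delta> \<le> \<epsilon>" .
  \<comment> \<open>The window length \<open>m\<close> is fixed, so replacing \<open>n\<close> by
    \<open>n + m\<close> does not affect the rate.\<close>
  have lim: "(\<lambda>n. ent M (itinerary T c (n + m)) / (n + m) * (real (n + m) / n) + \<epsilon>) \<longlonglongrightarrow> ent_rate c * 1 + \<epsilon>"
  proof (intro tendsto_add tendsto_mult tendsto_const)
    show "(\<lambda>n. ent M (itinerary T c (n + m)) / (n + m)) \<longlonglongrightarrow> ent_rate c"
      using LIMSEQ_ignore_initial_segment[OF ent_rate_LIMSEQ[OF c], of m] by simp
    have "(\<lambda>n. 1 + real m / real n) \<longlonglongrightarrow> 1"
      using tendsto_add[OF tendsto_const lim_const_over_n[of "real m"], of 1] by simp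
    moreover have "\<forall>\<^sub>F n in sequentially. 1 + real m / real n = real (n + m) / real n"
      by (intro eventually_sequentiallyI[of 1]) (simp add: field_simps)
    ultimately show "(\<lambda>n. real (n + m) / real n) \<longlonglongrightarrow> 1"
      by (rule Lim_transform_eventually)
  qed
  have "ent_rate r \<le> ent_rate c * 1 + \<epsilon>"
  proof (rule LIMSEQ_le[OF ent_rate_LIMSEQ[OF r] lim])
    show "\<exists>N. \<forall>n\<ge>N. ent M (itinerary T r n) / n \<le> ent M (itinerary T c (n + m)) / (n + m) * (real (n + m) / n) + \<epsilon>"
    proof (intro exI[of _ 1] allI impI)
      fix n :: nat assume n: "n \<ge> 1"
      have "ent M (itinerary T r n) \<le> ent M (itinerary T c (n + m)) + n * \<delta>"
        unfolding \<delta>_def by (rule ent_itinerary_le_cond[OF r c])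
      also have "\<dots> \<le> ent M (itinerary T c (n + m)) + n * \<epsilon>"
        using \<delta> by (intro add_left_mono mult_left_mono) auto
      finally have "ent M (itinerary T r n) / n \<le> ent M (itinerary T c (n + m)) / n + \<epsilon>"
        using n by (simp add: field_simps)
      also have "ent M (itinerary T c (n + m)) / n = ent M (itinerary T c (n + m)) / (n + m) * (real (n + m) / n)"
        using n by (simp del: of_nat_add)
      finally show "ent M (itinerary T r n) / n \<le> ent M (itinerary T c (n + m)) / (n + m) * (real (n + m) / n) + \<epsilon>" .
    qed
  qed
  then show "ent_rate r \<le> ent_rate c + \<epsilon>" by simp
qed

text \<open>The Kolmogorov--Sinai theorem. A finite partition is described by the function sending a
  point to its cell, whose rate is at most that of \<open>c\<close>; the fibres of \<open>c\<close>
  form a partition that attains the bound.\<close>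

lemma ks_entropy_generator:
  assumes c: "simple_function M c"
    and gen: "\<And>A e. A \<in> sets M \<Longrightarrow> e > 0 \<Longrightarrow>
      \<forall>\<^sub>F m in sequentially. \<exists>S. measure M {\<omega> \<in> space M. (\<omega> \<in> A) \<noteq> (itinerary T c m \<omega> \<in> S)} \<le> e"
  shows "ks_entropy M T = ereal (ent_rate c)"
proof (rule antisym)
  show "ks_entropy M T \<le> ereal (ent_rate c)"
    unfolding ks_entropy_def
  proof (intro SUP_least)
    fix P assume "P \<in> {P. measurable_partition M P}"
    then have fin: "finite P" and sets: "P \<subseteq> sets M" and part: "partition_on (space M) P"
      by (auto simp: measurable_partition_def)
    define r where "r x = (THE A. A \<in> P \<and> x \<in> A)" for x
    have r_eq: "r x = A" if "A \<in> P" "x \<in> A" for x A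
      unfolding r_def using that part unfolding partition_on_def disjoint_def by (intro the_equality) blast+
    have r_ex: "r x \<in> P \<and> x \<in> r x" if "x \<in> space M" for x
    proof -
      have "x \<in> \<Union>P" using that partition_onD1[OF part] by simp
      then obtain A where "A \<in> P" "x \<in> A" by blast
      then show ?thesis using r_eq by auto
    qed
    have "simple_function M r"
      unfolding simple_function_def
    proof (intro conjI ballI)
      show "finite (r ` space M)" using r_ex fin by (auto intro: finite_subset)
      fix A assume "A \<in> r ` space M"
      then have "A \<in> P" using r_ex by auto
      moreover have "r -` {A} \<inter> space M = A"
        using \<open>A \<in> P\<close> r_ex r_eq part by (auto simp: partition_on_def)
      ultimately show "r -` {A} \<inter> space M \<in> sets M" using sets by auto
    qed
    moreover have "entropy_wrt_partition M T P = ent_rate r"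
      using r_ex r_eq by (intro entropy_wrt_partition_eq_ent_rate[OF part]) metis
    ultimately show "ereal (entropy_wrt_partition M T P) \<le> ereal (ent_rate c)"
      using ent_rate_le_generator[OF c _ gen] by simp
  qed
next
  define P where "P = (\<lambda>v. c -` {v} \<inter> space M) ` c ` space M"
  have part: "partition_on (space M) P"
    by (auto simp: partition_on_def P_def disjoint_def)
  have "measurable_partition M P"
    unfolding measurable_partition_def using c part by (auto simp: P_def dest: simple_functionD)
  moreover have "entropy_wrt_partition M T P = ent_rate c"
    by (intro entropy_wrt_partition_eq_ent_rate[OF part]) (auto simp: P_def)
  ultimately show "ereal (ent_rate c) \<le> ks_entropy M T"
    unfolding ks_entropy_def by (metis (mono_tags, lifting) SUP_upper mem_Collect_eq)
qed

end

section \<open>Cylinders\<close>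

lemma itinerary_Suc': "itinerary T c (Suc n) x = c x # itinerary T c n (T x)"
  using itinerary_add[of T c 1 n x] by (simp add: itinerary_def)

text \<open>Recurrence of atoms: if \<open>x\<close> never returned, its preimages under the
  iterates would be disjoint sets of equal positive mass.\<close>

lemma (in measure_preserving_system) atom_periodic:
  assumes "{x} \<in> sets M" "measure M {x} > 0"
  shows "\<exists>p\<ge>1. (T ^^ p) x = x"
proof (rule ccontr)
  assume np: "\<not> (\<exists>p\<ge>1. (T ^^ p) x = x)"
  define A where "A n = (T ^^ n) -` {x} \<inter> space M" for n
  have sets: "A n \<in> sets M" for n
    unfolding A_def using assms(1) by (rule measurable_sets[OF funpow_measurable])
  have disj: "A i \<inter> A j = {}" if "i < j" for i j
  proof (rule ccontr)
    assume "A i \<inter> A j \<noteq> {}"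
    then obtain y where "(T ^^ i) y = x" "(T ^^ j) y = x" unfolding A_def by auto
    moreover have "(T ^^ j) y = (T ^^ (j - i)) ((T ^^ i) y)"
      using that by (simp add: funpow_add[symmetric, THEN fun_cong, unfolded o_apply])
    ultimately have "(T ^^ (j - i)) x = x" by simp
    with np that show False by (metis One_nat_def Suc_leI zero_less_diff)
  qed
  have disj': "disjoint_family_on A {..<n}" for n
    unfolding disjoint_family_on_def using disj by (metis Int_commute linorder_neqE_nat)
  obtain n :: nat where n: "1 < n * measure M {x}"
    using assms(2) ex_less_of_nat_mult by blast
  have "(\<Sum>i<n. measure M (A i)) = measure M (\<Union>i<n. A i)"
    using sets disj' by (intro finite_measure_finite_Union[symmetric]) auto
  also have "\<dots> \<le> 1" by (rule prob_le_1)
  finally show False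
    using n measure_funpow_vimage[OF assms(1)] by (simp add: A_def)
qed

lemma
  fixes c :: real
  assumes "c \<noteq> 0" "E \<in> sets borel"
  shows measure_lborel_affine_vimage: "measure lborel ((\<lambda>x. t + c * x) -` E) = measure lborel E / \<bar>c\<bar>"
    and fmeasurable_affine_vimage: "E \<in> fmeasurable lborel \<Longrightarrow> (\<lambda>x. t + c * x) -` E \<in> fmeasurable lborel"
proof -
  have vimage [measurable]: "(\<lambda>x. t + c * x) -` E \<in> sets borel"
    using measurable_sets[of "\<lambda>x. t + c * x" borel borel E] assms(2) by simp
  have "emeasure lborel E = emeasure (density (distr lborel borel (\<lambda>x. t + c * x)) (\<lambda>_. ennreal \<bar>c\<bar>)) E"
    using lborel_real_affine[OF assms(1), of t] by simp
  also have "\<dots> = ennreal \<bar>c\<bar> * emeasure lborel ((\<lambda>x. t + c * x) -` E)"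
    using assms(2) by (subst emeasure_density_const) (simp_all add: emeasure_distr)
  finally have eq: "emeasure lborel E = ennreal \<bar>c\<bar> * emeasure lborel ((\<lambda>x. t + c * x) -` E)" .
  then have "measure lborel E = \<bar>c\<bar> * measure lborel ((\<lambda>x. t + c * x) -` E)"
    by (simp add: measure_def enn2real_mult)
  then show "measure lborel ((\<lambda>x. t + c * x) -` E) = measure lborel E / \<bar>c\<bar>"
    using assms(1) by simp
  assume "E \<in> fmeasurable lborel"
  with eq assms(1) vimage show "(\<lambda>x. t + c * x) -` E \<in> fmeasurable lborel"
    by (auto simp: fmeasurable_def ennreal_mult_less_top)
qed

section \<open>Words and cylinders of the transformation\<close>

locale neg_beta =
  fixes \<beta> :: real
  assumes beta_gt_1: "\<beta> > 1"
begin

abbreviation "T \<equiv> T_neg_beta \<beta>"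

definition digit :: "real \<Rightarrow> int" where
  "digit x = \<lfloor>\<beta> * x\<rfloor>"

abbreviation word :: "nat \<Rightarrow> real \<Rightarrow> int list" where
  "word \<equiv> itinerary T digit"

definition cyl :: "int list \<Rightarrow> real set" where
  "cyl u = {x \<in> {0<..1}. word (length u) x = u}"

definition words :: "nat \<Rightarrow> int list set" where
  "words n = word n ` {0<..1}"

lemma T_eq: "T x = of_int (digit x) + 1 - \<beta> * x"
  by (simp add: T_neg_beta_def digit_def)

lemma T_measurable_borel [measurable]: "T \<in> borel_measurable borel"
  unfolding T_neg_beta_def by measurable

lemma T_unit: "T x \<in> {0<..1}"
  by (rule T_neg_beta_in_unit)

lemma funpow_unit: "x \<in> {0<..1} \<Longrightarrow> (T ^^ n) x \<in> {0<..1}"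
  using T_unit by (cases n) auto

lemma length_words: "u \<in> words n \<Longrightarrow> length u = n"
  by (auto simp: words_def)

lemma finite_words: "finite (words n)"
proof (rule finite_subset)
  have "digit y \<in> {0..\<lfloor>\<beta>\<rfloor>}" if "y \<in> {0<..1}" for y
    using that beta_gt_1 by (auto simp: digit_def intro!: floor_mono)
  then have "digit ((T ^^ i) x) \<in> {0..\<lfloor>\<beta>\<rfloor>}" if "x \<in> {0<..1}" for x i
    using funpow_unit[OF that] by blast
  then show "words n \<subseteq> {xs. set xs \<subseteq> {0..\<lfloor>\<beta>\<rfloor>} \<and> length xs = n}"
    unfolding words_def itinerary_def by force
qed (rule finite_lists_length_eq, simp)

lemma cyl_unit: "cyl u \<subseteq> {0<..1}"
  by (auto simp: cyl_def)

lemma mem_cyl_word: "x \<in> {0<..1} \<Longrightarrow> x \<in> cyl (word n x)"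
  by (simp add: cyl_def)

lemma word_in_words: "x \<in> {0<..1} \<Longrightarrow> word n x \<in> words n"
  by (simp add: words_def)

lemma cyl_nonempty: "u \<in> words n \<Longrightarrow> cyl u \<noteq> {}"
  using mem_cyl_word by (fastforce simp: words_def)

lemma word_cyl: "x \<in> cyl u \<Longrightarrow> length u = n \<Longrightarrow> word n x = u"
  by (auto simp: cyl_def)

lemma cyl_disjoint: "length u = length v \<Longrightarrow> x \<in> cyl u \<Longrightarrow> x \<in> cyl v \<Longrightarrow> u = v"
  by (auto simp: cyl_def)

lemma cyl_append:
  "cyl (u @ v) = {x \<in> cyl u. (T ^^ length u) x \<in> cyl v}"
  using funpow_unit by (auto simp: cyl_def itinerary_add)

lemma append_in_words:
  assumes "u \<in> words (n + k)"
  shows "take n u \<in> words n" "drop n u \<in> words k" "u = take n u @ drop n u"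
  using assms funpow_unit by (auto simp: words_def itinerary_add)

lemma cyl_sets [measurable]: "cyl u \<in> sets borel"
proof (induction u)
  case Nil
  then show ?case by (simp add: cyl_def)
next
  case (Cons a u)
  have "cyl (a # u) = {x \<in> {0<..1}. \<lfloor>\<beta> * x\<rfloor> = a} \<inter> (T -` cyl u \<inter> space borel)"
    using T_unit by (auto simp: cyl_def itinerary_Suc' digit_def)
  also have "\<dots> \<in> sets borel"
    using measurable_sets[OF T_measurable_borel Cons] by measurable
  finally show ?case .
qed

lemma funpow_diff_word:
  "word n x = word n y \<Longrightarrow> (T ^^ n) x - (T ^^ n) y = (- \<beta>) ^ n * (x - y)"
proof (induction n)
  case (Suc n)
  then have IH: "(T ^^ n) x - (T ^^ n) y = (- \<beta>) ^ n * (x - y)"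
    and digit: "digit ((T ^^ n) x) = digit ((T ^^ n) y)"
    by (auto simp: itinerary_Suc)
  have "T ((T ^^ n) x) - T ((T ^^ n) y) = - \<beta> * ((T ^^ n) x - (T ^^ n) y)"
    by (simp add: T_eq[of "(T ^^ n) x"] T_eq[of "(T ^^ n) y"] digit right_diff_distrib)
  then show ?case unfolding IH by simp
qed simp

lemma funpow_affine_on_cyl:
  assumes "u \<in> words n"
  obtains t where "\<And>x. x \<in> cyl u \<Longrightarrow> (T ^^ n) x = t + (- \<beta>) ^ n * x"
proof -
  obtain y where y: "y \<in> cyl u" using cyl_nonempty[OF assms] by auto
  show ?thesis
  proof
    fix x assume "x \<in> cyl u"
    with y have "word n x = word n y" using length_words[OF assms] word_cyl by metis
    from funpow_diff_word[OF this] show "(T ^^ n) x = ((T ^^ n) y - (- \<beta>) ^ n * y) + (- \<beta>) ^ n * x"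
      by (simp add: algebra_simps)
  qed
qed

lemma cyl_diameter:
  assumes "x \<in> {0<..1}" "y \<in> {0<..1}" "word n x = word n y"
  shows "\<bar>x - y\<bar> \<le> 1 / \<beta> ^ n"
proof -
  have "\<beta> ^ n * \<bar>x - y\<bar> = \<bar>(T ^^ n) x - (T ^^ n) y\<bar>"
    using funpow_diff_word[OF assms(3)] beta_gt_1 by (simp add: abs_mult power_abs)
  also have "\<dots> \<le> 1"
    using funpow_unit[OF assms(1), of n] funpow_unit[OF assms(2), of n] by (auto simp: abs_if)
  finally show ?thesis using beta_gt_1 by (simp add: field_simps)
qed

text \<open>Digits are monotone in the point, and on a common branch \<open>T\<close> reverses the
  order, so the two outer points exchange roles in the induction.\<close>

lemma word_between:
  "x \<le> z \<Longrightarrow> z \<le> y \<Longrightarrow> word n x = word n y \<Longrightarrow> word n z = word n x"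
proof (induction n arbitrary: x y z)
  case (Suc n)
  then have eq: "digit x = digit y" and eq': "word n (T x) = word n (T y)"
    by (auto simp: itinerary_Suc')
  have "digit x \<le> digit z" "digit z \<le> digit y"
    using Suc.prems beta_gt_1 by (auto simp: digit_def intro!: floor_mono)
  with eq have z: "digit z = digit x" by simp
  have "T y \<le> T z" "T z \<le> T x"
    using Suc.prems eq z beta_gt_1 by (auto simp: T_eq)
  from Suc.IH[OF this] eq' z show ?case by (simp add: itinerary_Suc')
qed simp

lemma cyl_between: "x \<in> cyl u \<Longrightarrow> y \<in> cyl u \<Longrightarrow> x \<le> z \<Longrightarrow> z \<le> y \<Longrightarrow> z \<in> cyl u"
  using word_between[of x z y "length u"] by (auto simp: cyl_def)

lemma funpow_image_between:
  assumes u: "u \<in> words n" and "p \<in> (T ^^ n) ` cyl u" "q \<in> (T ^^ n) ` cyl u" "p \<le> z" "z \<le> q"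
  shows "z \<in> (T ^^ n) ` cyl u"
proof -
  obtain t where t: "\<And>x. x \<in> cyl u \<Longrightarrow> (T ^^ n) x = t + (- \<beta>) ^ n * x"
    using funpow_affine_on_cyl[OF u] by blast
  obtain x y where xy: "x \<in> cyl u" "p = t + (- \<beta>) ^ n * x" "y \<in> cyl u" "q = t + (- \<beta>) ^ n * y"
    using assms(2,3) t by auto
  define w where "w = (z - t) / (- \<beta>) ^ n"
  have nz: "(- \<beta>) ^ n \<noteq> 0" using beta_gt_1 by simp
  have z: "z = t + (- \<beta>) ^ n * w" using nz by (simp add: w_def)
  have "(- \<beta>) ^ n * x \<le> (- \<beta>) ^ n * w" "(- \<beta>) ^ n * w \<le> (- \<beta>) ^ n * y"
    using assms(4,5) xy z by auto
  \<comment> \<open>The slope \<open>(- \<beta>) ^ n\<close> is positive or negative according to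
    the parity of \<open>n\<close>.\<close>
  then have "x \<le> w \<and> w \<le> y \<or> y \<le> w \<and> w \<le> x"
    using nz unfolding mult_le_cancel_left by linarith
  then have "w \<in> cyl u" using cyl_between xy by blast
  then show ?thesis using t z by auto
qed

section \<open>Counting nondegenerate cylinders by Lebesgue measure\<close>

abbreviation lm :: "real set \<Rightarrow> real" where
  "lm \<equiv> measure lborel"

lemma unit_fmeasurable: "{0<..1::real} \<in> fmeasurable lborel"
  by (simp add: fmeasurable_def)

lemma fmeasurable_unit: "A \<in> sets (borel :: real measure) \<Longrightarrow> A \<subseteq> {0<..1} \<Longrightarrow> A \<in> fmeasurable lborel"
  by (rule fmeasurableI2[OF unit_fmeasurable]) auto

lemma lm_mono: "A \<subseteq> B \<Longrightarrow> A \<in> sets borel \<Longrightarrow> B \<in> sets borel \<Longrightarrow> B \<subseteq> {0<..1} \<Longrightarrow> lm A \<le> lm B"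
  by (rule measure_mono_fmeasurable) (auto intro: fmeasurable_unit)

lemma lm_cyl_Union:
  assumes "S \<subseteq> words n" "E \<in> sets borel"
  shows "lm (\<Union>u\<in>S. cyl u \<inter> E) = (\<Sum>u\<in>S. lm (cyl u \<inter> E))"
proof (rule measure_UNION')
  show "finite S" using assms finite_words finite_subset by blast
  show "cyl u \<inter> E \<in> fmeasurable lborel" for u
    using assms cyl_unit by (intro fmeasurable_unit) auto
  show "pairwise (\<lambda>u v. disjnt (cyl u \<inter> E) (cyl v \<inter> E)) S"
  proof (rule pairwiseI)
    fix u v assume "u \<in> S" "v \<in> S" "u \<noteq> v"
    moreover from this have "length u = length v" using assms(1) length_words by (metis subsetD)
    ultimately show "disjnt (cyl u \<inter> E) (cyl v \<inter> E)"
      using cyl_disjoint unfolding disjnt_def by blast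
  qed
qed

lemma Union_cyl: "(\<Union>u\<in>words n. cyl u) = {0<..1}"
  using cyl_unit mem_cyl_word word_in_words by blast

lemma sum_lm_cyl: "(\<Sum>u\<in>words n. lm (cyl u)) = 1"
  using lm_cyl_Union[OF order_refl, of UNIV n] by (simp add: Union_cyl)

lemma sum_lm_cyl_le: "S \<subseteq> words n \<Longrightarrow> (\<Sum>u\<in>S. lm (cyl u)) \<le> 1"
  using sum_mono2[OF finite_words, of S n "\<lambda>u. lm (cyl u)"] sum_lm_cyl by simp

text \<open>Cylinders are intervals, so the other words of length \<open>n\<close> belong to
  one-point cylinders.\<close>

definition fat :: "nat \<Rightarrow> int list set" where
  "fat n = {u \<in> words n. lm (cyl u) > 0}"

lemma fat_subset: "fat n \<subseteq> words n"
  by (auto simp: fat_def)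

lemma finite_fat: "finite (fat n)"
  using finite_subset[OF fat_subset finite_words] .

text \<open>The length of the shortest nondegenerate \<open>k\<close>-cylinder. It is the threshold
  for images under \<open>T ^^ n\<close> of nondegenerate \<open>n + k\<close>-cylinders: an image
  that fills a whole \<open>k\<close>-cylinder has at least this length.\<close>

definition \<delta> :: "nat \<Rightarrow> real" where
  "\<delta> k = Min ((\<lambda>v. lm (cyl v)) ` fat k)"

lemma sum_lm_fat: "(\<Sum>u\<in>fat n. lm (cyl u)) = 1"
proof -
  have "(\<Sum>u\<in>fat n. lm (cyl u)) = (\<Sum>u\<in>words n. lm (cyl u))"
    using finite_words by (intro sum.mono_neutral_left) (auto simp: fat_def less_le)
  then show ?thesis by (simp add: sum_lm_cyl)
qed

lemma fat_nonempty: "fat n \<noteq> {}"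
  using sum_lm_fat[of n] by auto

lemma \<delta>_pos: "\<delta> k > 0"
  unfolding \<delta>_def using finite_fat fat_nonempty by (subst Min_gr_iff) (auto simp: fat_def)

lemma \<delta>_le: "v \<in> fat k \<Longrightarrow> \<delta> k \<le> lm (cyl v)"
  unfolding \<delta>_def using finite_fat by (intro Min_le) auto

lemma lm_cyl_le:
  assumes "u \<in> words n"
  shows "lm (cyl u) \<le> 1 / \<beta> ^ n"
proof -
  obtain x where x: "x \<in> cyl u" using cyl_nonempty[OF assms] by auto
  obtain t where t: "\<And>x. x \<in> cyl u \<Longrightarrow> (T ^^ n) x = t + (- \<beta>) ^ n * x"
    using funpow_affine_on_cyl[OF assms] by blast
  have "cyl u \<subseteq> (\<lambda>x. t + (- \<beta>) ^ n * x) -` {0<..1}"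
    using t funpow_unit cyl_unit by (metis (no_types, lifting) subset_iff vimageI)
  moreover have "(\<lambda>x. t + (- \<beta>) ^ n * x) -` {0<..1} \<in> fmeasurable lborel"
    using beta_gt_1 by (intro fmeasurable_affine_vimage unit_fmeasurable) auto
  ultimately have "lm (cyl u) \<le> lm ((\<lambda>x. t + (- \<beta>) ^ n * x) -` {0<..1})"
    by (intro measure_mono_fmeasurable) auto
  also have "\<dots> = 1 / \<beta> ^ n"
    using beta_gt_1 by (subst measure_lborel_affine_vimage) (auto simp: power_abs)
  finally show ?thesis .
qed

lemma \<delta>_upper: "\<delta> k \<le> 1 / \<beta> ^ k"
proof -
  obtain v where "v \<in> fat k" using fat_nonempty by blast
  then show ?thesis using \<delta>_le[of v k] lm_cyl_le[of v k] by (auto simp: fat_def)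
qed

lemma lm_funpow_preimage:
  assumes u: "u \<in> words n" and E: "E \<in> sets borel" "E \<subseteq> (T ^^ n) ` cyl u"
  shows "lm {x \<in> cyl u. (T ^^ n) x \<in> E} = lm E / \<beta> ^ n"
proof -
  obtain t where t: "\<And>x. x \<in> cyl u \<Longrightarrow> (T ^^ n) x = t + (- \<beta>) ^ n * x"
    using funpow_affine_on_cyl[OF u] by blast
  have "{x \<in> cyl u. (T ^^ n) x \<in> E} = (\<lambda>x. t + (- \<beta>) ^ n * x) -` E"
  proof (intro equalityI subsetI)
    fix x assume "x \<in> (\<lambda>x. t + (- \<beta>) ^ n * x) -` E"
    then have xE: "t + (- \<beta>) ^ n * x \<in> E" by simp
    then obtain y where y: "y \<in> cyl u" "t + (- \<beta>) ^ n * x = (T ^^ n) y" using E by blast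
    then have "x = y" using t beta_gt_1 by auto
    with y t xE show "x \<in> {x \<in> cyl u. (T ^^ n) x \<in> E}" by auto
  qed (use t in auto)
  then show ?thesis
    using beta_gt_1 by (simp add: measure_lborel_affine_vimage E power_abs)
qed

lemma lm_null_mono: "A \<subseteq> B \<Longrightarrow> A \<in> sets borel \<Longrightarrow> B \<in> sets borel \<Longrightarrow> B \<subseteq> {0<..1} \<Longrightarrow> lm A > 0 \<Longrightarrow> lm B > 0"
  using lm_mono[of A B] by linarith

text \<open>The image of an \<open>n\<close>-cylinder is an interval, so all but at most two of the \<open>k\<close>-cylinders meeting
  it are contained in it; the corresponding \<open>n + k\<close>-cylinders are not short.\<close>

lemma card_short_children:
  assumes a: "a \<in> words n"
  shows "card {u \<in> fat (n + k). take n u = a \<and> \<beta> ^ n * lm (cyl u) < \<delta> k} \<le> 2"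
proof -
  let ?S = "{u \<in> fat (n + k). take n u = a \<and> \<beta> ^ n * lm (cyl u) < \<delta> k}"
  define D where "D = (T ^^ n) ` cyl a"
  have conv: "z \<in> D" if "p \<in> D" "q \<in> D" "p \<le> z" "z \<le> q" for p q z
    using funpow_image_between[OF a] that unfolding D_def by blast
  have fin: "finite ?S" using finite_fat by auto
  \<comment> \<open>The image of a short child is the part of a \<open>k\<close>-cylinder inside
    \<open>D\<close>. If the \<open>k\<close>-cylinder were contained in \<open>D\<close>, the image
    would have length at least \<open>\<delta> k\<close>; hence it meets both \<open>D\<close> and
    the complement.\<close>
  have S: "u = a @ drop n u \<and> drop n u \<in> words k \<and>
      (\<exists>q \<in> cyl (drop n u). q \<in> D) \<and> (\<exists>p \<in> cyl (drop n u). p \<notin> D)" if "u \<in> ?S" for u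
  proof -
    have u: "u \<in> words (n + k)" "u = a @ drop n u" "lm (cyl u) > 0" "\<beta> ^ n * lm (cyl u) < \<delta> k"
      using that append_in_words(3)[of u n k] by (auto simp: fat_def)
    define v where "v = drop n u"
    have v: "v \<in> words k" "u = a @ v" using u append_in_words by (auto simp: v_def)
    have cyl_u: "cyl u = {x \<in> cyl a. (T ^^ n) x \<in> cyl v}"
      using length_words[OF a] by (simp add: v cyl_append)
    obtain x where "x \<in> cyl u" using cyl_nonempty[OF u(1)] by blast
    then have 1: "\<exists>q\<in>cyl v. q \<in> D" unfolding cyl_u D_def by blast
    have "\<not> cyl v \<subseteq> D"
    proof
      assume "cyl v \<subseteq> D"
      then have eq: "lm (cyl u) = lm (cyl v) / \<beta> ^ n"
        unfolding cyl_u D_def by (intro lm_funpow_preimage a) auto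
      with u have "lm (cyl v) > 0" using beta_gt_1 by (simp add: zero_less_divide_iff)
      then have "\<delta> k \<le> lm (cyl v)" using v by (intro \<delta>_le) (simp add: fat_def)
      with eq u beta_gt_1 show False by simp
    qed
    with 1 u v show ?thesis unfolding v_def by blast
  qed
  \<comment> \<open>\<open>L\<close> collects the words whose \<open>k\<close>-cylinder crosses the
    left end of \<open>D\<close>, and \<open>R\<close> those crossing the right end.\<close>
  define L where "L = {u \<in> ?S. \<exists>p \<in> cyl (drop n u). \<exists>q \<in> cyl (drop n u). p \<notin> D \<and> q \<in> D \<and> p < q}"
  define R where "R = {u \<in> ?S. \<exists>p \<in> cyl (drop n u). \<exists>q \<in> cyl (drop n u). p \<notin> D \<and> q \<in> D \<and> q < p}"
  have eqI: "u = v" if "u \<in> ?S" "v \<in> ?S" "x \<in> cyl (drop n u)" "x \<in> cyl (drop n v)" for u v x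
    using cyl_disjoint[OF _ that(3,4)] S[OF that(1)] S[OF that(2)] length_words by metis
  have L: "card L \<le> Suc 0"
  proof (subst card_le_Suc0_iff_eq)
    show "\<forall>u\<in>L. \<forall>v\<in>L. u = v"
    proof (intro ballI)
      fix u v assume uv: "u \<in> L" "v \<in> L"
      obtain p q where pq: "p \<in> cyl (drop n u)" "q \<in> cyl (drop n u)" "p \<notin> D" "q \<in> D" "p < q"
        using uv unfolding L_def by blast
      obtain p' q' where pq': "p' \<in> cyl (drop n v)" "q' \<in> cyl (drop n v)" "p' \<notin> D" "q' \<in> D" "p' < q'"
        using uv unfolding L_def by blast
      have "p < q'" using conv[of q' q p] pq pq' by force
      moreover have "p' < q" using conv[of q q' p'] pq pq' by force
      \<comment> \<open>Both \<open>p\<close> and \<open>p'\<close> lie below the interval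
        \<open>D\<close>, hence below \<open>q\<close> and \<open>q'\<close>; the larger one belongs
        to both cylinders, which are therefore equal.\<close>
      ultimately have "max p p' \<in> cyl (drop n u)" "max p p' \<in> cyl (drop n v)"
        using pq pq' by (auto intro: cyl_between[of p _ q] cyl_between[of p' _ q'])
      then show "u = v" using eqI uv unfolding L_def by blast
    qed
  qed (rule finite_subset[OF _ fin], auto simp: L_def)
  have R: "card R \<le> Suc 0"
  proof (subst card_le_Suc0_iff_eq)
    show "\<forall>u\<in>R. \<forall>v\<in>R. u = v"
    proof (intro ballI)
      fix u v assume uv: "u \<in> R" "v \<in> R"
      obtain p q where pq: "p \<in> cyl (drop n u)" "q \<in> cyl (drop n u)" "p \<notin> D" "q \<in> D" "q < p"
        using uv unfolding R_def by blast
      obtain p' q' where pq': "p' \<in> cyl (drop n v)" "q' \<in> cyl (drop n v)" "p' \<notin> D" "q' \<in> D" "q' < p'"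
        using uv unfolding R_def by blast
      have "q' < p" using conv[of q q' p] pq pq' by force
      moreover have "q < p'" using conv[of q' q p'] pq pq' by force
      ultimately have "min p p' \<in> cyl (drop n u)" "min p p' \<in> cyl (drop n v)"
        using pq pq' by (auto intro: cyl_between[of q _ p] cyl_between[of q' _ p'])
      then show "u = v" using eqI uv unfolding R_def by blast
    qed
  qed (rule finite_subset[OF _ fin], auto simp: R_def)
  have "?S \<subseteq> L \<union> R"
  proof
    fix u assume u: "u \<in> ?S"
    obtain q p where "q \<in> cyl (drop n u)" "q \<in> D" "p \<in> cyl (drop n u)" "p \<notin> D"
      using S[OF u] by blast
    moreover from this have "p < q \<or> q < p" by (metis linorder_neqE)
    ultimately show "u \<in> L \<union> R" unfolding L_def R_def using u by blast
  qed
  then have "card ?S \<le> card (L \<union> R)"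
    by (intro card_mono finite_subset[OF _ fin]) (auto simp: L_def R_def)
  also have "\<dots> \<le> card L + card R" by (rule card_Un_le)
  finally show ?thesis using L R by simp
qed

lemma take_fat:
  assumes "u \<in> fat (n + k)"
  shows "take n u \<in> fat n"
proof -
  have u: "u \<in> words (n + k)" "lm (cyl u) > 0" using assms by (auto simp: fat_def)
  have "cyl u \<subseteq> cyl (take n u)"
    using cyl_append[of "take n u" "drop n u"] by auto
  then have "lm (cyl (take n u)) > 0"
    using lm_null_mono[OF _ cyl_sets cyl_sets cyl_unit u(2)] by blast
  then show ?thesis using append_in_words[OF u(1)] by (simp add: fat_def)
qed

lemma card_short: "card {u \<in> fat (n + k). \<beta> ^ n * lm (cyl u) < \<delta> k} \<le> 2 * card (fat n)"
proof -
  let ?S = "\<lambda>a. {u \<in> fat (n + k). take n u = a \<and> \<beta> ^ n * lm (cyl u) < \<delta> k}"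
  have "{u \<in> fat (n + k). \<beta> ^ n * lm (cyl u) < \<delta> k} = (\<Union>a\<in>fat n. ?S a)"
    using take_fat by auto
  then have "card {u \<in> fat (n + k). \<beta> ^ n * lm (cyl u) < \<delta> k} \<le> (\<Sum>a\<in>fat n. card (?S a))"
    using card_UN_le[OF finite_fat, of ?S n] by simp
  also have "\<dots> \<le> (\<Sum>a\<in>fat n. 2)"
    using fat_subset by (intro sum_mono card_short_children) auto
  finally show ?thesis by simp
qed

text \<open>A volume count. The total length stays in the bound because it is small for cylinders
  near a null set.\<close>

lemma card_long_le:
  assumes "S \<subseteq> {u \<in> fat (n + k). \<beta> ^ n * lm (cyl u) \<ge> \<delta> k}"
  shows "card S \<le> (\<Sum>u\<in>S. lm (cyl u)) * \<beta> ^ n / \<delta> k"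
proof -
  have "card S * \<delta> k = (\<Sum>u\<in>S. \<delta> k)" by simp
  also have "\<dots> \<le> (\<Sum>u\<in>S. \<beta> ^ n * lm (cyl u))" using assms by (intro sum_mono) auto
  finally show ?thesis
    using \<delta>_pos[of k] by (simp add: sum_distrib_left[symmetric] field_simps)
qed

lemma card_fat_add: "card (fat (n + k)) \<le> 2 * card (fat n) + \<beta> ^ n / \<delta> k"
proof -
  let ?S = "{u \<in> fat (n + k). \<beta> ^ n * lm (cyl u) < \<delta> k}" and ?L = "{u \<in> fat (n + k). \<beta> ^ n * lm (cyl u) \<ge> \<delta> k}"
  have "fat (n + k) = ?S \<union> ?L" by auto
  then have "card (fat (n + k)) \<le> card ?S + card ?L" by (metis (no_types, lifting) card_Un_le)
  then have "real (card (fat (n + k))) \<le> real (card ?S) + card ?L" by linarith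
  also have "card ?L \<le> (\<Sum>u\<in>?L. lm (cyl u)) * \<beta> ^ n / \<delta> k"
    by (rule card_long_le) simp
  also have "\<dots> \<le> 1 * \<beta> ^ n / \<delta> k"
    using beta_gt_1 \<delta>_pos[of k] fat_subset
    by (intro divide_right_mono mult_right_mono sum_lm_cyl_le[of _ "n + k"]) auto
  also have "real (card ?S) \<le> 2 * card (fat n)" using card_short[of n k] by linarith
  finally show ?thesis by simp
qed

lemma card_fat_bound: "\<exists>C\<ge>1. \<forall>n. card (fat n) \<le> C * \<beta> ^ n"
proof -
  \<comment> \<open>Over \<open>k\<close> steps the recursion doubles the count and adds one more
    multiple of \<open>\<beta> ^ m\<close>; the resulting factor 3 has to be absorbed by
    \<open>\<beta> ^ k\<close>.\<close>
  obtain k where k: "4 < \<beta> ^ k" using real_arch_pow[OF beta_gt_1] by blast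
  then have k0: "k > 0" by (cases k) auto
  \<comment> \<open>The sum covers the base cases \<open>n < k\<close>, and
    \<open>1 / \<delta> k\<close> the long cylinders of the recursion.\<close>
  define C where "C = 1 + 1 / \<delta> k + (\<Sum>i<k. real (card (fat i)))"
  have C: "C \<ge> 1" "1 / \<delta> k \<le> C" using \<delta>_pos[of k] by (auto simp: C_def intro!: add_nonneg_nonneg sum_nonneg)
  have "card (fat n) \<le> C * \<beta> ^ n" for n
  proof (induction n rule: less_induct)
    case (less n)
    show ?case
    proof (cases "n < k")
      case True
      have "card (fat n) \<le> (\<Sum>i<k. real (card (fat i)))"
        using True by (intro member_le_sum) auto
      also have "\<dots> \<le> C * 1" using \<delta>_pos[of k] by (simp add: C_def)
      also have "\<dots> \<le> C * \<beta> ^ n" using C beta_gt_1 by (intro mult_left_mono) auto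
      finally show ?thesis .
    next
      case False
      define m where "m = n - k"
      have n: "n = m + k" "m < n" using False k0 by (auto simp: m_def)
      have "card (fat n) \<le> 2 * card (fat m) + \<beta> ^ m / \<delta> k"
        unfolding n by (rule card_fat_add)
      also have "\<dots> \<le> 2 * (C * \<beta> ^ m) + C * \<beta> ^ m"
        using less.IH[OF n(2)] mult_right_mono[OF C(2), of "\<beta> ^ m"] beta_gt_1 by simp
      also have "\<dots> \<le> 4 * (C * \<beta> ^ m)" using C beta_gt_1 by simp
      also have "\<dots> \<le> \<beta> ^ k * (C * \<beta> ^ m)" using k C beta_gt_1 by (intro mult_right_mono) auto
      also have "\<dots> = C * \<beta> ^ n" by (simp add: n power_add)
      finally show ?thesis .
    qed
  qed
  with C show ?thesis by blast
qed

section \<open>Degenerate cylinders and periodic points\<close>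

lemma word_locally_constant:
  "(\<And>i. i < n \<Longrightarrow> \<beta> * (T ^^ i) x \<notin> \<int>) \<Longrightarrow> \<forall>\<^sub>F y in nhds x. word n y = word n x"
proof (induction n arbitrary: x)
  case (Suc n)
  have x: "\<beta> * x \<notin> \<int>" using Suc.prems[of 0] by simp
  have "of_int \<lfloor>\<beta> * x\<rfloor> < \<beta> * x"
    using x by (metis Ints_of_int of_int_floor_le order_le_less)
  then have "\<forall>\<^sub>F y in nhds x. of_int \<lfloor>\<beta> * x\<rfloor> < \<beta> * y"
    by (rule order_tendstoD(1)[OF tendsto_mult[OF tendsto_const filterlim_ident]])
  moreover have "\<forall>\<^sub>F y in nhds x. \<beta> * y < of_int \<lfloor>\<beta> * x\<rfloor> + 1"
    by (rule order_tendstoD(2)[OF tendsto_mult[OF tendsto_const filterlim_ident]]) linarith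
  ultimately have ev: "\<forall>\<^sub>F y in nhds x. digit y = digit x"
    by eventually_elim (auto simp: digit_def floor_unique)
  have "((\<lambda>y. of_int (digit x) + 1 - \<beta> * y) \<longlongrightarrow> T x) (nhds x)"
    unfolding T_eq by (intro tendsto_intros filterlim_ident)
  then have "filterlim T (nhds (T x)) (nhds x)"
    by (rule Lim_transform_eventually) (use ev in eventually_elim, simp add: T_eq)
  moreover have "\<forall>\<^sub>F y in nhds (T x). word n y = word n (T x)"
    using Suc.prems[of "Suc _"] by (intro Suc.IH) (simp add: funpow_swap1)
  ultimately have "\<forall>\<^sub>F y in nhds x. word n (T y) = word n (T x)"
    by (rule eventually_compose_filterlim[rotated])
  with ev show ?case by eventually_elim (simp add: itinerary_Suc')
qed simp

lemma thin_cyl_singleton: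
  assumes "lm (cyl u) = 0" "x \<in> cyl u" "y \<in> cyl u"
  shows "x = y"
proof (rule ccontr)
  assume "x \<noteq> y"
  then obtain a b where ab: "a \<in> cyl u" "b \<in> cyl u" "a < b"
    using assms(2,3) by (metis linorder_neqE)
  then have "lm {a..b} > 0" by simp
  moreover have "{a..b} \<subseteq> cyl u" using ab cyl_between[of a u b] by auto
  ultimately have "lm (cyl u) > 0"
    using lm_null_mono[OF _ _ cyl_sets cyl_unit, of "{a..b}"] by simp
  with assms(1) show False by simp
qed

text \<open>Otherwise the word would be constant near \<open>x\<close>, and the cylinder would
  contain a neighbourhood. The point 1 counts as a break because it is the endpoint of the
  space.\<close>

lemma thin_cyl_hits_break:
  assumes u: "u \<in> words n" "lm (cyl u) = 0" "x \<in> cyl u"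
  shows "\<exists>i<n. (T ^^ i) x = 1 \<or> \<beta> * (T ^^ i) x \<in> \<int>"
proof (rule ccontr)
  assume "\<not> ?thesis"
  then have ne: "\<And>i. i < n \<Longrightarrow> (T ^^ i) x \<noteq> 1" and nb: "\<And>i. i < n \<Longrightarrow> \<beta> * (T ^^ i) x \<notin> \<int>" by auto
  have "n \<noteq> 0"
  proof
    assume "n = 0"
    then have "cyl u = {0<..1}" using length_words[OF u(1)] by (auto simp: cyl_def)
    then show False using u by simp
  qed
  then have "x \<noteq> 1" using ne[of 0] by simp
  have x: "x \<in> {0<..1}" "word n x = u" using u length_words[OF u(1)] by (auto simp: cyl_def)
  have "\<forall>\<^sub>F y in nhds x. y \<in> {0<..<1}"
    using x \<open>x \<noteq> 1\<close> by (intro eventually_nhds_in_open) auto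
  moreover have "\<forall>\<^sub>F y in nhds x. word n y = word n x"
    by (rule word_locally_constant[OF nb])
  ultimately have "\<forall>\<^sub>F y in nhds x. y \<in> cyl u"
    by eventually_elim (use x length_words[OF u(1)] in \<open>auto simp: cyl_def\<close>)
  then obtain e where "e > 0" and e: "\<And>y. dist y x < e \<Longrightarrow> y \<in> cyl u"
    by (auto simp: eventually_nhds_metric)
  have "x + e / 2 \<in> cyl u" using \<open>e > 0\<close> by (intro e) (simp add: dist_real_def)
  from thin_cyl_singleton[OF u(2) u(3) this] \<open>e > 0\<close> show False by simp
qed

text \<open>The orbit of such a point contains a periodic break. There are finitely many breaks, the
  orbit of a periodic one is finite, and it leads back to the point. The set \<open>F\<close> serves
  all \<open>n\<close> at once.\<close>

lemma periodic_thin_finite: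
  "\<exists>F. finite F \<and> (\<forall>n u x. u \<in> words n \<longrightarrow> lm (cyl u) = 0 \<longrightarrow> x \<in> cyl u \<longrightarrow> (\<exists>p\<ge>1. (T ^^ p) x = x) \<longrightarrow> x \<in> F)"
proof -
  define B where "B = {b \<in> {0<..1}. (b = 1 \<or> \<beta> * b \<in> \<int>) \<and> (\<exists>p\<ge>1. (T ^^ p) b = b)}"
  have "B \<subseteq> insert 1 ((\<lambda>k. of_int k / \<beta>) ` {0..\<lfloor>\<beta>\<rfloor>})"
  proof
    fix b assume b: "b \<in> B"
    show "b \<in> insert 1 ((\<lambda>k. of_int k / \<beta>) ` {0..\<lfloor>\<beta>\<rfloor>})"
    proof (cases "b = 1")
      case False
      with b obtain k :: int where k: "\<beta> * b = of_int k" by (auto simp: B_def elim!: Ints_cases)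
      have b01: "0 < b" "b \<le> 1" using b by (auto simp: B_def)
      then have "0 \<le> \<beta> * b" "\<beta> * b \<le> \<beta>" using beta_gt_1 by (auto simp: mult_le_cancel_left1)
      with k have "k \<in> {0..\<lfloor>\<beta>\<rfloor>}" by (simp add: le_floor_iff)
      moreover have "b = of_int k / \<beta>" using k beta_gt_1 by (simp add: field_simps)
      ultimately show ?thesis by blast
    qed simp
  qed
  then have finB: "finite B" by (rule finite_subset) simp
  define F where "F = (\<Union>b\<in>B. range (\<lambda>j. (T ^^ j) b))"
  have fin_orbit: "finite (range (\<lambda>j. (T ^^ j) b))" if b: "b \<in> B" for b
  proof -
    obtain p where p: "p \<ge> 1" "(T ^^ p) b = b" using b by (auto simp: B_def)
    have "(T ^^ j) b \<in> (\<lambda>j. (T ^^ j) b) ` {..<p}" for j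
      using funpow_mod_eq[OF p(2), of j] p(1) by (intro image_eqI[of _ _ "j mod p"]) auto
    then have "range (\<lambda>j. (T ^^ j) b) \<subseteq> (\<lambda>j. (T ^^ j) b) ` {..<p}" by blast
    then show ?thesis by (rule finite_subset) simp
  qed
  show ?thesis
  proof (intro exI conjI allI impI)
    show "finite F" unfolding F_def using finB fin_orbit by blast
    fix n u x
    assume u: "u \<in> words n" "lm (cyl u) = 0" "x \<in> cyl u" and "\<exists>p\<ge>1. (T ^^ p) x = x"
    then obtain p where p: "p \<ge> 1" "(T ^^ p) x = x" by blast
    obtain i where i: "(T ^^ i) x = 1 \<or> \<beta> * (T ^^ i) x \<in> \<int>"
      using thin_cyl_hits_break[OF u] by blast
    define b where "b = (T ^^ i) x"
    have comp: "(T ^^ m) ((T ^^ l) x) = (T ^^ (m + l)) x" for m l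
      by (simp add: funpow_add)
    have "(T ^^ p) b = b"
      unfolding b_def comp using comp[of i p] p by (simp add: add.commute)
    then have bB: "b \<in> B"
      using i funpow_unit[of x i] u cyl_unit p(1) unfolding B_def b_def by blast
    \<comment> \<open>Running from time \<open>i\<close> on to the time \<open>p * i\<close>, a
      multiple of the period, closes the loop at \<open>x\<close>.\<close>
    have "(T ^^ (p * i - i)) b = (T ^^ (p * i)) x"
      unfolding b_def comp using p(1) by simp
    also have "(T ^^ (p * i)) x = x"
      using funpow_mod_eq[OF p(2), of "p * i"] by simp
    finally have "x = (T ^^ (p * i - i)) b" by simp
    with bB show "x \<in> F" unfolding F_def by blast
  qed
qed

end

section \<open>Entropy of invariant measures\<close>

lemma sets_unit_borel: "A \<in> sets unit_borel \<longleftrightarrow> A \<in> sets borel \<and> A \<subseteq> {0<..1}"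
  by (auto simp: unit_borel_def sets_restrict_space_iff)

text \<open>Inner regularity of the push-forward to the Borel sets of the line. The intersection
  with the unit interval allows \<open>A\<close> to be a complement in the line.\<close>

lemma compact_inner_approx:
  fixes A :: "real set"
  assumes "finite_measure M" and sets: "sets M = sets unit_borel" and A: "A \<in> sets borel" and "e > 0"
  obtains K where "compact K" "K \<subseteq> A" "measure M ((A - K) \<inter> {0<..1}) \<le> e"
proof -
  interpret finite_measure M by fact
  have space: "space M = {0<..1}" using sets_eq_imp_space_eq[OF sets] by (simp add: space_unit_borel)
  define N where "N = distr M borel (\<lambda>x. x)"
  have id[measurable]: "(\<lambda>x. x) \<in> measurable M borel"
    using sets by (auto simp: measurable_def space sets_unit_borel)
  interpret N: finite_measure N
    unfolding N_def by (rule finite_measure_distr[OF id])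
  have m: "measure N B = measure M (B \<inter> {0<..1})" if "B \<in> sets borel" for B
    using that unfolding N_def by (subst measure_distr[OF id]) (auto simp: space)
  have "\<exists>K. compact K \<and> K \<subseteq> A \<and> measure N A - e \<le> measure N K"
  proof (cases "measure N A = 0")
    case True
    with \<open>e > 0\<close> show ?thesis by (intro exI[of _ "{}"]) auto
  next
    case False
    then have "ennreal (measure N A - e) < emeasure N A"
      using \<open>e > 0\<close> by (subst N.emeasure_eq_measure, intro ennreal_lessI) (simp_all add: less_le)
    also have "emeasure N A = (SUP K \<in> {K. K \<subseteq> A \<and> compact K}. emeasure N K)"
      using A by (intro inner_regular) (simp_all add: N_def N.emeasure_finite[unfolded N_def])
    finally obtain K where K: "K \<subseteq> A" "compact K" "ennreal (measure N A - e) < emeasure N K"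
      unfolding less_SUP_iff by blast
    then have "measure N A - e \<le> measure N K"
      unfolding N.emeasure_eq_measure by (metis ennreal_le_iff less_imp_le measure_nonneg)
    with K show ?thesis by blast
  qed
  then obtain K where K: "compact K" "K \<subseteq> A" "measure N A - e \<le> measure N K" by blast
  have "measure N (A - K) = measure N A - measure N K"
    using A K borel_compact[OF K(1)] by (intro N.finite_measure_Diff) (auto simp: N_def)
  moreover have "measure N (A - K) = measure M ((A - K) \<inter> {0<..1})"
    using A borel_compact[OF K(1)] by (intro m) auto
  ultimately show ?thesis using K that by auto
qed

context neg_beta
begin

lemma digit_measurable [measurable]: "digit \<in> measurable borel (count_space UNIV)"
  unfolding digit_def by measurable

lemma inverse_power_tendsto_0: "(\<lambda>n. 1 / \<beta> ^ n) \<longlonglongrightarrow> 0"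
  using LIMSEQ_divide_realpow_zero[OF beta_gt_1, of 1] by simp

lemma eventually_inverse_power_less:
  assumes "e > 0"
  shows "\<forall>\<^sub>F n in sequentially. 1 / \<beta> ^ n < e"
  using order_tendstoD(2)[OF inverse_power_tendsto_0 assms] .

text \<open>Disjoint compact and closed sets have positive distance, while the diameters of
  cylinders tend to 0.\<close>

lemma eventually_cyl_separated:
  assumes "compact K" "closed L" "K \<inter> L = {}"
  shows "\<forall>\<^sub>F m in sequentially. \<forall>u. length u = m \<longrightarrow> cyl u \<inter> K \<noteq> {} \<longrightarrow> cyl u \<inter> L = {}"
proof -
  obtain d where d: "d > 0" "\<forall>x\<in>K. \<forall>y\<in>L. d \<le> dist x y"
    using separate_compact_closed[OF assms] by blast
  from eventually_inverse_power_less[OF d(1)] show ?thesis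
  proof eventually_elim
    case (elim m)
    show ?case
    proof (intro allI impI equals0I)
      fix u y assume u: "length u = m" "cyl u \<inter> K \<noteq> {}" and y: "y \<in> cyl u \<inter> L"
      obtain x where x: "x \<in> cyl u" "x \<in> K" using u by blast
      have "\<bar>x - y\<bar> \<le> 1 / \<beta> ^ m"
        using x y u by (intro cyl_diameter) (auto simp: cyl_def)
      moreover have "d \<le> \<bar>x - y\<bar>" using d x y by (auto simp: dist_real_def)
      ultimately show False using elim by simp
    qed
  qed
qed

text \<open>\<open>S\<close> consists of the words whose cylinder meets a compact \<open>K\<close>
  inside \<open>A\<close>. Long cylinders do not meet both \<open>K\<close> and a compact
  \<open>L\<close> inside the complement, so errors occur only outside both. Finite measures are
  allowed because Lebesgue measure is a second application.\<close>

lemma cyl_approx: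
  assumes M: "finite_measure M" "sets M = sets unit_borel" and A: "A \<in> sets M" and "e > 0"
  shows "\<forall>\<^sub>F m in sequentially. \<exists>S. measure M {x \<in> {0<..1}. (x \<in> A) \<noteq> (word m x \<in> S)} \<le> e"
proof -
  interpret finite_measure M by fact
  have A': "A \<in> sets borel" "A \<subseteq> {0<..1}" using A M by (auto simp: sets_unit_borel)
  have "e / 2 > 0" using \<open>e > 0\<close> by simp
  obtain K where K: "compact K" "K \<subseteq> A" "measure M ((A - K) \<inter> {0<..1}) \<le> e / 2"
    using compact_inner_approx[OF M A'(1) \<open>e / 2 > 0\<close>] .
  have "- A \<in> sets borel" using A' by auto
  obtain L where L: "compact L" "L \<subseteq> - A" "measure M ((- A - L) \<inter> {0<..1}) \<le> e / 2"
    using compact_inner_approx[OF M \<open>- A \<in> sets borel\<close> \<open>e / 2 > 0\<close>] .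
  have "\<forall>\<^sub>F m in sequentially. \<forall>u. length u = m \<longrightarrow> cyl u \<inter> K \<noteq> {} \<longrightarrow> cyl u \<inter> L = {}"
    using K L by (intro eventually_cyl_separated compact_imp_closed) auto
  then show ?thesis
  proof eventually_elim
    case (elim m)
    define S where "S = {u. length u = m \<and> cyl u \<inter> K \<noteq> {}}"
    have "{x \<in> {0<..1}. (x \<in> A) \<noteq> (word m x \<in> S)} \<subseteq> (A - K) \<inter> {0<..1} \<union> (- A - L) \<inter> {0<..1}"
    proof
      fix x assume "x \<in> {x \<in> {0<..1}. (x \<in> A) \<noteq> (word m x \<in> S)}"
      then have x: "x \<in> {0<..1}" "(x \<in> A) \<noteq> (word m x \<in> S)" by auto
      have xc: "x \<in> cyl (word m x)" using mem_cyl_word[OF x(1)] .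
      show "x \<in> (A - K) \<inter> {0<..1} \<union> (- A - L) \<inter> {0<..1}"
      proof (cases "x \<in> A")
        case True
        then have "x \<notin> K" using x xc by (auto simp: S_def)
        with True x show ?thesis by blast
      next
        case False
        then have "cyl (word m x) \<inter> L = {}" using x elim by (auto simp: S_def)
        with False x xc show ?thesis by blast
      qed
    qed
    moreover have "(A - K) \<inter> {0<..1} \<in> sets M" "(- A - L) \<inter> {0<..1} \<in> sets M"
      using A' borel_compact[OF K(1)] borel_compact[OF L(1)] by (auto simp: M sets_unit_borel)
    ultimately have "measure M {x \<in> {0<..1}. (x \<in> A) \<noteq> (word m x \<in> S)} \<le>
        measure M ((A - K) \<inter> {0<..1}) + measure M ((- A - L) \<inter> {0<..1})"
      by (intro order_trans[OF finite_measure_mono measure_Un_le]) auto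
    with K L show ?case by (intro exI[of _ S]) linarith
  qed
qed

end

section \<open>Entropy bounds for a fixed invariant measure\<close>

locale neg_beta_invariant_measure = neg_beta +
  fixes \<nu> :: "real measure"
  assumes inv: "invariant_prob unit_borel T \<nu>"
begin

lemma sets_nu [measurable_cong]: "sets \<nu> = sets unit_borel"
  using inv by (simp add: invariant_prob_def)

lemma space_nu: "space \<nu> = {0<..1}"
  using sets_eq_imp_space_eq[OF sets_nu] by (simp add: space_unit_borel)

sublocale measure_preserving_system \<nu> T
  using inv unfolding invariant_prob_def
  by (intro measure_preserving_system.intro measure_preserving_system_axioms.intro) auto

lemma sets_nu_iff: "A \<in> sets \<nu> \<longleftrightarrow> A \<in> sets borel \<and> A \<subseteq> {0<..1}"
  by (simp add: sets_nu sets_unit_borel)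

lemma cyl_sets_nu: "cyl u \<in> sets \<nu>"
  using cyl_unit by (simp add: sets_nu_iff)

lemma simple_function_digit: "simple_function \<nu> digit"
  unfolding simple_function_def
proof (intro conjI ballI)
  have "digit ` space \<nu> \<subseteq> {0..\<lfloor>\<beta>\<rfloor>}"
    using beta_gt_1 by (auto simp: digit_def space_nu intro!: floor_mono)
  then show "finite (digit ` space \<nu>)" by (rule finite_subset) simp
  fix d
  have "digit -` {d} \<in> sets borel" using measurable_sets[OF digit_measurable, of "{d}"] by simp
  then show "digit -` {d} \<inter> space \<nu> \<in> sets \<nu>" by (auto simp: sets_nu_iff space_nu)
qed

lemma simple_function_word: "simple_function \<nu> (word n)"
  by (rule simple_function_itinerary[OF simple_function_digit])

lemma ks_entropy_eq: "ks_entropy \<nu> T = ereal (ent_rate digit)"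
  using cyl_approx[OF finite_measure_axioms sets_nu]
  by (intro ks_entropy_generator[OF simple_function_digit]) (simp add: space_nu)

lemma fibre_prob_word: "u \<in> words n \<Longrightarrow> fibre_prob \<nu> (word n) u = measure \<nu> (cyl u)"
  unfolding fibre_prob_def using length_words
  by (intro arg_cong[where f="measure \<nu>"]) (auto simp: cyl_def space_nu)

lemma word_image_space: "word n ` space \<nu> = words n"
  by (simp add: words_def space_nu)

lemma ent_word: "ent \<nu> (word n) = - (\<Sum>u\<in>words n. measure \<nu> (cyl u) * ln (measure \<nu> (cyl u)))"
  unfolding ent_def word_image_space by (simp add: fibre_prob_word)

lemma sum_measure_cyl: "(\<Sum>u\<in>words n. measure \<nu> (cyl u)) = 1"
  using sum_fibre_prob_eq_1[OF simple_function_word[of n]] by (simp add: word_image_space fibre_prob_word)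

lemma measure_Union_cyl:
  assumes "S \<subseteq> words n"
  shows "measure \<nu> (\<Union>u\<in>S. cyl u) = (\<Sum>u\<in>S. measure \<nu> (cyl u))"
proof (rule finite_measure_finite_Union)
  show "finite S" using assms finite_words by (rule finite_subset)
  show "disjoint_family_on cyl S"
    unfolding disjoint_family_on_def
  proof (intro ballI impI equals0I)
    fix u v x assume "u \<in> S" "v \<in> S" "u \<noteq> v" and x: "x \<in> cyl u \<inter> cyl v"
    then have "length u = length v" using assms length_words by (metis subsetD)
    with x \<open>u \<noteq> v\<close> show False using cyl_disjoint by blast
  qed
qed (use cyl_sets_nu in auto)

text \<open>Degenerate cylinders of positive measure are atoms, hence periodic points in the orbit of a
  discontinuity; there are only finitely many of these.\<close>

lemma card_charged_words:
  "\<exists>c::nat. \<forall>n Q. card {u \<in> words n. measure \<nu> (cyl u) > 0 \<and> Q u} \<le> card {u \<in> fat n. Q u} + c"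
proof -
  obtain F where F: "finite F" "\<And>n u x. u \<in> words n \<Longrightarrow> lm (cyl u) = 0 \<Longrightarrow> x \<in> cyl u \<Longrightarrow>
      \<exists>p\<ge>1. (T ^^ p) x = x \<Longrightarrow> x \<in> F"
    using periodic_thin_finite by blast
  have "card {u \<in> words n. measure \<nu> (cyl u) > 0 \<and> Q u} \<le> card {u \<in> fat n. Q u} + card F" for n Q
  proof -
    let ?D = "{u \<in> words n. lm (cyl u) = 0 \<and> measure \<nu> (cyl u) > 0}"
    have D: "\<exists>x\<in>F. x \<in> cyl u" if "u \<in> ?D" for u
    proof -
      have u: "u \<in> words n" "lm (cyl u) = 0" "measure \<nu> (cyl u) > 0" using that by auto
      obtain x where x: "x \<in> cyl u" using cyl_nonempty[OF u(1)] by blast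
      have "cyl u = {x}" using thin_cyl_singleton[OF u(2)] x by blast
      then have "\<exists>p\<ge>1. (T ^^ p) x = x" using atom_periodic[of x] u cyl_sets_nu[of u] by simp
      with F(2)[OF u(1,2) x] x show ?thesis by blast
    qed
    have "\<forall>u\<in>?D. \<exists>x. x \<in> F \<and> x \<in> cyl u"
    proof
      fix u assume "u \<in> ?D"
      from D[OF this] show "\<exists>x. x \<in> F \<and> x \<in> cyl u" by (elim bexE) (intro exI conjI)
    qed
    from bchoice[OF this] obtain f where f: "\<forall>u\<in>?D. f u \<in> F \<and> f u \<in> cyl u" by (elim exE)
    \<comment> \<open>Cylinders of distinct words of equal length are disjoint, so each point of
      \<open>F\<close> accounts for at most one charged degenerate word.\<close>
    have "inj_on f ?D"
    proof (rule inj_onI)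
      fix u v assume "u \<in> ?D" "v \<in> ?D" "f u = f v"
      moreover from this have "f u \<in> cyl u" "f u \<in> cyl v" using bspec[OF f, of u] bspec[OF f, of v] by auto
      ultimately show "u = v" using cyl_disjoint[of u v "f u"] length_words[of u n] length_words[of v n] by simp
    qed
    then have "card ?D \<le> card F" using f F(1) by (intro card_inj_on_le[of f]) blast+
    moreover have "card {u \<in> words n. measure \<nu> (cyl u) > 0 \<and> Q u} \<le> card ({u \<in> fat n. Q u} \<union> ?D)"
      using finite_words by (intro card_mono) (auto simp: fat_def less_le)
    ultimately show ?thesis using card_Un_le[of "{u \<in> fat n. Q u}" ?D] by linarith
  qed
  then show ?thesis by blast
qed

lemma card_charged_bound:
  "\<exists>C\<ge>1. \<forall>n. card {u \<in> words n. measure \<nu> (cyl u) > 0} \<le> C * \<beta> ^ n"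
proof -
  obtain C where C: "C \<ge> 1" "\<And>n. card (fat n) \<le> C * \<beta> ^ n" using card_fat_bound by blast
  obtain c where c: "\<And>n Q. card {u \<in> words n. measure \<nu> (cyl u) > 0 \<and> Q u} \<le> card {u \<in> fat n. Q u} + c"
    using card_charged_words by blast
  have "card {u \<in> words n. measure \<nu> (cyl u) > 0} \<le> (C + c) * \<beta> ^ n" for n
  proof -
    have "card {u \<in> words n. measure \<nu> (cyl u) > 0} \<le> card (fat n) + c"
      using c[of n "\<lambda>_. True"] by simp
    then have "real (card {u \<in> words n. measure \<nu> (cyl u) > 0}) \<le> real (card (fat n)) + real c"
      by linarith
    also have "\<dots> \<le> C * \<beta> ^ n + c * \<beta> ^ n"
      using C(2)[of n] beta_gt_1 by (intro add_mono) (auto simp: mult_le_cancel_left1)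
    finally show ?thesis by (simp add: distrib_right)
  qed
  with C(1) show ?thesis by (intro exI[of _ "C + c"]) auto
qed

lemma ent_word_le:
  assumes "\<And>u. u \<in> words n \<Longrightarrow> measure \<nu> (cyl u) > 0 \<Longrightarrow> q u > 0"
    and "(\<Sum>u | u \<in> words n \<and> measure \<nu> (cyl u) > 0. q u) \<le> 1"
  shows "ent \<nu> (word n) \<le> - (\<Sum>u\<in>words n. measure \<nu> (cyl u) * ln (q u))"
proof -
  have "{u \<in> words n. fibre_prob \<nu> (word n) u > 0} = {u \<in> words n. measure \<nu> (cyl u) > 0}"
    using fibre_prob_word by auto
  with assms show ?thesis
    using gibbs_inequality[OF simple_function_word[of n], of q]
    unfolding word_image_space by (simp add: fibre_prob_word)
qed

text \<open>Gibbs' inequality with constant weights on the charged cylinders; the constant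
  \<open>ln C\<close> disappears after division by \<open>n\<close>.\<close>

lemma ent_rate_upper: "ent_rate digit \<le> ln \<beta>"
proof -
  obtain C where C: "C \<ge> 1" "\<And>n. card {u \<in> words n. measure \<nu> (cyl u) > 0} \<le> C * \<beta> ^ n"
    using card_charged_bound by blast
  have le: "ent \<nu> (word n) \<le> ln C + n * ln \<beta>" for n
  proof -
    have pos: "C * \<beta> ^ n > 0" using C beta_gt_1 by simp
    have "ent \<nu> (word n) \<le> - (\<Sum>u\<in>words n. measure \<nu> (cyl u) * ln (1 / (C * \<beta> ^ n)))"
      using pos C(2)[of n] by (intro ent_word_le) simp_all
    also have "\<dots> = - ln (1 / (C * \<beta> ^ n))"
      unfolding sum_distrib_right[symmetric] by (simp add: sum_measure_cyl)
    also have "\<dots> = ln C + n * ln \<beta>"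
      using C beta_gt_1 by (simp add: ln_div ln_mult ln_realpow)
    finally show ?thesis .
  qed
  have "(\<lambda>n. ln C / real n + ln \<beta>) \<longlonglongrightarrow> 0 + ln \<beta>"
    by (intro tendsto_add lim_const_over_n tendsto_const)
  moreover have "\<exists>N. \<forall>n\<ge>N. ent \<nu> (word n) / n \<le> ln C / real n + ln \<beta>"
  proof (intro exI[of _ 1] allI impI)
    fix n :: nat assume "n \<ge> 1"
    with le[of n] show "ent \<nu> (word n) / n \<le> ln C / real n + ln \<beta>" by (simp add: field_simps)
  qed
  ultimately have "ent_rate digit \<le> 0 + ln \<beta>"
    by (rule LIMSEQ_le[OF ent_rate_LIMSEQ[OF simple_function_digit]])
  then show ?thesis by simp
qed

text \<open>Every \<open>n\<close>-cylinder has measure at most \<open>C / \<beta> ^ n\<close>, so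
  its information content is at least \<open>n * ln \<beta> - ln C\<close>.\<close>

lemma ent_rate_lower:
  assumes C: "C > 0" "\<And>A. A \<in> sets \<nu> \<Longrightarrow> measure \<nu> A \<le> C * lm A"
  shows "ln \<beta> \<le> ent_rate digit"
proof -
  have le: "n * ln \<beta> - ln C \<le> ent \<nu> (word n)" for n
  proof -
    have "(\<Sum>u\<in>words n. measure \<nu> (cyl u) * ln (measure \<nu> (cyl u))) \<le>
        (\<Sum>u\<in>words n. measure \<nu> (cyl u) * (ln C - n * ln \<beta>))"
    proof (rule sum_mono)
      fix u assume u: "u \<in> words n"
      show "measure \<nu> (cyl u) * ln (measure \<nu> (cyl u)) \<le> measure \<nu> (cyl u) * (ln C - n * ln \<beta>)"
      proof (cases "measure \<nu> (cyl u) = 0")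
        case False
        then have pos: "measure \<nu> (cyl u) > 0" by (simp add: less_le)
        have "measure \<nu> (cyl u) \<le> C * (1 / \<beta> ^ n)"
          using C(2)[OF cyl_sets_nu, of u] lm_cyl_le[OF u] C(1)
          by (meson less_imp_le mult_left_mono order_trans)
        then have "ln (measure \<nu> (cyl u)) \<le> ln (C * (1 / \<beta> ^ n))" using pos by simp
        also have "\<dots> = ln C - n * ln \<beta>" using C(1) beta_gt_1 by (simp add: ln_div ln_realpow)
        finally show ?thesis by (intro mult_left_mono) auto
      qed simp
    qed
    also have "\<dots> = ln C - n * ln \<beta>"
      unfolding sum_distrib_right[symmetric] by (simp add: sum_measure_cyl)
    finally show ?thesis by (simp add: ent_word)
  qed
  have lim: "(\<lambda>n. ln \<beta> - ln C / real n) \<longlonglongrightarrow> ln \<beta> - 0"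
    by (intro tendsto_diff lim_const_over_n tendsto_const)
  have "ln \<beta> - 0 \<le> ent_rate digit"
  proof (rule LIMSEQ_le[OF lim ent_rate_LIMSEQ[OF simple_function_digit]])
    show "\<exists>N. \<forall>n\<ge>N. ln \<beta> - ln C / real n \<le> ent \<nu> (word n) / n"
    proof (intro exI[of _ 1] allI impI)
      fix n :: nat assume "n \<ge> 1"
      then have "ln \<beta> - ln C / real n = (n * ln \<beta> - ln C) / n" by (simp add: diff_divide_distrib)
      also have "\<dots> \<le> ent \<nu> (word n) / n" using le[of n] by (intro divide_right_mono) auto
      finally show "ln \<beta> - ln C / real n \<le> ent \<nu> (word n) / n" .
    qed
  qed
  then show ?thesis by simp
qed

text \<open>Three kinds of cylinders each receive a third of \<open>\<epsilon>\<close>: short ones,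
  which are few by \<open>card_short\<close>; long ones, which eventually lie in a small
  neighbourhood \<open>U\<close> of \<open>K\<close> and are counted by volume; and degenerate ones,
  of which at most \<open>c\<close> are charged.\<close>

lemma card_charged_meeting_null:
  assumes K: "compact K" "K \<subseteq> {0<..1}" "lm K = 0" and "\<epsilon> > 0"
  shows "\<forall>\<^sub>F N in sequentially.
    card {u \<in> words N. measure \<nu> (cyl u) > 0 \<and> cyl u \<inter> K \<noteq> {}} \<le> \<epsilon> * \<beta> ^ N"
proof -
  obtain C where C: "C \<ge> 1" "\<And>n. card (fat n) \<le> C * \<beta> ^ n" using card_fat_bound by blast
  obtain c where c: "\<And>n Q. card {u \<in> words n. measure \<nu> (cyl u) > 0 \<and> Q u} \<le> card {u \<in> fat n. Q u} + c"
    using card_charged_words by blast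
  \<comment> \<open>There are at most \<open>2 * C * \<beta> ^ n\<close> short cylinders with
    \<open>n = N - k\<close>, and this \<open>k\<close> makes that at most
    \<open>\<epsilon> / 3 * \<beta> ^ N\<close>.\<close>
  have "\<epsilon> / (6 * C) > 0" using C \<open>\<epsilon> > 0\<close> by simp
  obtain k where k: "1 / \<beta> ^ k < \<epsilon> / (6 * C)"
    using eventually_happens[OF eventually_inverse_power_less[OF \<open>\<epsilon> / (6 * C) > 0\<close>]] by auto
  \<comment> \<open>Chosen such that the volume count
    \<open>\<eta> * \<beta> ^ n / \<delta> k\<close> of the long cylinders is
    \<open>\<epsilon> / 3 * \<beta> ^ n\<close>.\<close>
  define \<eta> where "\<eta> = \<epsilon> / 3 * \<delta> k"
  have "\<eta> > 0" using \<delta>_pos[of k] \<open>\<epsilon> > 0\<close> by (simp add: \<eta>_def)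
  have K_sets: "K \<in> sets borel" using K by (intro borel_compact)
  obtain U where U: "open U" "K \<subseteq> U" "emeasure lborel (U - K) < ennreal \<eta>"
    using outer_regular_lborel[OF K_sets \<open>\<eta> > 0\<close>] by blast
  have c_bound: "\<forall>\<^sub>F N in sequentially. 1 / \<beta> ^ N < \<epsilon> / (3 * (c + 1))"
    using \<open>\<epsilon> > 0\<close> by (intro eventually_inverse_power_less) simp
  have sep: "\<forall>\<^sub>F m in sequentially. \<forall>u. length u = m \<longrightarrow> cyl u \<inter> K \<noteq> {} \<longrightarrow> cyl u \<inter> (- U) = {}"
    using K U by (intro eventually_cyl_separated) auto
  from c_bound sep eventually_ge_at_top[of k] show ?thesis
  proof eventually_elim
    case (elim N)
    define n where "n = N - k"
    have N: "N = n + k" using elim by (simp add: n_def)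
    have pow: "\<beta> ^ n = \<beta> ^ N * (1 / \<beta> ^ k)" using beta_gt_1 by (simp add: N power_add)
    let ?E = "{u \<in> fat N. cyl u \<inter> K \<noteq> {}}"
    let ?S = "{u \<in> fat N. \<beta> ^ n * lm (cyl u) < \<delta> k}" and ?L = "{u \<in> ?E. \<beta> ^ n * lm (cyl u) \<ge> \<delta> k}"
    have L: "?L \<subseteq> words N" using fat_subset by blast
    have "card ?E \<le> card (?S \<union> ?L)"
      using finite_fat by (intro card_mono) auto
    then have "card ?E \<le> card ?S + card ?L" using card_Un_le[of ?S ?L] by linarith
    moreover have "card ?S \<le> 2 * card (fat n)" unfolding N by (rule card_short)
    ultimately have "real (card ?E) \<le> 2 * (C * \<beta> ^ n) + card ?L"
      using C(2)[of n] by linarith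
    also have "card ?L \<le> (\<Sum>u\<in>?L. lm (cyl u)) * \<beta> ^ n / \<delta> k"
      unfolding N by (rule card_long_le) auto
    also have "(\<Sum>u\<in>?L. lm (cyl u)) = lm (\<Union>u\<in>?L. cyl u)"
      using lm_cyl_Union[OF L, of UNIV] by simp
    also have "lm (\<Union>u\<in>?L. cyl u) \<le> \<eta>"
    proof -
      let ?A = "\<Union>u\<in>?L. cyl u"
      have "?A \<subseteq> U"
        using elim(2) fat_subset length_words by blast
      then have sub: "?A \<subseteq> (U - K) \<union> K" by blast
      have "emeasure lborel K = 0"
        using K fmeasurable_unit[OF K_sets K(2)] by (simp add: emeasure_eq_measure2)
      moreover have "emeasure lborel ?A \<le> emeasure lborel ((U - K) \<union> K)"
        using sub U K_sets by (intro emeasure_mono) auto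
      moreover have "emeasure lborel ((U - K) \<union> K) \<le> emeasure lborel (U - K) + emeasure lborel K"
        using U K_sets by (intro emeasure_subadditive) auto
      ultimately have "emeasure lborel ?A \<le> ennreal \<eta>" using U(3) by simp
      then show ?thesis unfolding measure_def using \<open>\<eta> > 0\<close> by (intro enn2real_leI) auto
    qed
    finally have "real (card ?E) \<le> 2 * (C * \<beta> ^ n) + \<eta> * \<beta> ^ n / \<delta> k"
      using beta_gt_1 \<delta>_pos[of k] by (simp add: divide_right_mono mult_right_mono)
    also have "\<eta> * \<beta> ^ n / \<delta> k = \<epsilon> / 3 * \<beta> ^ n" using \<delta>_pos[of k] by (simp add: \<eta>_def)
    also have "\<epsilon> / 3 * \<beta> ^ n \<le> \<epsilon> / 3 * \<beta> ^ N"
      using beta_gt_1 \<open>\<epsilon> > 0\<close> by (intro mult_left_mono power_increasing) (auto simp: N)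
    also have "2 * (C * \<beta> ^ n) \<le> \<epsilon> / 3 * \<beta> ^ N"
    proof -
      have "2 * (C * \<beta> ^ n) = 2 * C * (1 / \<beta> ^ k) * \<beta> ^ N" by (simp add: pow)
      also have "\<dots> \<le> 2 * C * (\<epsilon> / (6 * C)) * \<beta> ^ N"
        using k C beta_gt_1 by (intro mult_right_mono mult_left_mono) auto
      also have "2 * C * (\<epsilon> / (6 * C)) = \<epsilon> / 3" using C by simp
      finally show ?thesis .
    qed
    finally have E: "real (card ?E) \<le> \<epsilon> / 3 * \<beta> ^ N + \<epsilon> / 3 * \<beta> ^ N" by simp
    have "real c \<le> \<epsilon> / 3 * \<beta> ^ N"
    proof -
      have "3 * (real c + 1) < \<epsilon> * \<beta> ^ N"
        using elim(1) beta_gt_1 by (simp add: field_simps)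
      then show ?thesis by simp
    qed
    moreover have "real (card {u \<in> words N. measure \<nu> (cyl u) > 0 \<and> cyl u \<inter> K \<noteq> {}}) \<le> card ?E + real c"
      using c[of N "\<lambda>u. cyl u \<inter> K \<noteq> {}"] by linarith
    ultimately show ?case using E by linarith
  qed
qed

text \<open>Gibbs' inequality with two levels of weights: one half is shared by the few charged
  cylinders meeting \<open>K\<close>, the other by all charged cylinders. The mass \<open>s\<close>
  of \<open>K\<close> sits on the heavier weights, which saves a multiple of \<open>s\<close> at a
  single time \<open>N\<close>.\<close>

lemma max_ent_abs_continuous:
  assumes h: "ln \<beta> \<le> ent_rate digit" and A: "A \<in> sets \<nu>" "lm A = 0"
  shows "measure \<nu> A = 0"
proof (rule ccontr)
  assume "measure \<nu> A \<noteq> 0"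
  then have pos: "measure \<nu> A / 2 > 0" by (simp add: less_le)
  have A': "A \<in> sets borel" "A \<subseteq> {0<..1}" using A by (auto simp: sets_nu_iff)
  obtain K where K: "compact K" "K \<subseteq> A" "measure \<nu> ((A - K) \<inter> {0<..1}) \<le> measure \<nu> A / 2"
    using compact_inner_approx[OF finite_measure_axioms sets_nu A'(1) pos] .
  have K_sets: "K \<in> sets borel" using K by (intro borel_compact)
  have K_nu: "K \<in> sets \<nu>" using K A' K_sets by (auto simp: sets_nu_iff)
  have lmK: "lm K = 0" using lm_mono[of K A] K A A' K_sets by (simp add: order_antisym)
  define s where "s = measure \<nu> K"
  have "measure \<nu> (A - K) = measure \<nu> A - s"
    unfolding s_def using A K K_nu by (intro finite_measure_Diff) auto
  moreover have "(A - K) \<inter> {0<..1} = A - K" using A' by blast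
  ultimately have s: "s > 0" using K pos by simp
  obtain C where C: "C \<ge> 1" "\<And>n. card {u \<in> words n. measure \<nu> (cyl u) > 0} \<le> C * \<beta> ^ n"
    using card_charged_bound by blast
  \<comment> \<open>Makes the saving \<open>- s * ln \<epsilon>\<close> exceed the constants
    \<open>ln 2 + ln C\<close> of the entropy bound by exactly 1.\<close>
  define \<epsilon> where "\<epsilon> = exp (- (ln 2 + ln C + 1) / s)"
  have "ln 2 + ln C + 1 > 0" using C by (simp add: add_pos_nonneg)
  then have eps: "0 < \<epsilon>" "ln \<epsilon> \<le> 0" "s * ln \<epsilon> = - (ln 2 + ln C + 1)"
    using s by (auto simp: \<epsilon>_def divide_nonpos_pos)
  have "\<forall>\<^sub>F N in sequentially. N \<ge> 1 \<and>
      card {u \<in> words N. measure \<nu> (cyl u) > 0 \<and> cyl u \<inter> K \<noteq> {}} \<le> \<epsilon> * \<beta> ^ N"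
    using K A' lmK eps
    by (intro eventually_conj eventually_ge_at_top card_charged_meeting_null) auto
  then obtain N where N: "N \<ge> 1"
      "card {u \<in> words N. measure \<nu> (cyl u) > 0 \<and> cyl u \<inter> K \<noteq> {}} \<le> \<epsilon> * \<beta> ^ N"
    by (auto dest: eventually_happens)
  let ?E = "{u \<in> words N. cyl u \<inter> K \<noteq> {}}" and ?V = "{u \<in> words N. measure \<nu> (cyl u) > 0}"
  define q where "q u = (if u \<in> ?E then 1 / (2 * \<epsilon> * \<beta> ^ N) else 1 / (2 * C * \<beta> ^ N))" for u
  define P where "P = (\<Sum>u\<in>?E. measure \<nu> (cyl u))"
  have bN: "\<beta> ^ N > 0" using beta_gt_1 by simp
  have "(\<Sum>u\<in>?V. q u) \<le> (\<Sum>u\<in>?V. (if u \<in> ?E then 1 / (2 * \<epsilon> * \<beta> ^ N) else 0) + 1 / (2 * C * \<beta> ^ N))"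
    using C beta_gt_1 by (intro sum_mono) (auto simp: q_def)
  also have "\<dots> = card {u \<in> words N. measure \<nu> (cyl u) > 0 \<and> cyl u \<inter> K \<noteq> {}} / (2 * \<epsilon> * \<beta> ^ N) + card ?V / (2 * C * \<beta> ^ N)"
  proof -
    have "(\<Sum>u\<in>?V. if u \<in> ?E then 1 / (2 * \<epsilon> * \<beta> ^ N) else 0) =
        (\<Sum>u\<in>{u \<in> words N. measure \<nu> (cyl u) > 0 \<and> cyl u \<inter> K \<noteq> {}}. 1 / (2 * \<epsilon> * \<beta> ^ N))"
      using finite_words by (intro sum.mono_neutral_cong_right) auto
    then show ?thesis by (simp add: sum.distrib)
  qed
  also have "\<dots> \<le> 1 / 2 + 1 / 2"
    using N(2) C eps bN by (intro add_mono) (auto simp: field_simps)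
  finally have sum_q: "(\<Sum>u\<in>?V. q u) \<le> 1" by simp
  have ln_q: "- ln (q u) = ln 2 + N * ln \<beta> + (if u \<in> ?E then ln \<epsilon> else ln C)" for u
    using eps C beta_gt_1 by (auto simp: q_def ln_div ln_mult ln_realpow)
  have "ent \<nu> (word N) \<le> - (\<Sum>u\<in>words N. measure \<nu> (cyl u) * ln (q u))"
    using sum_q eps C beta_gt_1 by (intro ent_word_le) (auto simp: q_def)
  also have "\<dots> = (\<Sum>u\<in>words N. measure \<nu> (cyl u) * (ln 2 + N * ln \<beta> + (if u \<in> ?E then ln \<epsilon> else ln C)))"
    unfolding ln_q[symmetric] by (simp add: sum_negf)
  also have "\<dots> \<le> (\<Sum>u\<in>words N. measure \<nu> (cyl u) * (ln 2 + N * ln \<beta> + ln C) + (if u \<in> ?E then measure \<nu> (cyl u) * ln \<epsilon> else 0))"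
    using C by (intro sum_mono) (auto simp: algebra_simps)
  also have "\<dots> = (ln 2 + N * ln \<beta> + ln C) + P * ln \<epsilon>"
  proof -
    have "(\<Sum>u\<in>words N. if u \<in> ?E then measure \<nu> (cyl u) * ln \<epsilon> else 0) = (\<Sum>u\<in>?E. measure \<nu> (cyl u) * ln \<epsilon>)"
      using finite_words by (intro sum.mono_neutral_cong_right) auto
    then show ?thesis
      by (simp add: sum.distrib sum_distrib_right[symmetric] sum_measure_cyl P_def)
  qed
  \<comment> \<open>The cylinders in \<open>?E\<close> cover \<open>K\<close>, so \<open>P\<close>
    is at least \<open>s\<close>; the inequality is reversed because \<open>ln \<epsilon>\<close> is
    not positive.\<close>
  also have "P * ln \<epsilon> \<le> s * ln \<epsilon>"
  proof (rule mult_right_mono_neg[OF _ eps(2)])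
    have "K \<subseteq> (\<Union>u\<in>?E. cyl u)"
    proof
      fix x assume "x \<in> K"
      then have "x \<in> {0<..1}" using K A' by blast
      with \<open>x \<in> K\<close> show "x \<in> (\<Union>u\<in>?E. cyl u)"
        using mem_cyl_word[of x N] word_in_words[of x N] by blast
    qed
    then have "s \<le> measure \<nu> (\<Union>u\<in>?E. cyl u)"
      unfolding s_def using cyl_sets_nu finite_words by (intro finite_measure_mono) auto
    also have "\<dots> = P" unfolding P_def by (rule measure_Union_cyl) auto
    finally show "s \<le> P" .
  qed
  finally have "ent \<nu> (word N) < N * ln \<beta>" using eps(3) by simp
  moreover have "N * ln \<beta> \<le> N * ent_rate digit" using h by (intro mult_left_mono) auto
  moreover have "N * ent_rate digit \<le> ent \<nu> (word N)"
    using ent_rate_le[OF simple_function_digit N(1)] N(1) by (simp add: field_simps)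
  ultimately show False by linarith
qed

end

section \<open>Forward invariant sets\<close>

lemma sets_unit_lborel: "sets (restrict_space lborel {0<..1::real}) = sets unit_borel"
  by (simp add: unit_borel_def sets_restrict_space)

lemma measure_unit_lborel:
  "A \<subseteq> {0<..1::real} \<Longrightarrow> measure (restrict_space lborel {0<..1}) A = measure lborel A"
  by (rule measure_restrict_space) auto

lemma prob_space_unit_lborel: "prob_space (restrict_space lborel {0<..1::real})"
  by (intro prob_spaceI) (simp add: emeasure_restrict_space space_restrict_space)

context neg_beta
begin

lemma funpow_image_contains_interval:
  assumes u: "u \<in> words n"
  obtains a b where "{a<..<b} \<subseteq> (T ^^ n) ` cyl u" "\<beta> ^ n * lm (cyl u) \<le> b - a"
proof
  define D where "D = (T ^^ n) ` cyl u"
  have D: "D \<noteq> {}" "D \<subseteq> {0<..1}"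
    using cyl_nonempty[OF u] funpow_unit cyl_unit unfolding D_def by blast+
  then have bdd: "bdd_below D" "bdd_above D"
    by (auto intro!: bdd_belowI[of _ 0] bdd_aboveI[of _ 1])
  show "{Inf D<..<Sup D} \<subseteq> (T ^^ n) ` cyl u"
  proof
    fix z assume "z \<in> {Inf D<..<Sup D}"
    then obtain p q where "p \<in> D" "q \<in> D" "p < z" "z < q"
      using cInf_less_iff[OF D(1) bdd(1)] less_cSup_iff[OF D(1) bdd(2)] by auto
    then show "z \<in> (T ^^ n) ` cyl u" using funpow_image_between[OF u] unfolding D_def by (meson less_imp_le)
  qed
  have le: "Inf D \<le> Sup D" using D bdd by (meson cInf_le_cSup)
  obtain t where t: "\<And>x. x \<in> cyl u \<Longrightarrow> (T ^^ n) x = t + (- \<beta>) ^ n * x"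
    using funpow_affine_on_cyl[OF u] by blast
  have "cyl u \<subseteq> (\<lambda>x. t + (- \<beta>) ^ n * x) -` {Inf D..Sup D}"
  proof
    fix x assume "x \<in> cyl u"
    then have "t + (- \<beta>) ^ n * x \<in> D" using t by (force simp: D_def)
    then show "x \<in> (\<lambda>x. t + (- \<beta>) ^ n * x) -` {Inf D..Sup D}"
      using bdd by (auto intro: cInf_lower cSup_upper)
  qed
  then have "lm (cyl u) \<le> lm ((\<lambda>x. t + (- \<beta>) ^ n * x) -` {Inf D..Sup D})"
    using beta_gt_1 le by (intro measure_mono_fmeasurable fmeasurable_affine_vimage) (auto simp: fmeasurable_def)
  also have "\<dots> = (Sup D - Inf D) / \<beta> ^ n"
    using beta_gt_1 le by (subst measure_lborel_affine_vimage) (auto simp: power_abs)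
  finally show "\<beta> ^ n * lm (cyl u) \<le> Sup D - Inf D"
    using beta_gt_1 by (simp add: field_simps)
qed

text \<open>A density-point argument along cylinders with long images: the remaining cylinders cover
  only a small part of the interval.\<close>

lemma exists_dense_long_cyl:
  assumes A: "A \<in> sets borel" "A \<subseteq> {0<..1}" "lm A > 0"
  obtains d where "d > 0"
    "\<And>\<eta>. \<eta> > 0 \<Longrightarrow> \<exists>m. \<exists>u\<in>words m. \<beta> ^ m * lm (cyl u) \<ge> d \<and> lm (cyl u - A) \<le> \<eta> * lm (cyl u)"
proof -
  obtain C where C: "C \<ge> 1" "\<And>n. card (fat n) \<le> C * \<beta> ^ n" using card_fat_bound by blast
  have "lm A / (4 * C) > 0" using C A by simp
  \<comment> \<open>The short cylinders have total length at most \<open>2 * C * \<delta> k\<close>,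
    which this choice keeps below half of \<open>lm A\<close>.\<close>
  obtain k where k: "1 / \<beta> ^ k < lm A / (4 * C)"
    using eventually_happens[OF eventually_inverse_power_less[OF \<open>lm A / (4 * C) > 0\<close>]] by auto
  have "C * \<delta> k \<le> C * (1 / \<beta> ^ k)" using \<delta>_upper C by (intro mult_left_mono) auto
  also have "\<dots> \<le> C * (lm A / (4 * C))" using k C by (intro mult_left_mono) auto
  finally have k': "2 * C * \<delta> k \<le> lm A / 2" using C by simp
  interpret prob_space "restrict_space lborel {0<..1::real}" by (rule prob_space_unit_lborel)
  have A': "A \<in> sets (restrict_space lborel {0<..1})" using A by (simp add: sets_unit_lborel sets_unit_borel)
  show ?thesis
  proof
    \<comment> \<open>For \<open>m = n + k\<close>, an image of length \<open>\<delta> k\<close>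
      under \<open>T ^^ n\<close> is stretched to length \<open>\<beta> ^ k * \<delta> k\<close>
      under \<open>T ^^ m\<close>. This witness for \<open>d\<close> does not depend on
      \<open>\<eta>\<close>.\<close>
    show "\<beta> ^ k * \<delta> k > 0" using \<delta>_pos beta_gt_1 by simp
    fix \<eta> :: real assume \<eta>: "\<eta> > 0"
    \<comment> \<open>The first bound leaves at least \<open>lm A / 4\<close> for the long cylinders
      in \<open>S\<close>. If each of them missed \<open>A\<close> in proportion
      \<open>\<eta>\<close>, the error would be at least \<open>\<eta> * lm A / 4\<close>, against
      the second bound.\<close>
    define e where "e = min (lm A / 4) (\<eta> * lm A / 8)"
    have e: "e > 0" using \<eta> A by (simp add: e_def)
    have "\<forall>\<^sub>F m in sequentially. m \<ge> k \<and>
        (\<exists>S. measure (restrict_space lborel {0<..1}) {x \<in> {0<..1}. (x \<in> A) \<noteq> (word m x \<in> S)} \<le> e)"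
      using e A' by (intro eventually_conj eventually_ge_at_top cyl_approx finite_measure_axioms sets_unit_lborel)
    then obtain m S where m: "m \<ge> k"
        and S: "measure (restrict_space lborel {0<..1}) {x \<in> {0<..1}. (x \<in> A) \<noteq> (word m x \<in> S)} \<le> e"
      by (auto dest: eventually_happens)
    define n where "n = m - k"
    have m_eq: "m = n + k" using m by (simp add: n_def)
    define X where "X = {x \<in> {0<..1}. (x \<in> A) \<noteq> (word m x \<in> S)}"
    have X: "lm X \<le> e" using S by (subst (asm) measure_unit_lborel) (auto simp: X_def)
    define L where "L = {u \<in> fat m. \<beta> ^ n * lm (cyl u) \<ge> \<delta> k \<and> u \<in> S}"
    define V where "V = {u \<in> fat m. \<beta> ^ n * lm (cyl u) < \<delta> k}"
    define Z where "Z = words m - fat m"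
    have sub: "L \<subseteq> words m" "V \<subseteq> words m" "Z \<subseteq> words m" using fat_subset by (auto simp: L_def V_def Z_def)
    have fin: "finite L" "finite V" "finite Z" using sub finite_words by (auto intro: finite_subset)
    have X_sets: "X \<in> sets borel"
    proof -
      have "X = (A - (\<Union>u\<in>words m \<inter> S. cyl u)) \<union> ((\<Union>u\<in>words m \<inter> S. cyl u) - A)"
      proof -
        have *: "x \<in> (\<Union>u\<in>words m \<inter> S. cyl u) \<longleftrightarrow> x \<in> {0<..1} \<and> word m x \<in> S" for x
        proof
          assume "x \<in> (\<Union>u\<in>words m \<inter> S. cyl u)"
          then obtain u where "u \<in> words m" "u \<in> S" "x \<in> cyl u" by blast
          then show "x \<in> {0<..1} \<and> word m x \<in> S"
            using word_cyl[OF _ length_words] cyl_unit by blast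
        next
          assume "x \<in> {0<..1} \<and> word m x \<in> S"
          then show "x \<in> (\<Union>u\<in>words m \<inter> S. cyl u)"
            using mem_cyl_word word_in_words by blast
        qed
        show ?thesis unfolding set_eq_iff Un_iff Diff_iff * X_def mem_Collect_eq using A(2) by blast
      qed
      moreover have "(\<Union>u\<in>words m \<inter> S. cyl u) \<in> sets borel"
        using finite_words by (intro sets.finite_UN) auto
      ultimately show ?thesis using A by auto
    qed
    show "\<exists>m. \<exists>u\<in>words m. \<beta> ^ k * \<delta> k \<le> \<beta> ^ m * lm (cyl u) \<and> lm (cyl u - A) \<le> \<eta> * lm (cyl u)"
    proof (rule ccontr)
      assume none: "\<not> ?thesis"
      have bad: "\<eta> * lm (cyl u) \<le> lm (cyl u - A)" if "u \<in> L" for u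
      proof -
        have "\<beta> ^ k * \<delta> k \<le> \<beta> ^ k * (\<beta> ^ n * lm (cyl u))"
          using that beta_gt_1 by (intro mult_left_mono) (auto simp: L_def)
        then have "\<beta> ^ k * \<delta> k \<le> \<beta> ^ m * lm (cyl u)" by (simp add: m_eq power_add mult_ac)
        then show ?thesis using none that sub by (meson linear subsetD)
      qed
      have "\<eta> * (\<Sum>u\<in>L. lm (cyl u)) \<le> (\<Sum>u\<in>L. lm (cyl u - A))"
        unfolding sum_distrib_left by (intro sum_mono bad)
      also have "\<dots> = lm (\<Union>u\<in>L. cyl u - A)"
        using lm_cyl_Union[OF sub(1), of "- A"] A by (simp add: Diff_eq)
      also have "\<dots> \<le> lm X"
      proof (rule lm_mono)
        show "(\<Union>u\<in>L. cyl u - A) \<subseteq> X"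
        proof
          fix x assume "x \<in> (\<Union>u\<in>L. cyl u - A)"
          then obtain u where u: "u \<in> L" "x \<in> cyl u" "x \<notin> A" by blast
          then have "u \<in> words m" using sub by blast
          then have "word m x = u" by (rule word_cyl[OF u(2) length_words])
          moreover have "x \<in> {0<..1}" using u(2) cyl_unit by blast
          ultimately show "x \<in> X" using u by (auto simp: X_def L_def)
        qed
        show "(\<Union>u\<in>L. cyl u - A) \<in> sets borel" using fin A by (intro sets.finite_UN) auto
      qed (use X_sets in \<open>auto simp: X_def\<close>)
      finally have L_le: "\<eta> * (\<Sum>u\<in>L. lm (cyl u)) \<le> e" using X by simp
      have "A \<subseteq> X \<union> (\<Union>u\<in>L. cyl u) \<union> (\<Union>u\<in>V. cyl u) \<union> (\<Union>u\<in>Z. cyl u)" (is "_ \<subseteq> ?R")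
      proof
        fix x assume x: "x \<in> A"
        then have x01: "x \<in> {0<..1}" using A by blast
        have "x \<in> cyl (word m x)" "word m x \<in> words m"
          using mem_cyl_word[OF x01] word_in_words[OF x01] .
        moreover have "word m x \<in> L \<union> V \<union> Z \<or> word m x \<notin> S"
          using \<open>word m x \<in> words m\<close> by (auto simp: L_def V_def Z_def)
        ultimately show "x \<in> ?R" using x x01 by (auto simp: X_def)
      qed
      moreover have "?R \<in> sets borel" using X_sets fin by auto
      moreover have "?R \<subseteq> {0<..1}" using cyl_unit unfolding X_def by blast
      ultimately have "lm A \<le> lm ?R" using A(1) by (intro lm_mono)
      also have "\<dots> \<le> lm X + lm (\<Union>u\<in>L. cyl u) + lm (\<Union>u\<in>V. cyl u) + lm (\<Union>u\<in>Z. cyl u)"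
        using X_sets fin by (intro order_trans[OF measure_Un_le] add_mono order_refl) auto
      also have "lm (\<Union>u\<in>Z. cyl u) = 0"
        using lm_cyl_Union[OF sub(3), of UNIV] by (auto simp: Z_def fat_def less_le intro!: sum.neutral)
      also have "lm (\<Union>u\<in>V. cyl u) \<le> 2 * C * \<delta> k"
      proof -
        have "lm (\<Union>u\<in>V. cyl u) = (\<Sum>u\<in>V. lm (cyl u))"
          using lm_cyl_Union[OF sub(2), of UNIV] by simp
        also have "\<dots> \<le> (\<Sum>u\<in>V. \<delta> k / \<beta> ^ n)"
          using beta_gt_1 by (intro sum_mono) (auto simp: V_def field_simps)
        also have "\<dots> = card V * (\<delta> k / \<beta> ^ n)" by simp
        also have "\<dots> \<le> (2 * (C * \<beta> ^ n)) * (\<delta> k / \<beta> ^ n)"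
        proof (rule mult_right_mono)
          have "card V \<le> 2 * card (fat n)" unfolding V_def m_eq by (rule card_short)
          then show "real (card V) \<le> 2 * (C * \<beta> ^ n)" using C(2)[of n] by linarith
        qed (use \<delta>_pos[of k] beta_gt_1 in auto)
        also have "\<dots> = 2 * C * \<delta> k" using beta_gt_1 by simp
        finally show ?thesis .
      qed
      also have "lm (\<Union>u\<in>L. cyl u) = (\<Sum>u\<in>L. lm (cyl u))"
        using lm_cyl_Union[OF sub(1), of UNIV] by simp
      finally have "lm A \<le> e + (\<Sum>u\<in>L. lm (cyl u)) + lm A / 2" using X k' by simp
      then have "lm A / 4 \<le> (\<Sum>u\<in>L. lm (cyl u))" unfolding e_def by linarith
      then have "\<eta> * (lm A / 4) \<le> e" using L_le \<eta> by (meson mult_left_mono less_imp_le order_trans)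
      moreover have "e \<le> \<eta> * lm A / 8" by (simp add: e_def)
      moreover have "\<eta> * lm A > 0" using \<eta> A by simp
      ultimately show False by linarith
    qed
  qed
qed

text \<open>Dense long cylinders have images of length at least \<open>d\<close> that
  \<open>A\<close> nearly fills. Each image contains a cell of one fixed finite grid, so the defects
  of the cells come arbitrarily close to 0; as there are finitely many cells, one defect is
  0.\<close>

lemma forward_invariant_contains_interval:
  assumes A: "A \<in> sets borel" "A \<subseteq> {0<..1}" "lm A > 0" and forward: "\<And>x. x \<in> A \<Longrightarrow> T x \<in> A"
  obtains a b where "0 \<le> a" "a < b" "b \<le> 1" "lm ({a<..<b} - A) = 0"
proof -
  obtain d where d: "d > 0" "\<And>\<eta>. \<eta> > 0 \<Longrightarrow>
      \<exists>m. \<exists>u\<in>words m. \<beta> ^ m * lm (cyl u) \<ge> d \<and> lm (cyl u - A) \<le> \<eta> * lm (cyl u)"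
    using exists_dense_long_cyl[OF A] by blast
  have forward_n: "(T ^^ n) x \<in> A" if "x \<in> A" for n x
    using that forward by (induction n) auto
  \<comment> \<open>An interval of length at least \<open>d\<close>, hence longer than two mesh
    widths, contains an entire grid cell.\<close>
  obtain M :: nat where M: "2 / d < M" using reals_Archimedean2 by blast
  then have M0: "M > 0" using d by (cases M) (auto simp: field_simps)
  define G where "G i = {real i / M<..<(real i + 1) / M}" for i :: nat
  have G_sub: "G i \<subseteq> {0<..1}" if "i < M" for i
  proof -
    have "real i + 1 \<le> M" using that by linarith
    then have "(real i + 1) / M \<le> 1" using M0 by simp
    moreover have "0 \<le> real i / M" by simp
    ultimately have "z \<in> {0<..1}" if "real i / M < z" "z < (real i + 1) / M" for z
      unfolding greaterThanAtMost_iff using that by linarith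
    then show ?thesis unfolding G_def by auto
  qed
  have small: "\<exists>i<M. lm (G i - A) \<le> \<eta>" if \<eta>: "\<eta> > 0" for \<eta>
  proof -
    obtain m u where u: "u \<in> words m" "\<beta> ^ m * lm (cyl u) \<ge> d" "lm (cyl u - A) \<le> \<eta> * lm (cyl u)"
      using d(2)[OF \<eta>] by blast
    obtain a b where ab: "{a<..<b} \<subseteq> (T ^^ m) ` cyl u" "\<beta> ^ m * lm (cyl u) \<le> b - a"
      using funpow_image_contains_interval[OF u(1)] .
    have "d \<le> b - a" using ab u by simp
    have ab01: "{a<..<b} \<subseteq> {0<..1}" using ab funpow_unit cyl_unit by blast
    have "a < b" using \<open>d \<le> b - a\<close> d by simp
    have "0 \<le> a"
    proof (rule ccontr)
      assume "\<not> 0 \<le> a"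
      then obtain z where "a < z" "z < min b 0" using \<open>a < b\<close> dense[of a "min b 0"] by auto
      then have "z \<in> {a<..<b}" "z < 0" by auto
      with ab01 show False by auto
    qed
    have "b \<le> 1"
    proof (rule ccontr)
      assume "\<not> b \<le> 1"
      then obtain z where "max a 1 < z" "z < b" using \<open>a < b\<close> dense[of "max a 1" b] by auto
      then have "z \<in> {a<..<b}" "z > 1" by auto
      with ab01 show False by auto
    qed
    define i where "i = nat \<lceil>a * M\<rceil>"
    have i: "a * M \<le> real i" "real i < a * M + 1"
      using \<open>0 \<le> a\<close> unfolding i_def by (auto simp: of_nat_nat) linarith+
    have "2 < d * M" using M d M0 by (simp add: field_simps)
    also have "\<dots> \<le> (b - a) * M" using \<open>d \<le> b - a\<close> by (intro mult_right_mono) auto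
    finally have "2 < b * M - a * M" by (simp add: left_diff_distrib)
    with i have i': "real i + 1 < b * M" by linarith
    have "b * M \<le> M" using mult_right_mono[OF \<open>b \<le> 1\<close>, of "real M"] by simp
    with i' have "i < M" by linarith
    have Gab: "G i \<subseteq> {a<..<b}"
    proof -
      have "a \<le> real i / M" "(real i + 1) / M < b" using i i' M0 by (auto simp: field_simps)
      then show ?thesis unfolding G_def by auto
    qed
    \<comment> \<open>By forward invariance, points sent outside \<open>A\<close> lie outside
      \<open>A\<close>, so the defect of the cell pulls back into that of the cylinder. The factors
      \<open>\<beta> ^ m\<close> cancel because the cylinder has length at most
      \<open>1 / \<beta> ^ m\<close>.\<close>
    have "lm (G i - A) / \<beta> ^ m = lm {x \<in> cyl u. (T ^^ m) x \<in> G i - A}"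
      using Gab ab A by (intro lm_funpow_preimage[symmetric] u(1)) (auto simp: G_def)
    also have "\<dots> \<le> lm (cyl u - A)"
    proof (rule lm_mono)
      show "{x \<in> cyl u. (T ^^ m) x \<in> G i - A} \<subseteq> cyl u - A" using forward_n by blast
      have "{x \<in> cyl u. (T ^^ m) x \<in> G i - A} = cyl u \<inter> ((T ^^ m) -` (G i - A) \<inter> space borel)" by auto
      also have "\<dots> \<in> sets borel"
        using A by (intro sets.Int cyl_sets measurable_sets[of "T ^^ m" borel borel] measurable_compose_n) (auto simp: G_def)
      finally show "{x \<in> cyl u. (T ^^ m) x \<in> G i - A} \<in> sets borel" .
    qed (use A cyl_unit in auto)
    also have "\<dots> \<le> \<eta> * (1 / \<beta> ^ m)"
      using u lm_cyl_le[OF u(1)] \<eta> by (meson less_imp_le mult_left_mono order_trans)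
    finally have "lm (G i - A) \<le> \<eta>" using beta_gt_1 by (simp add: field_simps)
    with \<open>i < M\<close> show ?thesis by blast
  qed
  have "\<exists>i<M. lm (G i - A) = 0"
  proof (rule ccontr)
    assume "\<not> ?thesis"
    then have pos: "\<And>i. i < M \<Longrightarrow> lm (G i - A) > 0" by (auto simp: zero_less_measure_iff)
    define \<mu> where "\<mu> = Min ((\<lambda>i. lm (G i - A)) ` {..<M})"
    have "\<mu> > 0" unfolding \<mu>_def using pos M0 by (subst Min_gr_iff) auto
    then obtain i where "i < M" "lm (G i - A) \<le> \<mu> / 2" using small[of "\<mu> / 2"] by auto
    moreover have "\<mu> \<le> lm (G i - A)" unfolding \<mu>_def using \<open>i < M\<close> by (intro Min_le) auto
    ultimately show False using \<open>\<mu> > 0\<close> by linarith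
  qed
  then obtain i where i: "i < M" "lm (G i - A) = 0" by blast
  show ?thesis
  proof
    show "0 \<le> real i / M" "real i / M < (real i + 1) / M" using M0 by (auto simp: divide_strict_right_mono)
    have "real i + 1 \<le> M" using i by linarith
    then show "(real i + 1) / M \<le> 1" using M0 by simp
    show "lm ({real i / M<..<(real i + 1) / M} - A) = 0" using i by (simp add: G_def)
  qed
qed

lemma fmeasurable_Diff_borel:
  fixes A :: "real set"
  shows "I \<in> fmeasurable lborel \<Longrightarrow> A \<in> sets borel \<Longrightarrow> I - A \<in> fmeasurable lborel"
  by (rule fmeasurableI2[of I]) auto

lemma fmeasurable_interval_Diff:
  fixes A :: "real set"
  assumes "A \<in> sets borel"
  shows "{p<..<q} - A \<in> fmeasurable lborel"
  using assms by (intro fmeasurable_Diff_borel) (cases "p \<le> q"; auto simp: fmeasurable_def)+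

lemma forward_invariant_null_image:
  assumes A: "A \<in> sets borel" and forward: "\<And>x. x \<in> A \<Longrightarrow> T x \<in> A"
    and null: "lm ({p<..<q} - A) = 0" and T: "\<And>x. x \<in> {p<..<q} \<Longrightarrow> T x = t - \<beta> * x"
  shows "lm ({t - \<beta> * q<..<t - \<beta> * p} - A) = 0"
proof -
  let ?E = "{t - \<beta> * q<..<t - \<beta> * p} - A"
  have fm: "{p<..<q} - A \<in> fmeasurable lborel"
    using A by (rule fmeasurable_interval_Diff)
  have "(\<lambda>x. t + (- \<beta>) * x) -` ?E \<subseteq> {p<..<q} - A"
  proof
    fix x assume "x \<in> (\<lambda>x. t + (- \<beta>) * x) -` ?E"
    then have x: "\<beta> * p < \<beta> * x" "\<beta> * x < \<beta> * q" "t - \<beta> * x \<notin> A" by auto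
    then have "x \<in> {p<..<q}" using beta_gt_1 by auto
    with x T[of x] forward[of x] show "x \<in> {p<..<q} - A" by auto
  qed
  moreover have "(\<lambda>x. t + (- \<beta>) * x) -` ?E \<in> sets lborel"
    using measurable_sets[of "\<lambda>x. t + (- \<beta>) * x" borel borel ?E] A by simp
  ultimately have "lm ((\<lambda>x. t + (- \<beta>) * x) -` ?E) \<le> lm ({p<..<q} - A)"
    by (intro measure_mono_fmeasurable fm)
  moreover have "lm ((\<lambda>x. t + (- \<beta>) * x) -` ?E) = lm ?E / \<beta>"
    using beta_gt_1 A by (subst measure_lborel_affine_vimage) auto
  ultimately show ?thesis
    using null beta_gt_1 by (simp add: divide_le_0_iff order_antisym)
qed

text \<open>Intervals expand until they contain a discontinuity in their interior, whose right
  neighbourhood is mapped onto a left neighbourhood of 1.\<close>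

lemma forward_invariant_near_1:
  assumes A: "A \<in> sets borel" "A \<subseteq> {0<..1}" "lm A > 0" and forward: "\<And>x. x \<in> A \<Longrightarrow> T x \<in> A"
  shows "\<exists>e>0. lm ({1 - e<..1} - A) = 0"
proof (rule ccontr)
  assume none: "\<not> ?thesis"
  obtain a b where ab: "0 \<le> a" "a < b" "b \<le> 1" "lm ({a<..<b} - A) = 0"
    using forward_invariant_contains_interval[OF A forward] by blast
  have no_break: "\<not> (\<beta> * p < of_int k \<and> of_int k < \<beta> * q)"
    if pq: "lm ({p<..<q} - A) = 0" for p q and k :: int
  proof
    assume k: "\<beta> * p < of_int k \<and> of_int k < \<beta> * q"
    define c where "c = of_int k / \<beta>"
    \<comment> \<open>Cutting at the next discontinuity leaves a single branch of \<open>T\<close>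
      to the right of \<open>c\<close>.\<close>
    define q' where "q' = min q ((of_int k + 1) / \<beta>)"
    have c: "p < c" "c < q'" using k beta_gt_1 by (auto simp: c_def q'_def field_simps)
    have T: "T x = (of_int k + 1) - \<beta> * x" if "x \<in> {c<..<q'}" for x
    proof -
      have "of_int k < \<beta> * x" "\<beta> * x < of_int k + 1"
        using that beta_gt_1 by (auto simp: c_def q'_def field_simps)
      then have "digit x = k" unfolding digit_def by (intro floor_unique) auto
      then show ?thesis by (simp add: T_eq)
    qed
    have "lm ({c<..<q'} - A) \<le> lm ({p<..<q} - A)"
      using c A by (intro measure_mono_fmeasurable fmeasurable_interval_Diff) (auto simp: q'_def)
    then have "lm ({c<..<q'} - A) = 0" using pq by (simp add: order_antisym)
    from forward_invariant_null_image[OF A(1) forward this T]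
    have null: "lm ({of_int k + 1 - \<beta> * q'<..<of_int k + 1 - \<beta> * c} - A) = 0" .
    define e where "e = \<beta> * (q' - c)"
    have e: "e > 0" using c beta_gt_1 by (simp add: e_def)
    \<comment> \<open>The branch to the right of \<open>c = of_int k / \<beta>\<close> starts with
      limit value 1 and decreases, so the image of the interval is
      \<open>{1 - e<..<1}\<close>.\<close>
    have bounds: "of_int k + 1 - \<beta> * c = 1" "of_int k + 1 - \<beta> * q' = 1 - e"
      using beta_gt_1 by (auto simp: e_def c_def field_simps)
    have "{1 - e<..1} - A \<subseteq> ({1 - e<..<1} - A) \<union> {1}" by auto
    then have "lm ({1 - e<..1} - A) \<le> lm (({1 - e<..<1} - A) \<union> {1})"
      using A by (intro measure_mono_fmeasurable fmeasurable.Un fmeasurable_interval_Diff)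
        (auto simp: fmeasurable_def)
    also have "\<dots> \<le> lm ({1 - e<..<1} - A) + lm {1}" using A by (intro measure_Un_le) auto
    also have "\<dots> = 0" using null by (simp add: bounds)
    finally have "lm ({1 - e<..1} - A) = 0" by (simp add: order_antisym)
    with none e show False by blast
  qed
  have step: "\<exists>p' q'. 0 \<le> p' \<and> q' \<le> 1 \<and> q' - p' = \<beta> * (q - p) \<and> lm ({p'<..<q'} - A) = 0"
    if pq: "p < q" "lm ({p<..<q} - A) = 0" for p q
  proof -
    define D where "D = \<lfloor>\<beta> * p\<rfloor>"
    have D: "of_int D \<le> \<beta> * p" "\<beta> * p < of_int D + 1" by (auto simp: D_def)
    have Dq: "\<beta> * q \<le> of_int D + 1"
      using no_break[OF pq(2), of "D + 1"] D by auto
    have T: "T x = (of_int D + 1) - \<beta> * x" if "x \<in> {p<..<q}" for x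
    proof -
      have "\<beta> * p < \<beta> * x" "\<beta> * x < \<beta> * q" using that beta_gt_1 by auto
      then have "digit x = D" unfolding digit_def using D Dq by (intro floor_unique) auto
      then show ?thesis by (simp add: T_eq)
    qed
    show ?thesis
      using forward_invariant_null_image[OF A(1) forward pq(2) T] D Dq
      by (intro exI[of _ "of_int D + 1 - \<beta> * q"] exI[of _ "of_int D + 1 - \<beta> * p"])
        (auto simp: algebra_simps)
  qed
  have grow: "\<exists>p q. 0 \<le> p \<and> q \<le> 1 \<and> q - p = \<beta> ^ n * (b - a) \<and> lm ({p<..<q} - A) = 0" for n
  proof (induction n)
    case 0
    then show ?case using ab by (intro exI[of _ a] exI[of _ b]) auto
  next
    case (Suc n)
    then obtain p q where pq: "q - p = \<beta> ^ n * (b - a)" "lm ({p<..<q} - A) = 0" by blast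
    moreover have "\<beta> ^ n * (b - a) > 0" using ab beta_gt_1 by simp
    ultimately have "p < q" by linarith
    from step[OF this pq(2)] show ?case by (simp add: pq mult.assoc)
  qed
  \<comment> \<open>Without a discontinuity in the interior the lengths grow by
    \<open>\<beta>\<close> at each step, which cannot go on inside the unit interval.\<close>
  obtain n where "1 / (b - a) < \<beta> ^ n" using real_arch_pow[OF beta_gt_1] by blast
  then have "1 < \<beta> ^ n * (b - a)" using ab by (simp add: field_simps)
  moreover obtain p q where "0 \<le> p" "q \<le> 1" "q - p = \<beta> ^ n * (b - a)" using grow[of n] by blast
  ultimately show False by linarith
qed

end

section \<open>Absolutely continuous invariant measures\<close>

context neg_beta
begin

abbreviation leb :: "real measure" where
  "leb \<equiv> restrict_space lborel {0<..1}"

lemma space_leb [simp]: "space leb = {0<..1}"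
  by (simp add: space_restrict_space)

lemma sets_leb_iff: "A \<in> sets leb \<longleftrightarrow> A \<in> sets borel \<and> A \<subseteq> {0<..1}"
  by (simp add: sets_unit_lborel sets_unit_borel)

lemma T_measurable_leb [measurable]: "T \<in> measurable leb leb"
  using measurable_T_neg_beta[of \<beta>] measurable_cong_sets[OF sets_unit_lborel sets_unit_lborel] by simp

lemma T_vimage_leb: "A \<in> sets leb \<Longrightarrow> T -` A \<inter> {0<..1} \<in> sets leb"
  using measurable_sets[OF T_measurable_leb] by simp

text \<open>Invariance of the signed measure with density \<open>f\<close>; no sign is imposed, so
  that differences of densities and \<open>dens\<close> itself qualify.\<close>

definition invariant_density :: "(real \<Rightarrow> real) \<Rightarrow> bool" where
  "invariant_density f \<longleftrightarrow> integrable leb f \<and>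
    (\<forall>A\<in>sets leb. (LINT x:T -` A \<inter> {0<..1}|leb. f x) = (LINT x:A|leb. f x))"

lemma set_integrable_leb:
  fixes f :: "real \<Rightarrow> real"
  shows "integrable leb f \<Longrightarrow> A \<in> sets leb \<Longrightarrow> set_integrable leb A f"
  unfolding set_integrable_def by (intro integrable_mult_indicator)

lemma set_integral_leb_compl:
  fixes f :: "real \<Rightarrow> real"
  assumes "integrable leb f" "A \<in> sets leb"
  shows "(LINT x:A|leb. f x) + (LINT x:{0<..1} - A|leb. f x) = (LINT x|leb. f x)"
proof -
  have "{0<..1} - A \<in> sets leb" using assms(2) sets.compl_sets[of A leb] by simp
  then have "(LINT x:A|leb. f x) + (LINT x:{0<..1} - A|leb. f x) =
      (LINT x|leb. indicator A x *\<^sub>R f x + indicator ({0<..1} - A) x *\<^sub>R f x)"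
    unfolding set_lebesgue_integral_def using set_integrable_leb[OF assms(1)] assms(2)
    by (intro Bochner_Integration.integral_add[symmetric]) (auto simp: set_integrable_def)
  also have "\<dots> = (LINT x|leb. f x)"
    by (intro Bochner_Integration.integral_cong) (auto simp: indicator_def)
  finally show ?thesis .
qed

text \<open>By invariance the positive part \<open>\<sigma>\<close> of the signed measure satisfies
  \<open>\<sigma> A \<le> \<sigma> (T -` A)\<close>; equality follows by passing to the complement, since the total masses
  agree.\<close>

lemma invariant_density_pos_part:
  assumes f: "invariant_density f"
  shows "invariant_density (\<lambda>x. max 0 (f x))"
proof -
  let ?g = "\<lambda>x. max 0 (f x)"
  have int_f: "integrable leb f" using f by (simp add: invariant_density_def)
  have int_g: "integrable leb ?g" using int_f by simp
  have [measurable]: "f \<in> borel_measurable leb" using int_f by simp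
  define P where "P = {x \<in> space leb. f x > 0}"
  have P: "P \<in> sets leb" unfolding P_def by measurable
  have le: "(LINT x:A|leb. ?g x) \<le> (LINT x:T -` A \<inter> {0<..1}|leb. ?g x)" if A: "A \<in> sets leb" for A
  proof -
    have AP: "A \<inter> P \<in> sets leb" using A P by auto
    have "(LINT x:A|leb. ?g x) = (LINT x:A \<inter> P|leb. f x)"
      unfolding set_lebesgue_integral_def
      by (intro Bochner_Integration.integral_cong) (auto simp: indicator_def P_def)
    also have "\<dots> = (LINT x:T -` (A \<inter> P) \<inter> {0<..1}|leb. f x)"
      using f AP unfolding invariant_density_def by (elim conjE) (rule sym, erule (1) bspec)
    also have "\<dots> \<le> (LINT x:T -` A \<inter> {0<..1}|leb. ?g x)"
      unfolding set_lebesgue_integral_def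
      using set_integrable_leb[OF int_f T_vimage_leb[OF AP]] set_integrable_leb[OF int_g T_vimage_leb[OF A]]
      by (intro integral_mono) (auto simp: indicator_def set_integrable_def)
    finally show ?thesis .
  qed
  have "(LINT x:T -` A \<inter> {0<..1}|leb. ?g x) = (LINT x:A|leb. ?g x)" if A: "A \<in> sets leb" for A
  proof -
    have "{0<..1} - A \<in> sets leb" using A sets.compl_sets[of A leb] by simp
    from le[OF this] have "(LINT x:{0<..1} - A|leb. ?g x) \<le> (LINT x:T -` ({0<..1} - A) \<inter> {0<..1}|leb. ?g x)" .
    also have "T -` ({0<..1} - A) \<inter> {0<..1} = {0<..1} - (T -` A \<inter> {0<..1})"
      using T_unit by auto
    finally show ?thesis
      using set_integral_leb_compl[OF int_g A] set_integral_leb_compl[OF int_g T_vimage_leb[OF A]] le[OF A]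
      by linarith
  qed
  with int_g show ?thesis by (simp add: invariant_density_def)
qed

lemma invariant_density_uminus: "invariant_density f \<Longrightarrow> invariant_density (\<lambda>x. - f x)"
  by (simp add: invariant_density_def set_lebesgue_integral_def)

lemma
  assumes g: "invariant_density g" "\<And>x. g x \<ge> 0" and c: "c = (LINT x|leb. g x)" "c > 0"
  defines "\<nu> \<equiv> density leb (\<lambda>x. ennreal (g x / c))"
  shows invariant_prob_density: "invariant_prob unit_borel T \<nu>"
    and measure_invariant_density: "\<And>A. A \<in> sets leb \<Longrightarrow> measure \<nu> A = (LINT x:A|leb. g x) / c"
proof -
  have int_g: "integrable leb g" using g by (simp add: invariant_density_def)
  then have [measurable]: "g \<in> borel_measurable leb" by simp
  have em: "emeasure \<nu> A = ennreal ((LINT x:A|leb. g x) / c)" if A: "A \<in> sets leb" for A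
  proof -
    have "emeasure \<nu> A = (\<integral>\<^sup>+x. ennreal (g x / c) * indicator A x \<partial>leb)"
      unfolding \<nu>_def using A by (intro emeasure_density) auto
    also have "\<dots> = (\<integral>\<^sup>+x. ennreal (indicator A x *\<^sub>R g x / c) \<partial>leb)"
      by (intro nn_integral_cong) (auto simp: indicator_def)
    also have "\<dots> = ennreal (LINT x|leb. indicator A x *\<^sub>R g x / c)"
      using set_integrable_leb[OF int_g A] g(2) c
      by (intro nn_integral_eq_integral) (auto simp: set_integrable_def)
    finally show ?thesis by (simp add: set_lebesgue_integral_def)
  qed
  show m: "measure \<nu> A = (LINT x:A|leb. g x) / c" if "A \<in> sets leb" for A
    using em[OF that] c g(2) unfolding measure_def
    by (simp add: set_lebesgue_integral_def)
  have sets: "sets \<nu> = sets unit_borel" by (simp add: \<nu>_def sets_unit_lborel)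
  have space: "space \<nu> = {0<..1}" by (simp add: \<nu>_def)
  have sets': "sets \<nu> = sets leb" by (simp add: \<nu>_def)
  have "(LINT x:{0<..1}|leb. g x) = c"
    unfolding c(1) set_lebesgue_integral_def
    by (intro Bochner_Integration.integral_cong) (auto simp: indicator_def)
  then have "emeasure \<nu> (space \<nu>) = 1"
    using em[of "{0<..1}"] c(2) sets.top[of leb] by (simp add: space)
  moreover have "T \<in> measurable \<nu> \<nu>"
    using T_measurable_leb measurable_cong_sets[OF sets' sets'] by simp
  moreover have "emeasure \<nu> (T -` A \<inter> space \<nu>) = emeasure \<nu> A" if "A \<in> sets \<nu>" for A
    using that em T_vimage_leb g(1) by (simp add: sets' space invariant_density_def)
  ultimately show "invariant_prob unit_borel T \<nu>"
    unfolding invariant_prob_def using sets by (auto intro: prob_spaceI)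
qed

lemma null_sets_leb_iff: "A \<in> null_sets leb \<longleftrightarrow> A \<in> sets leb \<and> lm A = 0"
proof -
  have "emeasure leb A = 0 \<longleftrightarrow> lm A = 0" if "A \<in> sets leb"
  proof -
    have "A \<in> fmeasurable lborel" "A \<subseteq> {0<..1}"
      using that fmeasurable_unit by (auto simp: sets_leb_iff)
    then show ?thesis
      by (simp add: emeasure_restrict_space emeasure_eq_measure2)
  qed
  then show ?thesis by (auto simp: null_sets_def)
qed

text \<open>The normalised measure gives full mass to the positivity set \<open>P\<close>, hence
  also to the set \<open>A\<close> of points whose whole orbit stays in \<open>P\<close>. This
  \<open>A\<close> is forward invariant and, by absolute continuity, not a Lebesgue null
  set.\<close>

lemma invariant_density_pos_near_1:
  assumes g: "invariant_density g" "\<And>x. g x \<ge> 0" and pos: "(LINT x|leb. g x) > 0"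
  shows "\<exists>e>0. lm ({1 - e<..1} - {x \<in> {0<..1}. g x > 0}) = 0"
proof -
  define c where "c = (LINT x|leb. g x)"
  define \<nu> where "\<nu> = density leb (\<lambda>x. ennreal (g x / c))"
  have c: "c > 0" using pos by (simp add: c_def)
  have int_g: "integrable leb g" using g by (simp add: invariant_density_def)
  then have [measurable]: "g \<in> borel_measurable leb" by simp
  interpret neg_beta_invariant_measure \<beta> \<nu>
    using invariant_prob_density[OF g c_def c] unfolding \<nu>_def by unfold_locales
  have sets: "sets \<nu> = sets leb" by (simp add: \<nu>_def)
  define P where "P = {x \<in> {0<..1}. g x > 0}"
  have P: "P \<in> sets leb"
  proof -
    have "{x \<in> space leb. g x > 0} \<in> sets leb" by measurable
    then show ?thesis by (simp add: P_def)
  qed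
  have "(LINT x:P|leb. g x) = c"
    unfolding c_def set_lebesgue_integral_def
    using g(2) by (intro Bochner_Integration.integral_cong) (auto simp: P_def indicator_def less_le)
  then have "measure \<nu> P = 1"
    using measure_invariant_density[OF g c_def c P] c unfolding \<nu>_def by simp
  then have "measure \<nu> ((T ^^ n) -` P \<inter> space \<nu>) = 1" for n
    using measure_funpow_vimage[of P n] P sets by simp
  then have "AE x in \<nu>. x \<in> (T ^^ n) -` P \<inter> space \<nu>" for n
    using AE_prob_1 by blast
  then have AE: "AE x in \<nu>. \<forall>n. x \<in> (T ^^ n) -` P \<inter> space \<nu>"
    by (subst AE_all_countable) (rule allI)
  define A where "A = (\<Inter>n. (T ^^ n) -` P \<inter> space \<nu>)"
  have A_sets: "A \<in> sets \<nu>"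
    unfolding A_def using P sets measurable_sets[OF funpow_measurable, of P] by (intro sets.countable_INT') auto
  have "measure \<nu> A = 1"
    using AE A_sets by (subst prob_eq_1) (auto simp: A_def)
  have A: "A \<in> sets borel" "A \<subseteq> {0<..1}" using A_sets by (auto simp: sets_nu_iff)
  have "lm A > 0"
  proof (rule ccontr)
    assume "\<not> lm A > 0"
    then have "lm A = 0" by (simp add: zero_less_measure_iff)
    then have "A \<in> null_sets leb" using A_sets sets by (simp add: null_sets_leb_iff)
    moreover have "absolutely_continuous leb \<nu>"
      unfolding \<nu>_def by (rule absolutely_continuousI_density) measurable
    ultimately have "A \<in> null_sets \<nu>" by (auto simp: absolutely_continuous_def)
    then show False using \<open>measure \<nu> A = 1\<close> by (simp add: null_sets_def measure_def)
  qed
  moreover have "T x \<in> A" if "x \<in> A" for x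
  proof -
    have "(T ^^ n) (T x) \<in> P" for n
      using that unfolding A_def by (auto dest: spec[of _ "Suc n"] simp: funpow_swap1)
    then show ?thesis using T_unit by (simp add: A_def space_nu)
  qed
  ultimately obtain e where e: "e > 0" "lm ({1 - e<..1} - A) = 0"
    using forward_invariant_near_1[OF A] by blast
  \<comment> \<open>Capped at 1 to keep the left neighbourhood inside the unit interval.\<close>
  define e' where "e' = min e 1"
  have "A \<subseteq> P"
  proof
    fix x assume "x \<in> A"
    then have "x \<in> (T ^^ 0) -` P" unfolding A_def by blast
    then show "x \<in> P" by simp
  qed
  have "e' > 0" using e by (simp add: e'_def)
  have "lm ({1 - e'<..1} - P) \<le> lm ({1 - e'<..1} - A)"
    using \<open>A \<subseteq> P\<close> A P by (intro lm_mono) (auto simp: sets_leb_iff e'_def)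
  also have "\<dots> \<le> lm ({1 - e<..1} - A)"
  proof (rule measure_mono_fmeasurable)
    show "{1 - e<..1} - A \<in> fmeasurable lborel"
      using A e by (intro fmeasurable_Diff_borel) (auto simp: fmeasurable_def)
  qed (use A in \<open>auto simp: e'_def\<close>)
  also have "\<dots> = 0" by (rule e)
  finally have "lm ({1 - e'<..1} - P) = 0" by (simp add: order_antisym)
  with \<open>e' > 0\<close> show ?thesis unfolding P_def by blast
qed

lemma unique_abs_continuous_invariant:
  assumes nu: "invariant_prob unit_borel T \<nu>" "\<And>A. A \<in> sets \<nu> \<Longrightarrow> lm A = 0 \<Longrightarrow> measure \<nu> A = 0"
    and mu: "invariant_prob unit_borel T \<mu>" "\<And>A. A \<in> sets \<mu> \<Longrightarrow> lm A = 0 \<Longrightarrow> measure \<mu> A = 0"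
  shows "\<nu> = \<mu>"
proof -
  interpret leb: prob_space leb by (rule prob_space_unit_lborel)
  \<comment> \<open>Radon--Nikodym, with a real-valued integrable density.\<close>
  have dens: "\<exists>D. integrable leb D \<and> (\<forall>A\<in>sets leb. measure \<kappa> A = (LINT x:A|leb. D x))"
    if k: "invariant_prob unit_borel T \<kappa>" "\<And>A. A \<in> sets \<kappa> \<Longrightarrow> lm A = 0 \<Longrightarrow> measure \<kappa> A = 0" for \<kappa>
  proof -
    interpret k: neg_beta_invariant_measure \<beta> \<kappa> by unfold_locales (rule k(1))
    have sets: "sets \<kappa> = sets leb" using k.sets_nu sets_unit_lborel by simp
    have ac: "absolutely_continuous leb \<kappa>"
      unfolding absolutely_continuous_def
    proof
      fix A assume "A \<in> null_sets leb"
      then have "A \<in> sets \<kappa>" "lm A = 0" by (auto simp: null_sets_leb_iff sets)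
      with k(2) show "A \<in> null_sets \<kappa>" by (auto simp: null_sets_def k.emeasure_eq_measure)
    qed
    obtain D where D: "D \<in> borel_measurable leb" "AE x in leb. RN_deriv leb \<kappa> x = ennreal (D x)"
        "\<And>x. 0 \<le> D x"
      using leb.real_RN_deriv[OF k.finite_measure_axioms ac sets] by blast
    have dens: "density leb (\<lambda>x. ennreal (D x)) = \<kappa>"
    proof -
      have "density leb (\<lambda>x. ennreal (D x)) = density leb (RN_deriv leb \<kappa>)"
        using D by (intro density_cong) auto
      also have "\<dots> = \<kappa>" by (rule leb.density_RN_deriv[OF ac sets])
      finally show ?thesis .
    qed
    have em: "emeasure \<kappa> A = (\<integral>\<^sup>+x. ennreal (indicator A x *\<^sub>R D x) \<partial>leb)" if A: "A \<in> sets leb" for A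
    proof -
      have "emeasure \<kappa> A = (\<integral>\<^sup>+x. ennreal (D x) * indicator A x \<partial>leb)"
        unfolding dens[symmetric] using A D by (intro emeasure_density) auto
      also have "\<dots> = (\<integral>\<^sup>+x. ennreal (indicator A x *\<^sub>R D x) \<partial>leb)"
        by (intro nn_integral_cong) (auto simp: indicator_def)
      finally show ?thesis .
    qed
    have int: "integrable leb D"
    proof (rule integrableI_nonneg)
      have "(\<integral>\<^sup>+x. ennreal (D x) \<partial>leb) = (\<integral>\<^sup>+x. ennreal (indicator {0<..1} x *\<^sub>R D x) \<partial>leb)"
        by (intro nn_integral_cong) auto
      also have "\<dots> = emeasure \<kappa> {0<..1}" using em[of "{0<..1}"] sets.top[of leb] by simp
      also have "\<dots> < \<infinity>" by (simp add: k.emeasure_eq_measure)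
      finally show "(\<integral>\<^sup>+x. ennreal (D x) \<partial>leb) < \<infinity>" .
    qed (use D in auto)
    have "measure \<kappa> A = (LINT x:A|leb. D x)" if A: "A \<in> sets leb" for A
    proof -
      have "emeasure \<kappa> A = ennreal (LINT x:A|leb. D x)"
        unfolding em[OF A] set_lebesgue_integral_def
        using set_integrable_leb[OF int A] D(3)
        by (intro nn_integral_eq_integral) (auto simp: set_integrable_def)
      then show ?thesis using D(3) by (simp add: measure_def set_lebesgue_integral_def)
    qed
    with int show ?thesis by blast
  qed
  obtain D where D: "integrable leb D" "\<And>A. A \<in> sets leb \<Longrightarrow> measure \<nu> A = (LINT x:A|leb. D x)"
    using dens[OF nu] by blast
  obtain E where E: "integrable leb E" "\<And>A. A \<in> sets leb \<Longrightarrow> measure \<mu> A = (LINT x:A|leb. E x)"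
    using dens[OF mu] by blast
  interpret nu: neg_beta_invariant_measure \<beta> \<nu> by unfold_locales (rule nu(1))
  interpret mu: neg_beta_invariant_measure \<beta> \<mu> by unfold_locales (rule mu(1))
  have sets: "sets \<nu> = sets leb" "sets \<mu> = sets leb"
    using nu.sets_nu mu.sets_nu sets_unit_lborel by simp_all
  define f where "f x = D x - E x" for x
  have int_f: "integrable leb f" unfolding f_def using D(1) E(1) by simp
  have f_int: "(LINT x:A|leb. f x) = measure \<nu> A - measure \<mu> A" if A: "A \<in> sets leb" for A
    unfolding f_def using set_integral_diff(2)[OF set_integrable_leb[OF D(1) A] set_integrable_leb[OF E(1) A]]
    by (simp add: D(2)[OF A] E(2)[OF A])
  have inv_f: "invariant_density f"
    unfolding invariant_density_def
  proof (intro conjI ballI int_f)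
    fix A assume A: "A \<in> sets leb"
    have "measure \<nu> (T -` A \<inter> {0<..1}) = measure \<nu> A" "measure \<mu> (T -` A \<inter> {0<..1}) = measure \<mu> A"
      using nu.measure_funpow_vimage[of A 1] mu.measure_funpow_vimage[of A 1] A
      by (simp_all add: sets nu.space_nu mu.space_nu)
    then show "(LINT x:T -` A \<inter> {0<..1}|leb. f x) = (LINT x:A|leb. f x)"
      using f_int[OF A] f_int[OF T_vimage_leb[OF A]] by simp
  qed
  let ?p = "\<lambda>x. max 0 (f x)" and ?m = "\<lambda>x. max 0 (- f x)"
  have inv_p: "invariant_density ?p" using invariant_density_pos_part[OF inv_f] .
  have inv_m: "invariant_density ?m" using invariant_density_pos_part[OF invariant_density_uminus[OF inv_f]] .
  have int_p: "integrable leb ?p" and int_m: "integrable leb ?m"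
    using inv_p inv_m by (auto simp: invariant_density_def)
  have split: "(LINT x:A|leb. f x) = (LINT x:A|leb. ?p x) - (LINT x:A|leb. ?m x)" if A: "A \<in> sets leb" for A
  proof -
    have "(LINT x:A|leb. f x) = (LINT x:A|leb. ?p x - ?m x)"
      unfolding set_lebesgue_integral_def by (intro Bochner_Integration.integral_cong) (auto simp: max_def)
    also have "\<dots> = (LINT x:A|leb. ?p x) - (LINT x:A|leb. ?m x)"
      by (rule set_integral_diff(2)[OF set_integrable_leb[OF int_p A] set_integrable_leb[OF int_m A]])
    finally show ?thesis .
  qed
  have whole: "(LINT x:{0<..1}|leb. g x) = (LINT x|leb. g x)" for g :: "real \<Rightarrow> real"
    unfolding set_lebesgue_integral_def by (intro Bochner_Integration.integral_cong) auto
  have unit: "{0<..1} \<in> sets leb" using sets.top[of leb] by simp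
  have "(LINT x:{0<..1}|leb. f x) = 0"
    using f_int[OF unit] nu.prob_space mu.prob_space by (simp add: nu.space_nu mu.space_nu)
  \<comment> \<open>Both measures have total mass 1, so the two parts have equal mass and, if one is
    nonzero, both are positive near 1.\<close>
  then have eq: "(LINT x|leb. ?p x) = (LINT x|leb. ?m x)"
    using split[OF unit] by (simp only: whole)
  have zero: "(LINT x|leb. ?p x) = 0"
  proof (rule ccontr)
    assume "(LINT x|leb. ?p x) \<noteq> 0"
    moreover have "(LINT x|leb. ?p x) \<ge> 0" by (intro Bochner_Integration.integral_nonneg) simp
    ultimately have pos: "(LINT x|leb. ?p x) > 0" "(LINT x|leb. ?m x) > 0" using eq by linarith+
    obtain e1 where e1: "e1 > 0" "lm ({1 - e1<..1} - {x \<in> {0<..1}. ?p x > 0}) = 0"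
      using invariant_density_pos_near_1[OF inv_p _ pos(1)] by auto
    obtain e2 where e2: "e2 > 0" "lm ({1 - e2<..1} - {x \<in> {0<..1}. ?m x > 0}) = 0"
      using invariant_density_pos_near_1[OF inv_m _ pos(2)] by auto
    define e where "e = min (min e1 e2) 1"
    have e: "e > 0" using e1 e2 by (simp add: e_def)
    have meas: "f \<in> borel_measurable leb" using int_f by simp
    have P: "{x \<in> {0<..1}. ?p x > 0} \<in> sets borel" "{x \<in> {0<..1}. ?m x > 0} \<in> sets borel"
    proof -
      have "{x \<in> space leb. ?p x > 0} \<in> sets leb" "{x \<in> space leb. ?m x > 0} \<in> sets leb"
        using meas by measurable
      then show "{x \<in> {0<..1}. ?p x > 0} \<in> sets borel" "{x \<in> {0<..1}. ?m x > 0} \<in> sets borel"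
        by (simp_all only: sets_leb_iff space_leb)
    qed
    let ?X = "{1 - e1<..1} - {x \<in> {0<..1}. ?p x > 0}" and ?Y = "{1 - e2<..1} - {x \<in> {0<..1}. ?m x > 0}"
    have fm: "?X \<in> fmeasurable lborel" "?Y \<in> fmeasurable lborel"
    proof -
      have I: "{1 - d<..1} \<in> fmeasurable lborel" if "d > 0" for d :: real
        using that by (simp add: fmeasurable_def)
      show "?X \<in> fmeasurable lborel" by (rule fmeasurable_Diff_borel[OF I[OF e1(1)] P(1)])
      show "?Y \<in> fmeasurable lborel" by (rule fmeasurable_Diff_borel[OF I[OF e2(1)] P(2)])
    qed
    \<comment> \<open>\<open>f\<close> is nowhere positive and negative at once, so each point near
      1 belongs to one of the two null sets.\<close>
    have "{1 - e<..1} \<subseteq> ?X \<union> ?Y" by (auto simp: e_def)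
    then have "lm {1 - e<..1} \<le> lm (?X \<union> ?Y)"
      using fm by (intro measure_mono_fmeasurable fmeasurable.Un) auto
    also have "\<dots> \<le> lm ?X + lm ?Y" by (intro measure_Un_le fmeasurableD fm)
    also have "\<dots> = 0" using e1 e2 by simp
    finally show False using e by simp
  qed
  have part_zero: "(LINT x:A|leb. g x) = 0"
    if A: "A \<in> sets leb" and g: "integrable leb g" "\<And>x. g x \<ge> 0" "(LINT x|leb. g x) = 0" for A and g :: "real \<Rightarrow> real"
  proof -
    have "{0<..1} - A \<in> sets leb" using A sets.compl_sets[of A leb] by simp
    moreover have "(LINT x:B|leb. g x) \<ge> 0" if "B \<in> sets leb" for B
      unfolding set_lebesgue_integral_def using g(2) by (intro Bochner_Integration.integral_nonneg) auto
    ultimately show ?thesis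
      using set_integral_leb_compl[OF g(1) A] g(3) A by (smt (verit))
  qed
  show ?thesis
  proof (rule measure_eqI)
    fix A assume "A \<in> sets \<nu>"
    then have A: "A \<in> sets leb" by (simp add: sets)
    have "measure \<nu> A - measure \<mu> A = 0"
      using f_int[OF A] split[OF A] part_zero[OF A int_p] part_zero[OF A int_m] zero eq by simp
    then show "emeasure \<nu> A = emeasure \<mu> A"
      by (simp add: nu.emeasure_eq_measure mu.emeasure_eq_measure)
  qed (simp add: sets)
qed

end

section \<open>An invariant density\<close>

context neg_beta
begin

text \<open>The transfer operator on the indicator of \<open>{0<..t}\<close>. Each of the
  \<open>digit t\<close> complete branches contributes \<open>lm A / \<beta>\<close>; the last
  branch is decreasing and stops at \<open>t\<close>, so it takes only values above
  \<open>T t\<close>.\<close>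

lemma lm_T_vimage_initial:
  assumes t: "t \<in> {0<..1}" and A: "A \<in> sets leb"
  shows "\<beta> * lm (T -` A \<inter> {0<..t}) = (of_int (digit t) + 1) * lm A - lm (A \<inter> {0<..T t})"
proof -
  have A': "A \<in> sets borel" "A \<subseteq> {0<..1}" using A by (auto simp: sets_leb_iff)
  define k where "k = nat (digit t)"
  have "0 \<le> \<beta> * t" using t beta_gt_1 by simp
  then have k: "digit t = int k" by (simp add: k_def digit_def)
  then have T_t: "T t = real k + 1 - \<beta> * t" by (simp add: T_eq)
  have kt: "real k \<le> \<beta> * t" using k by (simp add: digit_def floor_eq_iff)
  define E where "E j = (if j < k then A else A \<inter> {T t<..})" for j
  define V where "V j = (\<lambda>x. (real j + 1) + (- \<beta>) * x) -` E j" for j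
  have E: "E j \<in> sets borel" "E j \<subseteq> A" for j using A' by (auto simp: E_def)
  have V_bounds: "real j \<le> \<beta> * x" "\<beta> * x < real j + 1" if "x \<in> V j" for x j
  proof -
    have "(real j + 1) + (- \<beta>) * x \<in> {0<..1}" using that E(2)[of j] A' unfolding V_def by blast
    then show "real j \<le> \<beta> * x" "\<beta> * x < real j + 1" by auto
  qed
  have V_digit: "digit x = int j" if "x \<in> V j" for x j
    unfolding digit_def using V_bounds[OF that] by (intro floor_unique) auto
  have V_fm: "V j \<in> fmeasurable lborel" for j
    unfolding V_def using E A' beta_gt_1 by (intro fmeasurable_affine_vimage fmeasurable_unit) auto
  have V_sets: "V j \<in> sets borel" for j using fmeasurableD[OF V_fm[of j]] by simp
  \<comment> \<open>The end points are adjoined on both sides as a null set: 0 may belong to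
    \<open>V 0\<close> without lying in the domain, and \<open>t\<close> may be missed by the strict
    inequality in \<open>E k\<close>.\<close>
  have eq: "(T -` A \<inter> {0<..t}) \<union> {0, t} = (\<Union>j\<in>{..k}. V j) \<union> {0, t}"
  proof (intro equalityI subsetI)
    fix x assume "x \<in> (T -` A \<inter> {0<..t}) \<union> {0, t}"
    then consider "x \<in> {0, t}" | "0 < x" "x < t" "T x \<in> A" by force
    then show "x \<in> (\<Union>j\<in>{..k}. V j) \<union> {0, t}"
    proof cases
      case 2
      define j where "j = nat (digit x)"
      have "0 \<le> \<beta> * x" using 2 beta_gt_1 by simp
      then have j: "digit x = int j" by (simp add: j_def digit_def)
      have "digit x \<le> digit t" using 2 beta_gt_1 unfolding digit_def by (intro floor_mono) simp
      then have "j \<le> k" using j k by simp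
      moreover have "T x = real j + 1 - \<beta> * x" using j by (simp add: T_eq)
      moreover have "\<beta> * x < \<beta> * t" using 2 beta_gt_1 by simp
      ultimately have "x \<in> V j" using 2 T_t by (auto simp: V_def E_def)
      with \<open>j \<le> k\<close> show ?thesis by blast
    qed auto
  next
    fix x assume "x \<in> (\<Union>j\<in>{..k}. V j) \<union> {0, t}"
    then consider "x \<in> {0, t}" | j where "j \<le> k" "x \<in> V j" "x \<noteq> 0" by blast
    then show "x \<in> (T -` A \<inter> {0<..t}) \<union> {0, t}"
    proof cases
      case 2
      have "T x = (real j + 1) + (- \<beta>) * x" using V_digit[OF 2(2)] by (simp add: T_eq)
      then have Tx: "T x \<in> E j" using 2 by (simp add: V_def)
      have "0 \<le> \<beta> * x" using V_bounds(1)[OF 2(2)] by linarith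
      then have "0 < x" using 2(3) beta_gt_1 by (simp add: zero_le_mult_iff)
      moreover have "\<beta> * x < \<beta> * t"
      proof (cases "j < k")
        case True
        then have "real j + 1 \<le> real k" by linarith
        with V_bounds(2)[OF 2(2)] kt show ?thesis by linarith
      next
        case False
        with 2 have "j = k" by simp
        then have "T t < T x" using Tx by (simp add: E_def)
        then show ?thesis using T_t V_digit[OF 2(2)] \<open>j = k\<close> by (simp add: T_eq[of x])
      qed
      ultimately show ?thesis using Tx E(2) beta_gt_1 by auto
    qed auto
  qed
  have null: "{0, t} \<in> null_sets lborel" by (intro finite_imp_null_set_lborel) simp
  have T_sets: "T -` A \<inter> {0<..t} \<in> sets lborel"
    using measurable_sets[OF T_measurable_borel A'(1)] by auto
  have "lm (T -` A \<inter> {0<..t}) = lm ((T -` A \<inter> {0<..t}) \<union> {0, t})"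
    using measure_Un_null_set[OF T_sets null] by simp
  also have "\<dots> = lm (\<Union>j\<in>{..k}. V j)"
    unfolding eq using V_sets by (intro measure_Un_null_set null) auto
  also have "\<dots> = (\<Sum>j\<in>{..k}. lm (V j))"
  proof (rule measure_UNION')
    show "pairwise (\<lambda>i j. disjnt (V i) (V j)) {..k}"
      unfolding pairwise_def disjnt_def using V_digit by (metis disjoint_iff of_nat_eq_iff)
  qed (use V_fm in auto)
  also have "\<dots> = (\<Sum>j\<in>{..k}. lm (E j) / \<beta>)"
    unfolding V_def using beta_gt_1 E by (subst measure_lborel_affine_vimage) auto
  also have "\<dots> = (\<Sum>j<k. lm A / \<beta>) + lm (A \<inter> {T t<..}) / \<beta>"
    unfolding lessThan_Suc_atMost[symmetric] sum.lessThan_Suc by (simp add: E_def)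
  also have "A \<inter> {T t<..} = A - A \<inter> {0<..T t}" using A' by auto
  also have "lm (A - A \<inter> {0<..T t}) = lm A - lm (A \<inter> {0<..T t})"
    using A' by (intro measurable_measure_Diff fmeasurable_unit) auto
  finally show ?thesis using beta_gt_1 k by (simp add: field_simps)
qed

definition orbit1 :: "nat \<Rightarrow> real" where
  "orbit1 n = (T ^^ n) 1"

definition alt_weight :: "nat \<Rightarrow> real" where
  "alt_weight n = (- 1 / \<beta>) ^ n"

text \<open>The density of Ito and Sadahiro, an eigenfunction of the transfer operator; its sign is
  not apparent from the formula.\<close>

definition dens :: "real \<Rightarrow> real" where
  "dens x = (\<Sum>n. alt_weight n * indicator {0<..orbit1 n} x)"

lemma orbit1_unit: "orbit1 n \<in> {0<..1}"
  unfolding orbit1_def by (rule funpow_unit) simp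

lemma orbit1_0: "orbit1 0 = 1"
  by (simp add: orbit1_def)

lemma orbit1_Suc: "orbit1 (Suc n) = T (orbit1 n)"
  by (simp add: orbit1_def)

lemma abs_alt_weight: "\<bar>alt_weight n\<bar> = (1 / \<beta>) ^ n"
  using beta_gt_1 by (simp add: alt_weight_def power_abs)

lemma summable_abs_alt_weight: "summable (\<lambda>n. \<bar>alt_weight n\<bar>)"
  unfolding abs_alt_weight using beta_gt_1 by (intro summable_geometric) simp

lemma summable_alt_weight_bounded:
  fixes b :: "nat \<Rightarrow> real"
  assumes "\<And>n. \<bar>b n\<bar> \<le> 1"
  shows "summable (\<lambda>n. alt_weight n * b n)" "summable (\<lambda>n. \<bar>alt_weight n * b n\<bar>)"
    "\<bar>\<Sum>n. alt_weight n * b n\<bar> \<le> (\<Sum>n. \<bar>alt_weight n\<bar>)"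
proof -
  have le: "\<bar>alt_weight n * b n\<bar> \<le> \<bar>alt_weight n\<bar>" for n
    using assms by (simp add: abs_mult mult_left_le)
  show s: "summable (\<lambda>n. \<bar>alt_weight n * b n\<bar>)"
    using le by (intro summable_comparison_test'[OF summable_abs_alt_weight, of 0]) simp
  then show "summable (\<lambda>n. alt_weight n * b n)" by (rule summable_rabs_cancel)
  have "\<bar>\<Sum>n. alt_weight n * b n\<bar> \<le> (\<Sum>n. \<bar>alt_weight n * b n\<bar>)" by (rule summable_rabs[OF s])
  also have "\<dots> \<le> (\<Sum>n. \<bar>alt_weight n\<bar>)" by (rule suminf_le[OF le s summable_abs_alt_weight])
  finally show "\<bar>\<Sum>n. alt_weight n * b n\<bar> \<le> (\<Sum>n. \<bar>alt_weight n\<bar>)" .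
qed

lemma dens_measurable [measurable]: "dens \<in> borel_measurable leb"
proof -
  have "dens \<in> borel_measurable borel" unfolding dens_def by measurable
  then show ?thesis by (intro measurable_restrict_space1) simp
qed

lemma abs_dens_le: "\<bar>dens x\<bar> \<le> (\<Sum>n. \<bar>alt_weight n\<bar>)"
  unfolding dens_def by (rule summable_alt_weight_bounded(3)) (simp add: indicator_def)

lemma integrable_dens: "integrable leb dens"
proof -
  interpret leb: prob_space leb by (rule prob_space_unit_lborel)
  show ?thesis by (rule leb.integrable_const_bound[of _ "\<Sum>n. \<bar>alt_weight n\<bar>"]) (simp_all add: abs_dens_le)
qed

lemma set_integral_dens:
  assumes A: "A \<in> sets leb"
  shows "(\<lambda>n. alt_weight n * lm (A \<inter> {0<..orbit1 n})) sums (LINT x:A|leb. dens x)"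
proof -
  interpret leb: prob_space leb by (rule prob_space_unit_lborel)
  let ?f = "\<lambda>n x. alt_weight n * indicator (A \<inter> {0<..orbit1 n}) x :: real"
  have AI: "A \<inter> {0<..orbit1 n} \<in> sets leb" for n
    using A by (auto simp: sets_leb_iff)
  have int: "integrable leb (?f n)" for n
    using AI by (intro integrable_mult_right integrable_real_indicator) (auto simp: leb.emeasure_eq_measure)
  have meas: "measure leb (A \<inter> {0<..orbit1 n}) = lm (A \<inter> {0<..orbit1 n})" for n
    using A by (intro measure_unit_lborel) (auto simp: sets_leb_iff)
  have val: "(LINT x|leb. ?f n x) = alt_weight n * lm (A \<inter> {0<..orbit1 n})" for n
  proof -
    have "(A \<inter> {0<..orbit1 n}) \<inter> {0<..1} = A \<inter> {0<..orbit1 n}" using A by (auto simp: sets_leb_iff)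
    then show ?thesis using meas by simp
  qed
  have "(\<lambda>n. LINT x|leb. ?f n x) sums (LINT x|leb. (\<Sum>n. ?f n x))"
  proof (rule sums_integral[OF int])
    show "AE x in leb. summable (\<lambda>n. norm (?f n x))"
      using summable_alt_weight_bounded(2)[of "\<lambda>n. indicator (A \<inter> {0<..orbit1 n}) _"] by (simp add: indicator_def)
    show "summable (\<lambda>n. LINT x|leb. norm (?f n x))"
    proof (rule summable_comparison_test'[OF summable_abs_alt_weight, of 0])
      fix n
      have "(LINT x|leb. norm (?f n x)) \<le> (LINT x|leb. \<bar>alt_weight n\<bar>)"
        using int by (intro integral_mono integrable_norm) (auto simp: indicator_def)
      moreover have "(LINT x|leb. norm (?f n x)) \<ge> 0" by (intro Bochner_Integration.integral_nonneg) simp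
      ultimately show "norm (LINT x|leb. norm (?f n x)) \<le> \<bar>alt_weight n\<bar>"
        using leb.prob_space by simp
    qed
  qed
  moreover have "(LINT x|leb. (\<Sum>n. ?f n x)) = (LINT x:A|leb. dens x)"
    unfolding set_lebesgue_integral_def dens_def
    by (intro Bochner_Integration.integral_cong) (auto simp: indicator_def)
  ultimately show ?thesis by (simp only: val)
qed

text \<open>Since \<open>digit t + 1\<close> equals \<open>T t + \<beta> * t\<close>, pulling back
  \<open>A\<close> along \<open>T\<close> changes the \<open>n\<close>-th term of the series by
  \<open>G (Suc n) - G n\<close>. The differences telescope to 0: \<open>G 0\<close> vanishes
  because the orbit starts at 1, and \<open>G n\<close> decays like
  \<open>1 / \<beta> ^ n\<close>.\<close>

lemma invariant_density_dens: "invariant_density dens"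
  unfolding invariant_density_def
proof (intro conjI ballI integrable_dens)
  fix A assume A: "A \<in> sets leb"
  define F where "F n = lm (A \<inter> {0<..orbit1 n})" for n
  define G where "G n = alt_weight n * (F n - orbit1 n * lm A)" for n
  have F1: "0 \<le> F n" "F n \<le> lm A" for n
    unfolding F_def using A by (auto simp: sets_leb_iff intro!: lm_mono)
  have term_eq: "alt_weight n * lm (T -` A \<inter> {0<..1} \<inter> {0<..orbit1 n}) = alt_weight n * F n + (G (Suc n) - G n)" for n
  proof -
    have "T -` A \<inter> {0<..1} \<inter> {0<..orbit1 n} = T -` A \<inter> {0<..orbit1 n}"
      using orbit1_unit[of n] by auto
    moreover have eq: "\<beta> * lm (T -` A \<inter> {0<..orbit1 n}) =
        (orbit1 (Suc n) + \<beta> * orbit1 n) * lm A - F (Suc n)"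
      using lm_T_vimage_initial[OF orbit1_unit A, of n] by (simp add: F_def orbit1_Suc T_eq[of "orbit1 n"])
    moreover have c: "alt_weight n = - \<beta> * alt_weight (Suc n)" using beta_gt_1 by (simp add: alt_weight_def)
    moreover have "alt_weight n * lm (T -` A \<inter> {0<..orbit1 n}) =
        - alt_weight (Suc n) * ((orbit1 (Suc n) + \<beta> * orbit1 n) * lm A - F (Suc n))"
      unfolding eq[symmetric] by (simp add: c)
    ultimately show ?thesis unfolding G_def by (simp add: algebra_simps)
  qed
  have "G \<longlonglongrightarrow> 0"
  proof (rule Lim_null_comparison)
    have "\<bar>F n - orbit1 n * lm A\<bar> \<le> lm A" for n
    proof -
      have "0 \<le> orbit1 n * lm A" "orbit1 n * lm A \<le> 1 * lm A"
        using orbit1_unit[of n] by (intro mult_nonneg_nonneg mult_right_mono; simp)+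
      with F1[of n] show ?thesis by linarith
    qed
    then show "\<forall>\<^sub>F n in sequentially. norm (G n) \<le> (1 / \<beta>) ^ n * lm A"
      using beta_gt_1 by (auto simp: G_def abs_mult abs_alt_weight intro!: always_eventually mult_left_mono)
    have "(\<lambda>n. (1 / \<beta>) ^ n * lm A) \<longlonglongrightarrow> 0 * lm A"
      using beta_gt_1 by (intro tendsto_mult_right LIMSEQ_realpow_zero) auto
    then show "(\<lambda>n. (1 / \<beta>) ^ n * lm A) \<longlonglongrightarrow> 0" by simp
  qed
  then have "(\<lambda>n. G (Suc n) - G n) sums (0 - G 0)" by (rule telescope_sums)
  moreover have "G 0 = 0"
  proof -
    have "A \<inter> {0<..1} = A" using A by (auto simp: sets_leb_iff)
    then show ?thesis by (simp add: G_def F_def orbit1_def)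
  qed
  ultimately have "(\<lambda>n. alt_weight n * F n + (G (Suc n) - G n)) sums ((LINT x:A|leb. dens x) + (0 - 0))"
    using set_integral_dens[OF A] unfolding F_def[symmetric] by (intro sums_add) simp_all
  then have "(\<lambda>n. alt_weight n * lm (T -` A \<inter> {0<..1} \<inter> {0<..orbit1 n})) sums (LINT x:A|leb. dens x)"
    by (simp only: term_eq) simp
  with set_integral_dens[OF T_vimage_leb[OF A]]
  show "(LINT x:T -` A \<inter> {0<..1}|leb. dens x) = (LINT x:A|leb. dens x)" by (rule sums_unique2)
qed

text \<open>If \<open>p\<close> is the period of 1, then \<open>dens 1 = 1 + (- 1 / \<beta>)\<^sup>p * dens 1\<close>.\<close>

lemma dens_1_nonzero: "dens 1 \<noteq> 0"
proof -
  let ?b = "\<lambda>n. indicator {0<..orbit1 n} (1::real) :: real"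
  have b: "?b n = (if orbit1 n = 1 then 1 else 0)" for n
    using orbit1_unit[of n] by (auto simp: indicator_def)
  have sm: "summable (\<lambda>n. alt_weight n * ?b n)" by (rule summable_alt_weight_bounded) (simp add: indicator_def)
  show ?thesis
  proof (cases "\<exists>p\<ge>1. orbit1 p = 1")
    case False
    then have "orbit1 (Suc m) \<noteq> 1" for m by auto
    then have "alt_weight n * ?b n = (if n = 0 then 1 else 0)" for n
      by (cases n) (simp_all add: b alt_weight_def orbit1_0)
    then have "dens 1 = 1" unfolding dens_def by (simp add: sums_unique[OF sums_single[of 0 "\<lambda>_. 1::real"], symmetric])
    then show ?thesis by simp
  next
    case True
    define p where "p = (LEAST p. p \<ge> 1 \<and> orbit1 p = 1)"
    have p: "p \<ge> 1" "orbit1 p = 1" using LeastI_ex[OF True[unfolded Bex_def]] True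
      unfolding p_def by (metis (mono_tags, lifting) LeastI)+
    have least: "orbit1 i \<noteq> 1" if "1 \<le> i" "i < p" for i
      using not_less_Least[of i "\<lambda>p. p \<ge> 1 \<and> orbit1 p = 1"] that unfolding p_def by blast
    have shift: "orbit1 (n + p) = orbit1 n" for n
      using p(2) by (simp add: orbit1_def funpow_add)
    have "dens 1 = (\<Sum>n. alt_weight (n + p) * ?b (n + p)) + (\<Sum>n<p. alt_weight n * ?b n)"
      unfolding dens_def by (rule suminf_split_initial_segment[OF sm])
    also have "(\<Sum>n<p. alt_weight n * ?b n) = (\<Sum>n<p. if n = 0 then 1 else 0)"
      using least by (intro sum.cong) (auto simp: b alt_weight_def orbit1_0 Suc_le_eq)
    also have "\<dots> = 1" using p(1) by simp
    also have "(\<Sum>n. alt_weight (n + p) * ?b (n + p)) = (\<Sum>n. alt_weight p * (alt_weight n * ?b n))"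
      by (simp add: shift alt_weight_def power_add mult_ac)
    also have "\<dots> = alt_weight p * dens 1"
      unfolding dens_def by (rule suminf_mult[OF sm])
    finally show ?thesis by auto
  qed
qed

text \<open>Left continuity at 1. Among the first \<open>N\<close> terms, those with
  \<open>orbit1 n = 1\<close> are constant on the unit interval, and the others vanish to the right
  of \<open>orbit1 n\<close>, so only the small tail can vary near 1.\<close>

lemma dens_near_1:
  obtains e where "0 < e" "e \<le> 1" "\<And>x. x \<in> {1 - e<..1} \<Longrightarrow> \<bar>dens 1\<bar> / 2 \<le> \<bar>dens x\<bar>"
proof -
  have "(\<lambda>N. \<Sum>n. \<bar>alt_weight (n + N)\<bar>) \<longlonglongrightarrow> 0"
    by (rule suminf_exist_split2[OF summable_abs_alt_weight])
  then have "\<forall>\<^sub>F N in sequentially. (\<Sum>n. \<bar>alt_weight (n + N)\<bar>) < \<bar>dens 1\<bar> / 2"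
    using dens_1_nonzero by (intro order_tendstoD(2)) auto
  then obtain N where N: "(\<Sum>n. \<bar>alt_weight (n + N)\<bar>) < \<bar>dens 1\<bar> / 2"
    by (auto dest: eventually_happens)
  \<comment> \<open>The distance from 1 to the other points among the first \<open>N\<close> of the
    orbit; inserting 1 makes the set nonempty and caps \<open>e\<close>.\<close>
  define e where "e = Min (insert 1 ((\<lambda>n. 1 - orbit1 n) ` {n. n < N \<and> orbit1 n \<noteq> 1}))"
  have "orbit1 n < 1" if "orbit1 n \<noteq> 1" for n using orbit1_unit[of n] that by auto
  then have e: "0 < e" "e \<le> 1" unfolding e_def by (auto simp: Min_gr_iff)
  have e_le: "e \<le> 1 - orbit1 n" if "n < N" "orbit1 n \<noteq> 1" for n
    unfolding e_def using that by (intro Min_le) auto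
  show ?thesis
  proof (rule that[OF e])
    fix x assume x: "x \<in> {1 - e<..1}"
    let ?d = "\<lambda>n. indicator {0<..orbit1 n} x - indicator {0<..orbit1 n} 1 :: real"
    have d0: "?d n = 0" if "n < N" for n
    proof (cases "orbit1 n = 1")
      case True
      then show ?thesis using x e by (simp add: indicator_def)
    next
      case False
      then show ?thesis using e_le[OF that False] x orbit1_unit[of n] by (simp add: indicator_def)
    qed
    have d1: "\<bar>?d n\<bar> \<le> 1" for n by (simp add: indicator_def)
    have sm: "summable (\<lambda>n. alt_weight n * ?d n)" "summable (\<lambda>n. \<bar>alt_weight n * ?d n\<bar>)"
      by (rule summable_alt_weight_bounded[OF d1])+
    have "dens x - dens 1 = (\<Sum>n. alt_weight n * ?d n)"
      unfolding dens_def right_diff_distrib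
      by (intro suminf_diff summable_alt_weight_bounded) (auto simp: indicator_def)
    also have "\<dots> = (\<Sum>n. alt_weight (n + N) * ?d (n + N))"
      using suminf_split_initial_segment[OF sm(1), of N] d0 by simp
    finally have "\<bar>dens x - dens 1\<bar> \<le> (\<Sum>n. \<bar>alt_weight (n + N) * ?d (n + N)\<bar>)"
      using summable_rabs[of "\<lambda>n. alt_weight (n + N) * ?d (n + N)"] summable_ignore_initial_segment[OF sm(2), of N] by simp
    also have "\<dots> \<le> (\<Sum>n. \<bar>alt_weight (n + N)\<bar>)"
    proof (rule suminf_le)
      show "\<bar>alt_weight (n + N) * ?d (n + N)\<bar> \<le> \<bar>alt_weight (n + N)\<bar>" for n
        using d1[of "n + N"] by (simp only: abs_mult) (rule mult_left_le, auto)
      show "summable (\<lambda>n. \<bar>alt_weight (n + N) * ?d (n + N)\<bar>)"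
        using summable_ignore_initial_segment[OF sm(2), of N] by simp
      show "summable (\<lambda>n. \<bar>alt_weight (n + N)\<bar>)"
        using summable_ignore_initial_segment[OF summable_abs_alt_weight, of N] by simp
    qed
    finally show "\<bar>dens 1\<bar> / 2 \<le> \<bar>dens x\<bar>" using N by linarith
  qed
qed

text \<open>The positive and negative parts add up to the absolute value of \<open>dens\<close>,
  which is bounded away from 0 near 1, so one of them has positive integral.\<close>

lemma exists_nonneg_bounded_invariant_density:
  obtains g B where "invariant_density g" "\<And>x. 0 \<le> g x" "\<And>x. g x \<le> B" "(LINT x|leb. g x) > 0"
proof -
  let ?p = "\<lambda>x. max 0 (dens x)" and ?m = "\<lambda>x. max 0 (- dens x)"
  interpret leb: prob_space leb by (rule prob_space_unit_lborel)
  have p: "invariant_density ?p" and m: "invariant_density ?m"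
    using invariant_density_pos_part[OF invariant_density_dens]
      invariant_density_pos_part[OF invariant_density_uminus[OF invariant_density_dens]] .
  have int: "integrable leb ?p" "integrable leb ?m" using p m by (auto simp: invariant_density_def)
  obtain e where e: "0 < e" "e \<le> 1" "\<And>x. x \<in> {1 - e<..1} \<Longrightarrow> \<bar>dens 1\<bar> / 2 \<le> \<bar>dens x\<bar>"
    using dens_near_1 by blast
  have I: "{1 - e<..1} \<in> sets leb" using e by (auto simp: sets_leb_iff)
  have "0 < \<bar>dens 1\<bar> / 2 * e" using dens_1_nonzero e by simp
  also have "\<dots> = (LINT x|leb. \<bar>dens 1\<bar> / 2 * indicator {1 - e<..1} x)"
  proof -
    have "{1 - e<..1} \<inter> {0<..1} = {1 - e<..1}" using e by auto
    moreover have "measure leb {1 - e<..1} = e" using e by (subst measure_unit_lborel) auto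
    ultimately show ?thesis by simp
  qed
  also have "\<dots> \<le> (LINT x|leb. ?p x + ?m x)"
  proof (rule integral_mono)
    show "integrable leb (\<lambda>x. \<bar>dens 1\<bar> / 2 * indicator {1 - e<..1} x)"
      using I by (intro integrable_mult_right integrable_real_indicator) (auto simp: leb.emeasure_eq_measure)
    show "integrable leb (\<lambda>x. ?p x + ?m x)" using int by (rule Bochner_Integration.integrable_add)
    show "\<bar>dens 1\<bar> / 2 * indicator {1 - e<..1} x \<le> ?p x + ?m x" for x
      using e(3)[of x] by (auto simp: indicator_def max_def split: if_splits)
  qed
  also have "\<dots> = (LINT x|leb. ?p x) + (LINT x|leb. ?m x)" using int by (rule Bochner_Integration.integral_add)
  finally have "(LINT x|leb. ?p x) > 0 \<or> (LINT x|leb. ?m x) > 0" by linarith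
  moreover have "?p x \<le> (\<Sum>n. \<bar>alt_weight n\<bar>)" "?m x \<le> (\<Sum>n. \<bar>alt_weight n\<bar>)" for x
    using abs_dens_le[of x] by (auto simp: abs_if split: if_splits)
  ultimately show ?thesis using that[OF p] that[OF m] by (metis max.cobounded1)
qed

lemma exists_maximal_abs_continuous:
  obtains \<mu> where "invariant_prob unit_borel T \<mu>" "ks_entropy \<mu> T = ereal (ln \<beta>)"
    "\<And>A. A \<in> sets \<mu> \<Longrightarrow> lm A = 0 \<Longrightarrow> measure \<mu> A = 0"
proof -
  obtain g B where g: "invariant_density g" "\<And>x. 0 \<le> g x" "\<And>x. g x \<le> B" "(LINT x|leb. g x) > 0"
    using exists_nonneg_bounded_invariant_density by blast
  interpret leb: prob_space leb by (rule prob_space_unit_lborel)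
  define c where "c = (LINT x|leb. g x)"
  define \<mu> where "\<mu> = density leb (\<lambda>x. ennreal (g x / c))"
  have c: "c > 0" using g by (simp add: c_def)
  have inv: "invariant_prob unit_borel T \<mu>"
    unfolding \<mu>_def by (rule invariant_prob_density[OF g(1,2) c_def c])
  interpret neg_beta_invariant_measure \<beta> \<mu> by unfold_locales (rule inv)
  have int_g: "integrable leb g" using g(1) by (simp add: invariant_density_def)
  \<comment> \<open>The absolute value and the added 1 make the constant positive whatever the sign
    of \<open>B\<close>.\<close>
  define D where "D = (\<bar>B\<bar> + 1) / c"
  have D: "D > 0" using c by (simp add: D_def)
  have le: "measure \<mu> A \<le> D * lm A" if "A \<in> sets \<mu>" for A
  proof -
    have A: "A \<in> sets leb" using that by (simp add: \<mu>_def)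
    have A': "A \<inter> {0<..1} = A" "measure leb A = lm A"
      using A measure_unit_lborel by (auto simp: sets_leb_iff)
    have "(LINT x:A|leb. g x) \<le> (LINT x|leb. (\<bar>B\<bar> + 1) * indicator A x)"
      unfolding set_lebesgue_integral_def
    proof (rule integral_mono)
      show "integrable leb (\<lambda>x. indicator A x *\<^sub>R g x)"
        using set_integrable_leb[OF int_g A] by (simp add: set_integrable_def)
      show "integrable leb (\<lambda>x. (\<bar>B\<bar> + 1) * indicator A x)"
        using A by (intro integrable_mult_right integrable_real_indicator) (auto simp: leb.emeasure_eq_measure)
      show "indicator A x *\<^sub>R g x \<le> (\<bar>B\<bar> + 1) * indicator A x" for x
        using g(3)[of x] by (auto simp: indicator_def)
    qed
    also have "\<dots> = (\<bar>B\<bar> + 1) * lm A" using A' by simp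
    finally show ?thesis
      using measure_invariant_density[OF g(1,2) c_def c A] c
      unfolding \<mu>_def[symmetric] D_def by (simp add: divide_right_mono)
  qed
  show ?thesis
  proof (rule that[OF inv])
    show "ks_entropy \<mu> T = ereal (ln \<beta>)"
      using ent_rate_lower[OF D le] ent_rate_upper by (simp add: ks_entropy_eq)
    show "measure \<mu> A = 0" if "A \<in> sets \<mu>" "lm A = 0" for A
      using le[OF that(1)] that(2) by (simp add: order_antisym)
  qed
qed

end

theorem corollary2p4:
  fixes \<beta> :: real
  assumes "\<beta> > 1"
  shows "intrinsic unit_borel (T_neg_beta \<beta>)"
proof -
  interpret neg_beta \<beta> by unfold_locales (rule assms)
  obtain \<mu> where \<mu>: "invariant_prob unit_borel T \<mu>" "ks_entropy \<mu> T = ereal (ln \<beta>)"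
      "\<And>A. A \<in> sets \<mu> \<Longrightarrow> lm A = 0 \<Longrightarrow> measure \<mu> A = 0"
    using exists_maximal_abs_continuous by blast
  have ks: "\<exists>h. ks_entropy \<nu> T = ereal h \<and> h \<le> ln \<beta> \<and>
      (ln \<beta> \<le> h \<longrightarrow> (\<forall>A\<in>sets \<nu>. lm A = 0 \<longrightarrow> measure \<nu> A = 0))"
    if "invariant_prob unit_borel T \<nu>" for \<nu>
  proof -
    interpret neg_beta_invariant_measure \<beta> \<nu> by unfold_locales (rule that)
    show ?thesis using ks_entropy_eq ent_rate_upper max_ent_abs_continuous by blast
  qed
  show ?thesis
    unfolding intrinsic_def
  proof (rule ex1I)
    show "maximal_entropy_measure unit_borel T \<mu>"
      unfolding maximal_entropy_measure_def using \<mu>(1,2) ks by fastforce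
    fix \<nu> assume "maximal_entropy_measure unit_borel T \<nu>"
    then have \<nu>: "invariant_prob unit_borel T \<nu>" "ks_entropy \<mu> T \<le> ks_entropy \<nu> T"
      using \<mu>(1) by (auto simp: maximal_entropy_measure_def)
    \<comment> \<open>Maximality compared with \<open>\<mu>\<close> forces the entropy of
      \<open>\<nu>\<close> up to \<open>ln \<beta>\<close>, where absolute continuity is
      automatic.\<close>
    with ks[OF \<nu>(1)] \<mu>(2) have "measure \<nu> A = 0" if "A \<in> sets \<nu>" "lm A = 0" for A
      using that by auto
    then show "\<nu> = \<mu>" by (intro unique_abs_continuous_invariant \<nu>(1) \<mu>) auto
  qed
qed

end
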